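(* Let $K$ be a field of characteristic zero, $\mathfrak g$ a split simple Lie algebra over $K$, and $r\in\mathfrak g\otimes\mathfrak g$ an $r$-matrix with $r+\kappa(r)=\lambda\Omega$ for some $\lambda\in K^*$. Let $\alpha\in\overline K^*$. The set of $K$-isomorphism classes of $K$-Lie bialgebras that become isomorphic to $(\overline{\mathfrak g},\alpha\partial r)$ over $\overline K$ is in bijection with (1) $H^1_{\mathrm{Gal}}(K,\mathbf{Aut}(\mathfrak g,\partial r))$, if $\alpha\in K^*$; (2) $\overline H^1_{\mathrm{Gal}}(K,\mathbf{Aut}(\mathfrak g,\partial r),\alpha)$, if $\alpha^2\in K^*\setminus K^{*2}$; (3) the empty set, otherwise.
   Context: $\overline K$ is an algebraic closure of $K$, $\mathrm{Gal}(F)=\mathrm{Gal}(\overline K/F)$, $\overline{\mathfrak g}=\mathfrak g\otimes_K\overline K$, $\kappa$ the flip of tensor factors, $\Omega$ the Casimir element of $\mathfrak g$ for a fixed nondegenerate invariant symmetric bilinear form coming from the split $\mathbb Q$-form. A Lie bialgebra is a Lie algebra $\mathfrak g$ with a Lie cobracket $\delta:\mathfrak g\to\mathfrak g\otimes\mathfrak g$ (antisymmetric, co-Jacobi) satisfying $\delta([a,b])=(\mathrm{ad}_a\otimes1+1\otimes\mathrm{ad}_a)\delta(b)-(\mathrm{ad}_b\otimes1+1\otimes\mathrm{ad}_b)\delta(a)$; morphisms are Lie algebra morphisms $\phi$ with $(\phi\otimes\phi)\delta=\delta'\phi$. An $r$-matrix on $\mathfrak g$ is $r\in\mathfrak g\otimes\mathfrak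 g$ with $\mathrm{CYB}(r)=[r_{12},r_{13}]+[r_{12},r_{23}]+[r_{13},r_{23}]=0$ and $r+\kappa(r)=\lambda\Omega$ for some scalar $\lambda$; then $\partial r(a)=(\mathrm{ad}_a\otimes1+1\otimes\mathrm{ad}_a)(r)$ is a Lie bialgebra structure. $\mathbf{Aut}(\mathfrak g,\partial r)$ is its automorphism group scheme, and $H^1_{\mathrm{Gal}}(K,-)$ is the first non-abelian Galois cohomology set. For $\alpha\in\overline K^*$ with $\alpha^2\in K^*\setminus K^{*2}$, $\overline Z^1_\alpha$ denotes the set of all $\mathrm{Gal}(K)$-cocycles $(u_\gamma)$ with values in $\mathbf{Aut}(\mathfrak g)(\overline K)$ (continuous, $u_{\gamma\eta}=u_\gamma{}^\gamma u_\eta$) such that $(u_\gamma\otimes u_\gamma)(r)=r$ if $\gamma\in\mathrm{Gal}(K(\alpha))$ and $(u_\gamma\otimes u_\gamma)(r)=\kappa(r)$ if $\gamma(\alpha)=-\alpha$. On $\overline Z^1_\alpha$ put $(v_\gamma)\sim(u_\gamma)$ iff there exists $\rho\in\mathbf{Aut}(\mathfrak g,\partial r)(\overline K)$ with $v_\gamma=\rho^{-1}u_\gamma{}^\gamma\rho$ for all $\gamma$. Then $\overline H^1_{\mathrm{Gal}}(K,\mathbf{Aut}(\mathfrak g,\partial r),\alpha)$ is the set of equivalence classes $\overline Z^1_\alpha/\!\sim$. *)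

theory Defs
  imports
    "HOL-Analysis.Analysis"
    "HOL-Algebra.Generated_Fields"
    "HOL-Algebra.Algebraic_Closure_Type"
    "HOL-Library.Equipollence"
begin

unbundle no fps_syntax

section \<open>Tensor products of coordinate spaces and extension of scalars\<close>

text \<open>
  An \<open>n\<close>-dimensional vector space over \<open>K\<close> is rendered as \<^typ>\<open>'k ^ 'n\<close> with scalar
  multiplication \<^term>\<open>(*s)\<close>, and \<open>K\<^sup>m \<otimes> K\<^sup>n\<close> as \<^typ>\<open>'k ^ ('m \<times> 'n)\<close>, the
  entry at \<open>(i, j)\<close> being the coefficient of \<open>e\<^sub>i \<otimes> e\<^sub>j\<close>. In particular
  \<open>V \<otimes> V \<otimes> V\<close> is bracketed as \<open>V \<otimes> (V \<otimes> V)\<close>.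
\<close>

abbreviation lin :: "('a::field ^ 'm \<Rightarrow> 'a ^ 'n) \<Rightarrow> bool" where
  "lin \<equiv> Vector_Spaces.linear (*s) (*s)"

abbreviation basis_vec :: "'n \<Rightarrow> 'a::field ^ 'n" where
  "basis_vec i \<equiv> axis i 1"

definition tensor :: "'a::field ^ 'm::finite \<Rightarrow> 'a ^ 'n::finite \<Rightarrow> 'a ^ ('m \<times> 'n)" where
  "tensor a b = (\<chi> p. a $ fst p * b $ snd p)"

text \<open>\<open>\<phi> \<otimes> \<psi>\<close> for linear \<open>\<phi>\<close> and \<open>\<psi>\<close>.\<close>

definition tensor_map ::
    "('a::field ^ 'm::finite \<Rightarrow> 'a ^ 'p::finite) \<Rightarrow> ('a ^ 'n::finite \<Rightarrow> 'a ^ 'q::finite) \<Rightarrow> 'a ^ ('m \<times> 'n) \<Rightarrow> 'a ^ ('p \<times> 'q)" where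
  "tensor_map \<phi> \<psi> T =
     (\<Sum>i\<in>UNIV. \<Sum>j\<in>UNIV. T $ (i, j) *s tensor (\<phi> (basis_vec i)) (\<psi> (basis_vec j)))"

definition flip :: "'a::field ^ ('n::finite \<times> 'n) \<Rightarrow> 'a ^ ('n \<times> 'n)" where
  "flip T = (\<chi> p. T $ (snd p, fst p))"

text \<open>\<open>a \<otimes> b \<otimes> c \<mapsto> c \<otimes> a \<otimes> b\<close>\<close>

definition cycle3 :: "'a::field ^ ('n::finite \<times> 'n \<times> 'n) \<Rightarrow> 'a ^ ('n \<times> 'n \<times> 'n)" where
  "cycle3 T = (\<chi> p. T $ (fst (snd p), snd (snd p), fst p))"

text \<open>The coordinatewise action of a field homomorphism \<open>f\<close>.\<close>

definition vmap :: "('a \<Rightarrow> 'b) \<Rightarrow> 'a ^ 'n \<Rightarrow> 'b ^ 'n" where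
  "vmap f x = (\<chi> i. f (x $ i))"

text \<open>
  Extension of scalars along a field homomorphism \<open>f\<close> of linear maps, bilinear maps and
  bilinear forms: the extended map takes the same values on the standard basis.
\<close>

definition ext_lin ::
    "('a \<Rightarrow> 'b) \<Rightarrow> ('a::field ^ 'm \<Rightarrow> 'a ^ 'n) \<Rightarrow> 'b::field ^ 'm \<Rightarrow> 'b ^ 'n" where
  "ext_lin f \<phi> x = (\<Sum>i\<in>UNIV. x $ i *s vmap f (\<phi> (basis_vec i)))"

definition ext_bilin ::
    "('a \<Rightarrow> 'b) \<Rightarrow> ('a::field ^ 'n \<Rightarrow> 'a ^ 'n \<Rightarrow> 'a ^ 'n)
      \<Rightarrow> 'b::field ^ 'n \<Rightarrow> 'b ^ 'n \<Rightarrow> 'b ^ 'n" where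
  "ext_bilin f \<beta> x y =
     (\<Sum>i\<in>UNIV. \<Sum>j\<in>UNIV. (x $ i * y $ j) *s vmap f (\<beta> (basis_vec i) (basis_vec j)))"

definition ext_form ::
    "('a \<Rightarrow> 'b) \<Rightarrow> ('a::field ^ 'n \<Rightarrow> 'a ^ 'n \<Rightarrow> 'a) \<Rightarrow> 'b::field ^ 'n \<Rightarrow> 'b ^ 'n \<Rightarrow> 'b" where
  "ext_form f B x y =
     (\<Sum>i\<in>UNIV. \<Sum>j\<in>UNIV. x $ i * y $ j * f (B (basis_vec i) (basis_vec j)))"


section \<open>Lie algebras\<close>

type_synonym ('a, 'n) bracket = "'a ^ 'n \<Rightarrow> 'a ^ 'n \<Rightarrow> 'a ^ 'n"

definition lie_algebra :: "('a::field, 'n::finite) bracket \<Rightarrow> bool" where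
  "lie_algebra br \<longleftrightarrow>
     (\<forall>x. lin (br x)) \<and> (\<forall>y. lin (\<lambda>x. br x y)) \<and>
     (\<forall>x. br x x = 0) \<and>
     (\<forall>x y z. br x (br y z) + br y (br z x) + br z (br x y) = 0)"

definition lie_iso ::
    "('a::field, 'n::finite) bracket \<Rightarrow> ('a, 'n) bracket \<Rightarrow> ('a ^ 'n \<Rightarrow> 'a ^ 'n) \<Rightarrow> bool" where
  "lie_iso br br' \<phi> \<longleftrightarrow> lin \<phi> \<and> bij \<phi> \<and> (\<forall>x y. \<phi> (br x y) = br' (\<phi> x) (\<phi> y))"

definition lie_ideal :: "('a::field, 'n::finite) bracket \<Rightarrow> ('a ^ 'n) set \<Rightarrow> bool" where
  "lie_ideal br I \<longleftrightarrow> vec.subspace I \<and> (\<forall>x. \<forall>y\<in>I. br x y \<in> I)"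

definition simple_lie :: "('a::field, 'n::finite) bracket \<Rightarrow> bool" where
  "simple_lie br \<longleftrightarrow>
     lie_algebra br \<and> (\<exists>x y. br x y \<noteq> 0) \<and> (\<forall>I. lie_ideal br I \<longrightarrow> I = {0} \<or> I = UNIV)"

definition lie_subalgebra :: "('a::field, 'n::finite) bracket \<Rightarrow> ('a ^ 'n) set \<Rightarrow> bool" where
  "lie_subalgebra br H \<longleftrightarrow> vec.subspace H \<and> (\<forall>x\<in>H. \<forall>y\<in>H. br x y \<in> H)"

fun lower_central :: "('a::field, 'n::finite) bracket \<Rightarrow> ('a ^ 'n) set \<Rightarrow> nat \<Rightarrow> ('a ^ 'n) set" where
  "lower_central br H 0 = H"
| "lower_central br H (Suc m) = vec.span {br x y | x y. x \<in> H \<and> y \<in> lower_central br H m}"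

definition cartan_subalgebra :: "('a::field, 'n::finite) bracket \<Rightarrow> ('a ^ 'n) set \<Rightarrow> bool" where
  "cartan_subalgebra br H \<longleftrightarrow>
     lie_subalgebra br H \<and> (\<exists>m. lower_central br H m = {0}) \<and> {x. \<forall>y\<in>H. br x y \<in> H} = H"

definition diagonalizable :: "('a::field ^ 'n \<Rightarrow> 'a ^ 'n) \<Rightarrow> bool" where
  "diagonalizable \<phi> \<longleftrightarrow> vec.span {v. \<exists>c. \<phi> v = c *s v} = UNIV"

text \<open>Split: there is a Cartan subalgebra all of whose elements are ad-diagonalizable over the
  ground field.\<close>

definition split_simple_lie :: "('a::field, 'n::finite) bracket \<Rightarrow> bool" where
  "split_simple_lie br \<longleftrightarrow>
     simple_lie br \<and> (\<exists>H. cartan_subalgebra br H \<and> (\<forall>h\<in>H. diagonalizable (br h)))"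

definition invariant_form ::
    "('a::field, 'n::finite) bracket \<Rightarrow> ('a ^ 'n \<Rightarrow> 'a ^ 'n \<Rightarrow> 'a) \<Rightarrow> bool" where
  "invariant_form br B \<longleftrightarrow>
     (\<forall>x. Vector_Spaces.linear (*s) (*) (B x)) \<and>
     (\<forall>y. Vector_Spaces.linear (*s) (*) (\<lambda>x. B x y)) \<and>
     (\<forall>x y. B x y = B y x) \<and>
     (\<forall>x. (\<forall>y. B x y = 0) \<longrightarrow> x = 0) \<and>
     (\<forall>x y z. B (br x y) z = B x (br y z))"

text \<open>\<open>(\<gg>, B)\<close> is obtained by extension of scalars from a split simple Lie algebra over the
  rationals with a nondegenerate invariant symmetric bilinear form.\<close>

definition from_split_rational_form ::
    "('k::field_char_0, 'n::finite) bracket \<Rightarrow> ('k ^ 'n \<Rightarrow> 'k ^ 'n \<Rightarrow> 'k) \<Rightarrow> bool" where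
  "from_split_rational_form br B \<longleftrightarrow>
     (\<exists>(br\<^sub>0 :: (rat, 'n) bracket) B\<^sub>0 \<phi>.
        split_simple_lie br\<^sub>0 \<and> invariant_form br\<^sub>0 B\<^sub>0 \<and>
        lie_iso (ext_bilin of_rat br\<^sub>0) br \<phi> \<and>
        (\<forall>x y. B (\<phi> x) (\<phi> y) = ext_form of_rat B\<^sub>0 x y))"

definition dual_basis_vec :: "('a::field ^ 'n::finite \<Rightarrow> 'a ^ 'n \<Rightarrow> 'a) \<Rightarrow> 'n \<Rightarrow> 'a ^ 'n" where
  "dual_basis_vec B i = (THE y. \<forall>j. B y (basis_vec j) = (if i = j then 1 else 0))"

definition casimir :: "('a::field ^ 'n::finite \<Rightarrow> 'a ^ 'n \<Rightarrow> 'a) \<Rightarrow> 'a ^ ('n \<times> 'n)" where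
  "casimir B = (\<Sum>i\<in>UNIV. tensor (basis_vec i) (dual_basis_vec B i))"


section \<open>Lie bialgebras and r-matrices\<close>

type_synonym ('a, 'n) cobracket = "'a ^ 'n \<Rightarrow> 'a ^ ('n \<times> 'n)"

text \<open>\<open>ad\<^sub>a \<otimes> 1 + 1 \<otimes> ad\<^sub>a\<close>\<close>

definition ad2 ::
    "('a::field, 'n::finite) bracket \<Rightarrow> 'a ^ 'n \<Rightarrow> 'a ^ ('n \<times> 'n) \<Rightarrow> 'a ^ ('n \<times> 'n)" where
  "ad2 br a T = tensor_map (br a) id T + tensor_map id (br a) T"

text \<open>The co-Jacobi identity is the vanishing of the cyclic sum of \<open>(1 \<otimes> \<delta>) \<delta>\<close>.\<close>

definition lie_bialgebra ::
    "('a::field, 'n::finite) bracket \<Rightarrow> ('a, 'n) cobracket \<Rightarrow> bool" where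
  "lie_bialgebra br \<delta> \<longleftrightarrow>
     lie_algebra br \<and> lin \<delta> \<and>
     (\<forall>x. flip (\<delta> x) = - \<delta> x) \<and>
     (\<forall>x. let T = tensor_map id \<delta> (\<delta> x) in T + cycle3 T + cycle3 (cycle3 T) = 0) \<and>
     (\<forall>a b. \<delta> (br a b) = ad2 br a (\<delta> b) - ad2 br b (\<delta> a))"

definition lie_bialgebra_iso ::
    "('a::field, 'n::finite) bracket \<Rightarrow> ('a, 'n) cobracket \<Rightarrow>
     ('a, 'n) bracket \<Rightarrow> ('a, 'n) cobracket \<Rightarrow> ('a ^ 'n \<Rightarrow> 'a ^ 'n) \<Rightarrow> bool" where
  "lie_bialgebra_iso br \<delta> br' \<delta>' \<phi> \<longleftrightarrow>
     lie_iso br br' \<phi> \<and> (\<forall>x. tensor_map \<phi> \<phi> (\<delta> x) = \<delta>' (\<phi> x))"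

text \<open>\<open>[r\<^sub>1\<^sub>2, r\<^sub>1\<^sub>3] + [r\<^sub>1\<^sub>2, r\<^sub>2\<^sub>3] + [r\<^sub>1\<^sub>3, r\<^sub>2\<^sub>3]\<close>, with the first factor of each
  commutator expanded as the sum of \<open>r\<^sub>i\<^sub>j e\<^sub>i \<otimes> e\<^sub>j\<close> and the second as that of
  \<open>r\<^sub>k\<^sub>l e\<^sub>k \<otimes> e\<^sub>l\<close>.\<close>

definition CYB ::
    "('a::field, 'n::finite) bracket \<Rightarrow> 'a ^ ('n \<times> 'n) \<Rightarrow> 'a ^ ('n \<times> 'n \<times> 'n)" where
  "CYB br r = (\<Sum>i\<in>UNIV. \<Sum>j\<in>UNIV. \<Sum>k\<in>UNIV. \<Sum>l\<in>UNIV. (r $ (i, j) * r $ (k, l)) *s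
     (tensor (br (basis_vec i) (basis_vec k)) (tensor (basis_vec j) (basis_vec l)) +
      tensor (basis_vec i) (tensor (br (basis_vec j) (basis_vec k)) (basis_vec l)) +
      tensor (basis_vec i) (tensor (basis_vec k) (br (basis_vec j) (basis_vec l)))))"

definition r_matrix ::
    "('a::field, 'n::finite) bracket \<Rightarrow> ('a ^ 'n \<Rightarrow> 'a ^ 'n \<Rightarrow> 'a) \<Rightarrow> 'a ^ ('n \<times> 'n) \<Rightarrow> bool" where
  "r_matrix br B r \<longleftrightarrow> CYB br r = 0 \<and> (\<exists>c. r + flip r = c *s casimir B)"

definition coboundary ::
    "('a::field, 'n::finite) bracket \<Rightarrow> 'a ^ ('n \<times> 'n) \<Rightarrow> ('a, 'n) cobracket" where
  "coboundary br r a = ad2 br a r"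


section \<open>Galois cohomology\<close>

definition gal :: "'k::field alg_closure set \<Rightarrow> ('k alg_closure \<Rightarrow> 'k alg_closure) set" where
  "gal F = {\<sigma>. bij \<sigma> \<and> (\<forall>x y. \<sigma> (x + y) = \<sigma> x + \<sigma> y) \<and> (\<forall>x y. \<sigma> (x * y) = \<sigma> x * \<sigma> y) \<and>
             (\<forall>x\<in>F. \<sigma> x = x)}"

abbreviation abs_gal :: "('k::field alg_closure \<Rightarrow> 'k alg_closure) set" where
  "abs_gal \<equiv> gal (range to_ac)"

text \<open>\<open>K(\<alpha>)\<close> inside the algebraic closure of \<open>K\<close>\<close>

definition adjoin :: "'k::field alg_closure \<Rightarrow> 'k alg_closure set" where
  "adjoin \<alpha> = generate_field ring_of_type_algebra (insert \<alpha> (range to_ac))"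

text \<open>The Krull topology is the topology of pointwise convergence, with the algebraic closure
  carrying the discrete topology.\<close>

definition krull_topology :: "('k::field alg_closure \<Rightarrow> 'k alg_closure) topology" where
  "krull_topology = subtopology (product_topology (\<lambda>_. discrete_topology UNIV) UNIV) abs_gal"

type_synonym ('k, 'n) geom_map = "'k alg_closure ^ 'n \<Rightarrow> 'k alg_closure ^ 'n"

type_synonym ('k, 'n) cochain = "('k alg_closure \<Rightarrow> 'k alg_closure) \<Rightarrow> ('k, 'n) geom_map"

definition gal_act ::
    "('k::field alg_closure \<Rightarrow> 'k alg_closure) \<Rightarrow> ('k, 'n::finite) geom_map \<Rightarrow> ('k, 'n) geom_map" where
  "gal_act \<gamma> u = vmap \<gamma> \<circ> u \<circ> vmap (inv_into UNIV \<gamma>)"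

text \<open>
  Below, \<open>A\<close> is the set of points over the algebraic closure of a group scheme of automorphisms.
  Cochains are extensional functions on the absolute Galois group.
\<close>

definition gal_cocycles :: "('k::field, 'n::finite) geom_map set \<Rightarrow> ('k, 'n) cochain set" where
  "gal_cocycles A = {u \<in> abs_gal \<rightarrow>\<^sub>E A.
     continuous_map krull_topology (discrete_topology A) u \<and>
     (\<forall>\<gamma>\<in>abs_gal. \<forall>\<eta>\<in>abs_gal. u (\<gamma> \<circ> \<eta>) = u \<gamma> \<circ> gal_act \<gamma> (u \<eta>))}"

definition cohomologous ::
    "('k::field, 'n::finite) geom_map set \<Rightarrow> ('k, 'n) cochain set \<Rightarrow>
     (('k, 'n) cochain \<times> ('k, 'n) cochain) set" where
  "cohomologous A Z = {(u, v). u \<in> Z \<and> v \<in> Z \<and>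
     (\<exists>\<rho>\<in>A. \<forall>\<gamma>\<in>abs_gal. v \<gamma> = inv_into UNIV \<rho> \<circ> u \<gamma> \<circ> gal_act \<gamma> \<rho>)}"

definition H1_gal :: "('k::field, 'n::finite) geom_map set \<Rightarrow> ('k, 'n) cochain set set" where
  "H1_gal A = gal_cocycles A // cohomologous A (gal_cocycles A)"

text \<open>The points over the algebraic closure of the automorphism group schemes of \<open>\<gg>\<close> and of
  \<open>(\<gg>, \<partial>r)\<close>\<close>

definition aut_lie :: "('k::field, 'n::finite) bracket \<Rightarrow> ('k, 'n) geom_map set" where
  "aut_lie br = {\<phi>. lie_iso (ext_bilin to_ac br) (ext_bilin to_ac br) \<phi>}"

definition aut_bialgebra ::
    "('k::field, 'n::finite) bracket \<Rightarrow> ('k, 'n) cobracket \<Rightarrow> ('k, 'n) geom_map set" where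
  "aut_bialgebra br \<delta> = {\<phi>.
     lie_bialgebra_iso (ext_bilin to_ac br) (ext_lin to_ac \<delta>)
       (ext_bilin to_ac br) (ext_lin to_ac \<delta>) \<phi>}"

definition twisted_cocycles ::
    "('k::field, 'n::finite) bracket \<Rightarrow> 'k ^ ('n \<times> 'n) \<Rightarrow> 'k alg_closure \<Rightarrow> ('k, 'n) cochain set"
    where
  "twisted_cocycles br r \<alpha> = {u \<in> gal_cocycles (aut_lie br).
     (\<forall>\<gamma>\<in>gal (adjoin \<alpha>). tensor_map (u \<gamma>) (u \<gamma>) (vmap to_ac r) = vmap to_ac r) \<and>
     (\<forall>\<gamma>\<in>abs_gal. \<gamma> \<alpha> = - \<alpha> \<longrightarrow>
        tensor_map (u \<gamma>) (u \<gamma>) (vmap to_ac r) = flip (vmap to_ac r))}"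

definition H1_twisted ::
    "('k::field, 'n::finite) bracket \<Rightarrow> 'k ^ ('n \<times> 'n) \<Rightarrow> 'k alg_closure \<Rightarrow> ('k, 'n) cochain set set"
    where
  "H1_twisted br r \<alpha> =
     twisted_cocycles br r \<alpha>
       // cohomologous (aut_bialgebra br (coboundary br r)) (twisted_cocycles br r \<alpha>)"


section \<open>Forms of a Lie bialgebra\<close>

text \<open>
  The Lie bialgebras over \<open>K\<close> that become isomorphic over the algebraic closure to \<open>(br', \<delta>')\<close>.
  They all have the dimension of \<open>(br', \<delta>')\<close>, so up to isomorphism they live on \<^typ>\<open>'k ^ 'n\<close>.
\<close>

definition bialgebra_forms ::
    "('k::field alg_closure, 'n::finite) bracket \<Rightarrow> ('k alg_closure, 'n) cobracket \<Rightarrow>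
     (('k, 'n) bracket \<times> ('k, 'n) cobracket) set" where
  "bialgebra_forms br' \<delta>' = {(br, \<delta>). lie_bialgebra br \<delta> \<and>
     (\<exists>\<phi>. lie_bialgebra_iso (ext_bilin to_ac br) (ext_lin to_ac \<delta>) br' \<delta>' \<phi>)}"

definition iso_rel ::
    "(('k::field, 'n::finite) bracket \<times> ('k, 'n) cobracket) set \<Rightarrow>
     ((('k, 'n) bracket \<times> ('k, 'n) cobracket) \<times> (('k, 'n) bracket \<times> ('k, 'n) cobracket)) set" where
  "iso_rel S = {((br, \<delta>), (br', \<delta>')). (br, \<delta>) \<in> S \<and> (br', \<delta>') \<in> S \<and>
     (\<exists>\<phi>. lie_bialgebra_iso br \<delta> br' \<delta>' \<phi>)}"

definition form_classes ::
    "('k::field alg_closure, 'n::finite) bracket \<Rightarrow> ('k alg_closure, 'n) cobracket \<Rightarrow>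
     (('k, 'n) bracket \<times> ('k, 'n) cobracket) set set" where
  "form_classes br' \<delta>' = bialgebra_forms br' \<delta>' // iso_rel (bialgebra_forms br' \<delta>')"

end

theory Submission
  imports Defs
begin

unbundle no fps_syntax

text \<open>
  A Lie bialgebra isomorphism \<open>\<phi>\<close> over the algebraic closure from a form to \<open>(\<gg>, \<alpha> \<partial>r)\<close>
  yields the cocycle \<open>u\<^sub>\<gamma> = \<phi> (\<gamma> \<phi>)\<inverse>\<close>, where \<open>u\<^sub>\<gamma>\<close> carries \<open>\<gamma>(\<alpha>) \<partial>r\<close> to \<open>\<alpha> \<partial>r\<close>.
  Conversely Hilbert 90 for the general linear group trivialises such a cocycle, and the
  structure transported along the trivialisation is Galois invariant, hence defined over \<open>K\<close>.

  Put \<open>t = \<alpha> / \<gamma>(\<alpha>)\<close>. An automorphism \<open>u\<close> of \<open>\<gg>\<close> preserves \<open>\<Omega>\<close>, because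
  the form is a nonzero multiple of the Killing form, and \<open>\<gg> \<otimes> \<gg>\<close> has no nonzero
  skew invariants, because the centroid of the split simple algebra is trivial and stays so over
  the closure. Hence \<open>u\<close> multiplies \<open>\<partial>r\<close> by \<open>t\<close> iff it multiplies the skew part of
  \<open>r\<close> by \<open>t\<close>. The modified classical Yang-Baxter equation
  \<open>[Dx, Dy] + \<lambda>\<^sup>2 [x, y] = D([Dx, y] + [x, Dy])\<close> for the skew part then forces \<open>t\<^sup>2 = 1\<close>. So
  \<open>\<gamma>(\<alpha>) = \<plusminus>\<alpha>\<close> for all \<open>\<gamma>\<close>, that is \<open>\<alpha>\<^sup>2 \<in> K\<close>, with \<open>u\<close> fixing \<open>r\<close> for the
  sign \<open>+\<close> and sending it to its flip for the sign \<open>-\<close>.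
\<close>

section \<open>Semilinear extension of scalars\<close>

text \<open>One calculus of field homomorphisms serves three kinds of base change:
  \<open>of_rat\<close> from the rational form, \<open>to_ac\<close> into the closure, and each
  Galois element \<gamma> acting semilinearly. An identity that is linear in every variable may be
  checked on either side of such a map; this moves axioms and morphisms up and down. The Killing
  form is nonzero because a split Cartan element over the rationals has rational eigenvalues, and
  the trace of its square is a sum of rational squares. The equation for the skew part forces t^2 =
  1 for this reason: conjugation by u replaces D by t D, so the terms quadratic in D gain t^2 while
  \<lambda>^2 [x, y] does not change. Since \<lambda> is nonzero and [x, y] can be nonzero, the
  factor must be 1. A form does not determine its isomorphism \<phi> with the model over the
  closure, so forms and cocycles are matched by a relation that is total on both sides, not by a
  map.\<close>

locale field_hom =
  fixes f :: "'a::field \<Rightarrow> 'b::field"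
  assumes hom_add: "f (x + y) = f x + f y"
    and hom_mult: "f (x * y) = f x * f y"
    and hom_one: "f 1 = 1"
begin

lemma hom_zero: "f 0 = 0"
  by (metis add.right_neutral add_left_cancel hom_add)

lemma hom_minus: "f (- x) = - f x"
  using hom_add[of x "- x"] by (simp add: hom_zero eq_neg_iff_add_eq_0 add.commute)

lemma hom_diff: "f (x - y) = f x - f y"
  using hom_add[of x "- y"] by (simp add: hom_minus)

lemma hom_sum: "f (sum g A) = (\<Sum>x\<in>A. f (g x))"
  by (induction A rule: infinite_finite_induct) (auto simp: hom_zero hom_add)

lemma hom_eq_0_iff: "f x = 0 \<longleftrightarrow> x = 0"
proof
  assume "f x = 0"
  show "x = 0"
  proof (rule ccontr)
    assume "x \<noteq> 0"
    then have "f x * f (inverse x) = 1"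
      by (metis hom_mult hom_one right_inverse)
    then show False using \<open>f x = 0\<close> by simp
  qed
qed (simp add: hom_zero)

lemma hom_eq_iff: "f x = f y \<longleftrightarrow> x = y"
  using hom_eq_0_iff[of "x - y"] by (simp add: hom_diff)

lemma vmap_add: "vmap f (x + y) = vmap f x + vmap f y"
  by (simp add: vmap_def vec_eq_iff hom_add)

lemma vmap_minus: "vmap f (- x) = - vmap f x"
  by (simp add: vmap_def vec_eq_iff hom_minus)

lemma vmap_diff: "vmap f (x - y) = vmap f x - vmap f y"
  by (simp add: vmap_def vec_eq_iff hom_diff)

lemma vmap_zero: "vmap f 0 = 0"
  by (simp add: vmap_def vec_eq_iff hom_zero)

lemma vmap_smult: "vmap f (c *s x) = f c *s vmap f x"
  by (simp add: vmap_def vec_eq_iff hom_mult)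

lemma vmap_sum: "vmap f (sum g A) = (\<Sum>x\<in>A. vmap f (g x))"
  by (induction A rule: infinite_finite_induct) (auto simp: vmap_zero vmap_add)

lemma vmap_basis: "vmap f (basis_vec i) = basis_vec i"
  by (simp add: vmap_def vec_eq_iff axis_def hom_zero hom_one)

lemma vmap_eq_iff: "vmap f x = vmap f y \<longleftrightarrow> x = y"
  by (simp add: vmap_def vec_eq_iff hom_eq_iff)

lemma vmap_eq_0_iff: "vmap f x = 0 \<longleftrightarrow> x = 0"
  by (metis vmap_eq_iff vmap_zero)

lemma vmap_tensor: "vmap f (tensor a b) = tensor (vmap f a) (vmap f b)"
  by (simp add: vmap_def tensor_def vec_eq_iff hom_mult)

lemma vmap_flip: "vmap f (flip T) = flip (vmap f T)"
  by (simp add: vmap_def flip_def vec_eq_iff)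

lemma vmap_cycle3: "vmap f (cycle3 T) = cycle3 (vmap f T)"
  by (simp add: vmap_def cycle3_def vec_eq_iff)

lemmas vmap_simps = vmap_add vmap_minus vmap_diff vmap_zero vmap_smult vmap_sum vmap_basis
  vmap_tensor vmap_flip vmap_cycle3

end

lemma vmap_nth [simp]: "vmap f x $ i = f (x $ i)"
  by (simp add: vmap_def)

lemma vmap_comp: "vmap f (vmap g x) = vmap (f \<circ> g) x"
  by (simp add: vec_eq_iff)

lemma linI:
  assumes "\<And>x y. \<phi> (x + y) = \<phi> x + \<phi> y" "\<And>c x. \<phi> (c *s x) = c *s \<phi> x"
  shows "lin \<phi>"
  by unfold_locales (simp_all add: assms)

lemma lin_add: "lin \<phi> \<Longrightarrow> \<phi> (x + y) = \<phi> x + \<phi> y"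
  by (rule vec.linear_add)

lemma lin_smult: "lin \<phi> \<Longrightarrow> \<phi> (c *s x) = c *s \<phi> x"
  by (rule vec.linear_scale)

lemma lin_sum: "lin \<phi> \<Longrightarrow> \<phi> (sum g A) = (\<Sum>x\<in>A. \<phi> (g x))"
  by (rule vec.linear_sum)

lemma lin_id: "lin id" "lin (\<lambda>x. x)"
  by (auto intro: linI)

lemma lin_comp: "lin \<phi> \<Longrightarrow> lin \<psi> \<Longrightarrow> lin (\<lambda>x. \<phi> (\<psi> x))"
  by (rule linI) (simp_all add: lin_add lin_smult)

lemma lin_o: "lin \<phi> \<Longrightarrow> lin \<psi> \<Longrightarrow> lin (\<phi> \<circ> \<psi>)"
  unfolding comp_def by (rule lin_comp)

lemma lin_inv:
  fixes \<phi> :: "'a::field ^ 'm \<Rightarrow> 'a ^ 'n"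
  assumes "lin \<phi>" "bij \<phi>"
  shows "lin (inv_into UNIV \<phi>)"
proof (rule linI)
  have s: "\<phi> (inv_into UNIV \<phi> x) = x" for x using assms(2) by (simp add: bij_is_surj surj_f_inv_f)
  have i: "inv_into UNIV \<phi> (\<phi> x) = x" for x using assms(2) by (simp add: bij_is_inj)
  show "inv_into UNIV \<phi> (x + y) = inv_into UNIV \<phi> x + inv_into UNIV \<phi> y" for x y
    by (metis s i lin_add[OF assms(1)])
  show "inv_into UNIV \<phi> (c *s x) = c *s inv_into UNIV \<phi> x" for c x
    by (metis s i lin_smult[OF assms(1)])
qed

lemma lin_plus: "lin \<phi> \<Longrightarrow> lin \<psi> \<Longrightarrow> lin (\<lambda>x. \<phi> x + \<psi> x)"
  by (rule linI) (simp_all add: lin_add lin_smult vec.scale_right_distrib)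

lemma lin_scale: "lin \<phi> \<Longrightarrow> lin (\<lambda>x. c *s \<phi> x)"
  by (rule linI) (simp_all add: lin_add lin_smult vec.scale_right_distrib mult.commute)

lemma lin_expand:
  assumes "lin \<phi>"
  shows "\<phi> x = (\<Sum>i\<in>UNIV. x $ i *s \<phi> (basis_vec i))"
  by (metis (no_types, lifting) assms basis_expansion lin_smult lin_sum sum.cong)

lemma lin_eqI:
  assumes "lin \<phi>" "lin \<psi>" "\<And>i. \<phi> (basis_vec i) = \<psi> (basis_vec i)"
  shows "\<phi> = \<psi>"
  by (rule ext, subst lin_expand[OF assms(1)], subst lin_expand[OF assms(2)]) (simp add: assms(3))

definition bilin :: "('a::field ^ 'm \<Rightarrow> 'a ^ 'n \<Rightarrow> 'a ^ 'p) \<Rightarrow> bool" where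
  "bilin \<beta> \<longleftrightarrow> (\<forall>x. lin (\<beta> x)) \<and> (\<forall>y. lin (\<lambda>x. \<beta> x y))"

lemma bilinI: "(\<And>x. lin (\<beta> x)) \<Longrightarrow> (\<And>y. lin (\<lambda>x. \<beta> x y)) \<Longrightarrow> bilin \<beta>"
  by (simp add: bilin_def)

lemma bilin_lin: "bilin \<beta> \<Longrightarrow> lin (\<beta> x)" "bilin \<beta> \<Longrightarrow> lin (\<lambda>x. \<beta> x y)"
  by (auto simp: bilin_def)

lemma bilin_eqI:
  assumes "bilin \<beta>" "bilin \<gamma>" "\<And>i j. \<beta> (basis_vec i) (basis_vec j) = \<gamma> (basis_vec i) (basis_vec j)"
  shows "\<beta> x y = \<gamma> x y"
proof -
  have "\<beta> (basis_vec i) = \<gamma> (basis_vec i)" for i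
    by (rule lin_eqI) (use assms bilin_lin in auto)
  then have "(\<lambda>x. \<beta> x y) = (\<lambda>x. \<gamma> x y)"
    by (intro lin_eqI) (use assms bilin_lin in auto)
  then show ?thesis by metis
qed

lemma lie_algebra_bilin: "lie_algebra br \<Longrightarrow> bilin br"
  by (auto simp: lie_algebra_def bilin_def)

text \<open>A relation rather than the function \<open>ext_lin\<close>, because maps over the
  closure also arise by transport and by \<open>gal_act\<close>; the same transfer lemmas then cover
  all of them.\<close>

definition lin_extends ::
    "('a \<Rightarrow> 'b) \<Rightarrow> ('a::field ^ 'm \<Rightarrow> 'a ^ 'n) \<Rightarrow> ('b::field ^ 'm \<Rightarrow> 'b ^ 'n) \<Rightarrow> bool" where
  "lin_extends f \<phi> \<phi>' \<longleftrightarrow> lin \<phi> \<and> lin \<phi>' \<and> (\<forall>x. \<phi>' (vmap f x) = vmap f (\<phi> x))"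

definition bilin_extends ::
    "('a \<Rightarrow> 'b) \<Rightarrow> ('a::field ^ 'm \<Rightarrow> 'a ^ 'n \<Rightarrow> 'a ^ 'p) \<Rightarrow> ('b::field ^ 'm \<Rightarrow> 'b ^ 'n \<Rightarrow> 'b ^ 'p) \<Rightarrow> bool"
  where
  "bilin_extends f \<beta> \<beta>' \<longleftrightarrow>
     bilin \<beta> \<and> bilin \<beta>' \<and> (\<forall>x y. \<beta>' (vmap f x) (vmap f y) = vmap f (\<beta> x y))"

lemma lin_extendsD:
  assumes "lin_extends f \<phi> \<phi>'"
  shows "lin \<phi>" "lin \<phi>'" "\<phi>' (vmap f x) = vmap f (\<phi> x)"
  using assms by (auto simp: lin_extends_def)

lemma bilin_extendsD:
  assumes "bilin_extends f \<beta> \<beta>'"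
  shows "bilin \<beta>" "bilin \<beta>'" "\<beta>' (vmap f x) (vmap f y) = vmap f (\<beta> x y)"
  using assms by (auto simp: bilin_extends_def)

context field_hom
begin

lemma lin_ext_lin: "lin (ext_lin f \<phi>)"
  by (rule linI)
    (simp_all add: ext_lin_def vec.scale_left_distrib sum.distrib vec.scale_sum_right)

lemma lin_extends_ext_lin:
  assumes "lin \<phi>"
  shows "lin_extends f \<phi> (ext_lin f \<phi>)"
proof -
  have "ext_lin f \<phi> (vmap f x) = vmap f (\<phi> x)" for x
    by (subst lin_expand[OF assms]) (simp add: ext_lin_def vmap_sum vmap_smult)
  then show ?thesis
    by (simp add: lin_extends_def assms lin_ext_lin)
qed

lemma bilin_ext_bilin: "bilin (ext_bilin f \<beta>)"
  by (rule bilinI; rule linI)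
    (simp_all add: ext_bilin_def vec.scale_left_distrib sum.distrib vec.scale_sum_right
      algebra_simps)

lemma bilin_extends_ext_bilin:
  assumes "bilin \<beta>"
  shows "bilin_extends f \<beta> (ext_bilin f \<beta>)"
proof -
  have "ext_bilin f \<beta> (vmap f x) (vmap f y) = vmap f (\<beta> x y)" for x y
    by (subst lin_expand[OF bilin_lin(2)[OF assms]], subst lin_expand[OF bilin_lin(1)[OF assms]])
      (simp add: ext_bilin_def vmap_sum vmap_smult vec.scale_sum_right hom_mult)
  then show ?thesis
    by (simp add: bilin_extends_def assms bilin_ext_bilin)
qed

text \<open>The vectors with coordinates in the image of \<open>f\<close> include the standard
  basis, so they detect equality.\<close>

lemma lin_eq_vmapI:
  assumes "lin \<phi>" "lin \<psi>" "\<And>x. \<phi> (vmap f x) = \<psi> (vmap f x)"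
  shows "\<phi> = \<psi>"
  by (rule lin_eqI[OF assms(1,2)]) (metis assms(3) vmap_basis)

lemma bilin_eq_vmapI:
  assumes "bilin \<beta>" "bilin \<gamma>" "\<And>x y. \<beta> (vmap f x) (vmap f y) = \<gamma> (vmap f x) (vmap f y)"
  shows "\<beta> x y = \<gamma> x y"
  by (rule bilin_eqI[OF assms(1,2)]) (metis assms(3) vmap_basis)

end

section \<open>Tensors\<close>

lemma tensor_nth: "tensor a b $ (i, j) = a $ i * b $ j"
  by (simp add: tensor_def)

lemma tensor_basis: "tensor (basis_vec i) (basis_vec j) = basis_vec (i, j)"
  by (simp add: tensor_def vec_eq_iff axis_def)

lemma bilin_tensor: "bilin tensor"
  by (rule bilinI; rule linI) (auto simp: tensor_def vec_eq_iff algebra_simps)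

lemmas tensor_lin = bilin_lin[OF bilin_tensor]

lemma tensor_expand: "T = (\<Sum>i\<in>UNIV. \<Sum>j\<in>UNIV. T $ (i, j) *s tensor (basis_vec i) (basis_vec j))"
proof -
  have "T = (\<Sum>p\<in>UNIV. T $ p *s basis_vec p)"
    by (rule basis_expansion[symmetric])
  also have "\<dots> = (\<Sum>i\<in>UNIV. \<Sum>j\<in>UNIV. T $ (i, j) *s tensor (basis_vec i) (basis_vec j))"
    by (simp add: tensor_basis sum.cartesian_product UNIV_Times_UNIV)
  finally show ?thesis .
qed

lemma lin_eq_tensorI:
  assumes "lin \<phi>" "lin \<psi>" "\<And>a b. \<phi> (tensor a b) = \<psi> (tensor a b)"
  shows "\<phi> = \<psi>"
  by (rule lin_eqI[OF assms(1,2)]) (metis assms(3) surj_pair tensor_basis)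

lemma lin_tensor_map: "lin (tensor_map \<phi> \<psi>)"
  by (rule linI)
    (simp_all add: tensor_map_def vec.scale_left_distrib sum.distrib vec.scale_sum_right)

lemma tensor_map_tensor:
  assumes "lin \<phi>" "lin \<psi>"
  shows "tensor_map \<phi> \<psi> (tensor a b) = tensor (\<phi> a) (\<psi> b)"
proof -
  have "tensor (\<phi> a) (\<psi> b) = (\<Sum>i\<in>UNIV. \<Sum>j\<in>UNIV. (a $ i * b $ j) *s tensor (\<phi> (basis_vec i)) (\<psi> (basis_vec j)))"
    by (subst lin_expand[OF assms(1)], subst lin_expand[OF assms(2)])
      (simp add: lin_sum[OF tensor_lin(1)] lin_sum[OF tensor_lin(2)]
        lin_smult[OF tensor_lin(1)] lin_smult[OF tensor_lin(2)] vec.scale_sum_right mult.commute, rule sum.swap)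
  then show ?thesis by (simp add: tensor_map_def tensor_nth)
qed

lemma tensor_map_id: "tensor_map id id T = T"
  unfolding tensor_map_def id_apply by (rule tensor_expand[symmetric])

lemma tensor_map_comp:
  assumes "lin \<phi>" "lin \<psi>" "lin \<phi>'" "lin \<psi>'"
  shows "tensor_map \<phi> \<psi> (tensor_map \<phi>' \<psi>' T) = tensor_map (\<phi> \<circ> \<phi>') (\<psi> \<circ> \<psi>') T"
proof -
  have "(\<lambda>T. tensor_map \<phi> \<psi> (tensor_map \<phi>' \<psi>' T)) = tensor_map (\<phi> \<circ> \<phi>') (\<psi> \<circ> \<psi>')"
    by (rule lin_eq_tensorI[OF lin_comp[OF lin_tensor_map lin_tensor_map] lin_tensor_map])
      (simp add: tensor_map_tensor assms lin_o)
  then show ?thesis by metis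
qed

lemma flip_tensor: "flip (tensor a b) = tensor b a"
  by (simp add: flip_def tensor_def vec_eq_iff mult.commute)

lemma lin_flip: "lin flip"
  by (rule linI) (auto simp: flip_def vec_eq_iff)

lemma flip_flip: "flip (flip T) = T"
  by (simp add: flip_def vec_eq_iff)

lemma cycle3_tensor: "cycle3 (tensor a (tensor b c)) = tensor c (tensor a b)"
  by (simp add: cycle3_def tensor_def vec_eq_iff mult_ac)

lemma lin_cycle3: "lin cycle3"
  by (rule linI) (auto simp: cycle3_def vec_eq_iff)

lemma flip_tensor_map:
  assumes "lin \<phi>" "lin \<psi>"
  shows "flip (tensor_map \<phi> \<psi> T) = tensor_map \<psi> \<phi> (flip T)"
proof -
  have "(\<lambda>T. flip (tensor_map \<phi> \<psi> T)) = (\<lambda>T. tensor_map \<psi> \<phi> (flip T))"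
    by (rule lin_eq_tensorI[OF lin_comp[OF lin_flip lin_tensor_map] lin_comp[OF lin_tensor_map lin_flip]])
      (simp add: tensor_map_tensor flip_tensor assms)
  then show ?thesis by metis
qed

lemma lin_eq_tensor3I:
  assumes "lin \<phi>" "lin \<psi>" "\<And>a b c. \<phi> (tensor a (tensor b c)) = \<psi> (tensor a (tensor b c))"
  shows "\<phi> = \<psi>"
  by (rule lin_eqI[OF assms(1,2)]) (metis assms(3) surj_pair tensor_basis)

lemma cycle3_tensor_map:
  assumes "lin \<phi>"
  shows "cycle3 (tensor_map \<phi> (tensor_map \<phi> \<phi>) T) = tensor_map \<phi> (tensor_map \<phi> \<phi>) (cycle3 T)"
proof -
  have "(\<lambda>T. cycle3 (tensor_map \<phi> (tensor_map \<phi> \<phi>) T)) = (\<lambda>T. tensor_map \<phi> (tensor_map \<phi> \<phi>) (cycle3 T))"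
    by (rule lin_eq_tensor3I[OF lin_comp[OF lin_cycle3 lin_tensor_map] lin_comp[OF lin_tensor_map lin_cycle3]])
      (simp add: tensor_map_tensor cycle3_tensor assms lin_tensor_map)
  then show ?thesis by metis
qed

lemma tensor_map_scale:
  shows "tensor_map (\<lambda>x. c *s \<phi> x) \<psi> T = c *s tensor_map \<phi> \<psi> T"
    and "tensor_map \<phi> (\<lambda>x. c *s \<psi> x) T = c *s tensor_map \<phi> \<psi> T"
  by (simp_all add: tensor_map_def lin_smult[OF tensor_lin(1)] lin_smult[OF tensor_lin(2)]
      vec.scale_sum_right mult.commute)

lemma lin_ad2: "lin (ad2 br a)"
  unfolding ad2_def[abs_def] by (intro lin_plus lin_tensor_map)

lemma ad2_tensor:
  assumes "bilin br"
  shows "ad2 br x (tensor a b) = tensor (br x a) b + tensor a (br x b)"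
  by (simp add: ad2_def tensor_map_tensor bilin_lin[OF assms] lin_id)

lemma bilin_ad2:
  assumes "bilin br"
  shows "bilin (ad2 br)"
proof (rule bilinI)
  show "lin (ad2 br x)" for x by (rule lin_ad2)
  fix T
  show "lin (\<lambda>x. ad2 br x T)"
    by (rule linI)
      (simp_all add: ad2_def tensor_map_def lin_add[OF bilin_lin(2)[OF assms]] lin_smult[OF bilin_lin(2)[OF assms]]
        lin_add[OF tensor_lin(1)] lin_add[OF tensor_lin(2)] lin_smult[OF tensor_lin(1)] lin_smult[OF tensor_lin(2)]
        vec.scale_sum_right vec.scale_right_distrib sum.distrib algebra_simps)
qed

context field_hom
begin

lemma lin_extends_tensor_map:
  assumes "lin_extends f \<phi> \<phi>'" "lin_extends f \<psi> \<psi>'"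
  shows "lin_extends f (tensor_map \<phi> \<psi>) (tensor_map \<phi>' \<psi>')"
proof -
  have "\<phi>' (basis_vec i) = vmap f (\<phi> (basis_vec i))" for i
    by (metis assms(1) lin_extendsD(3) vmap_basis)
  moreover have "\<psi>' (basis_vec i) = vmap f (\<psi> (basis_vec i))" for i
    by (metis assms(2) lin_extendsD(3) vmap_basis)
  ultimately show ?thesis
    by (simp add: lin_extends_def lin_tensor_map) (simp add: tensor_map_def vmap_simps)
qed

lemma lin_extends_id: "lin_extends f id id" "lin_extends f (\<lambda>x. x) (\<lambda>x. x)"
  by (simp_all add: lin_extends_def lin_id)

lemma ad2_vmap:
  assumes "bilin_extends f br br'"
  shows "ad2 br' (vmap f a) (vmap f T) = vmap f (ad2 br a T)"
proof -
  have *: "lin_extends f (br a) (br' (vmap f a))"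
    using assms by (auto simp: lin_extends_def bilin_extends_def bilin_def)
  show ?thesis
    by (simp add: ad2_def vmap_add lin_extendsD(3)[OF lin_extends_tensor_map[OF * lin_extends_id(1)]]
      lin_extendsD(3)[OF lin_extends_tensor_map[OF lin_extends_id(1) *]])
qed

end

section \<open>Transfer of identities along an extension of scalars\<close>

lemma lin_minus: "lin \<phi> \<Longrightarrow> lin \<psi> \<Longrightarrow> lin (\<lambda>x. \<phi> x - \<psi> x)"
  by (rule linI) (simp_all add: lin_add lin_smult vec.scale_right_diff_distrib)

lemma lin_uminus: "lin \<phi> \<Longrightarrow> \<phi> (- x) = - \<phi> x"
  by (rule vec.linear_neg)

lemma lin_diff: "lin \<phi> \<Longrightarrow> \<phi> (x - y) = \<phi> x - \<phi> y"
  by (rule vec.linear_diff)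

lemma lin_zero: "lin \<phi> \<Longrightarrow> \<phi> 0 = 0"
  by (rule vec.linear_0)

lemma bilin_simps:
  assumes "bilin \<beta>"
  shows "\<beta> (x + y) z = \<beta> x z + \<beta> y z" "\<beta> u (v + w) = \<beta> u v + \<beta> u w"
    "\<beta> (x - y) z = \<beta> x z - \<beta> y z" "\<beta> u (v - w) = \<beta> u v - \<beta> u w"
    "\<beta> (c *s x) z = c *s \<beta> x z" "\<beta> u (c *s v) = c *s \<beta> u v"
    "\<beta> (- x) z = - \<beta> x z" "\<beta> u (- v) = - \<beta> u v"
    "\<beta> (sum g A) z = (\<Sum>i\<in>A. \<beta> (g i) z)" "\<beta> u (sum h C) = (\<Sum>i\<in>C. \<beta> u (h i))"
  by (fact lin_add[OF bilin_lin(2)[OF assms]] lin_add[OF bilin_lin(1)[OF assms]]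
      lin_diff[OF bilin_lin(2)[OF assms]] lin_diff[OF bilin_lin(1)[OF assms]]
      lin_smult[OF bilin_lin(2)[OF assms]] lin_smult[OF bilin_lin(1)[OF assms]]
      lin_uminus[OF bilin_lin(2)[OF assms]] lin_uminus[OF bilin_lin(1)[OF assms]]
      lin_sum[OF bilin_lin(2)[OF assms]] lin_sum[OF bilin_lin(1)[OF assms]])+

context field_hom
begin

lemma lin_extends_comp:
  assumes "lin_extends f \<phi> \<phi>'" "lin_extends f \<psi> \<psi>'"
  shows "lin_extends f (\<lambda>x. \<phi> (\<psi> x)) (\<lambda>x. \<phi>' (\<psi>' x))"
  using assms lin_comp[of \<phi> \<psi>] lin_comp[of \<phi>' \<psi>'] by (simp add: lin_extends_def)

lemma lin_extends_plus:
  assumes "lin_extends f \<phi> \<phi>'" "lin_extends f \<psi> \<psi>'"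
  shows "lin_extends f (\<lambda>x. \<phi> x + \<psi> x) (\<lambda>x. \<phi>' x + \<psi>' x)"
  using assms lin_plus[of \<phi> \<psi>] lin_plus[of \<phi>' \<psi>'] by (simp add: lin_extends_def vmap_add)

lemma lin_extends_minus:
  assumes "lin_extends f \<phi> \<phi>'" "lin_extends f \<psi> \<psi>'"
  shows "lin_extends f (\<lambda>x. \<phi> x - \<psi> x) (\<lambda>x. \<phi>' x - \<psi>' x)"
  using assms lin_minus[of \<phi> \<psi>] lin_minus[of \<phi>' \<psi>'] by (simp add: lin_extends_def vmap_diff)

lemma lin_extends_scale:
  assumes "lin_extends f \<phi> \<phi>'"
  shows "lin_extends f (\<lambda>x. c *s \<phi> x) (\<lambda>x. f c *s \<phi>' x)"
  using assms lin_scale[of \<phi>] lin_scale[of \<phi>'] by (simp add: lin_extends_def vmap_smult)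

lemma lin_extends_flip: "lin_extends f flip flip"
  by (simp add: lin_extends_def lin_flip vmap_flip)

lemma lin_extends_cycle3: "lin_extends f cycle3 cycle3"
  by (simp add: lin_extends_def lin_cycle3 vmap_cycle3)

text \<open>Downwards \<open>vmap f\<close> is injective; upwards the vectors
  \<open>vmap f x\<close> span. Axioms and morphism conditions are transferred by writing each as
  the vanishing of such a map.\<close>

lemma lin_extends_zero_iff:
  assumes "lin_extends f \<phi> \<phi>'"
  shows "(\<forall>x. \<phi>' x = 0) \<longleftrightarrow> (\<forall>x. \<phi> x = 0)"
proof
  assume "\<forall>x. \<phi>' x = 0"
  then show "\<forall>x. \<phi> x = 0"
    by (metis assms lin_extendsD(3) vmap_eq_0_iff)
next
  assume *: "\<forall>x. \<phi> x = 0"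
  have "\<phi>' = (\<lambda>x. 0)"
    by (rule lin_eq_vmapI) (use assms * in \<open>auto simp: lin_extends_def vmap_zero intro: linI\<close>)
  then show "\<forall>x. \<phi>' x = 0" by simp
qed

lemma bilin_extends_zero_iff:
  fixes \<beta>' :: "'b ^ 'm \<Rightarrow> 'b ^ 'n \<Rightarrow> 'b ^ 'd"
  assumes "bilin_extends f \<beta> \<beta>'"
  shows "(\<forall>x y. \<beta>' x y = 0) \<longleftrightarrow> (\<forall>x y. \<beta> x y = 0)"
proof
  assume "\<forall>x y. \<beta>' x y = 0"
  then show "\<forall>x y. \<beta> x y = 0"
    by (metis assms bilin_extendsD(3) vmap_eq_0_iff)
next
  assume *: "\<forall>x y. \<beta> x y = 0"
  have bz: "bilin (\<lambda>x y. 0 :: 'b ^ 'd)"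
    by (auto intro!: bilinI linI)
  then have "\<beta>' x y = 0" for x y
    using bilin_eq_vmapI[OF bilin_extendsD(2)[OF assms] bz, of x y]
    by (simp add: bilin_extendsD(3)[OF assms] * vmap_zero)
  then show "\<forall>x y. \<beta>' x y = 0" by simp
qed

text \<open>Freezing the first argument at \<open>vmap f x\<close> reduces to the bilinear case, and
  linearity then frees it. It serves the Jacobi identity.\<close>

lemma trilin_extends_zero_iff:
  assumes "\<And>x. bilin_extends f (\<tau> x) (\<tau>' (vmap f x))"
    and "\<And>y z. lin (\<lambda>x. \<tau>' x y z)"
  shows "(\<forall>x y z. \<tau>' x y z = 0) \<longleftrightarrow> (\<forall>x y z. \<tau> x y z = 0)"
proof
  assume "\<forall>x y z. \<tau>' x y z = 0"
  then show "\<forall>x y z. \<tau> x y z = 0"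
    by (metis assms(1) bilin_extendsD(3) vmap_eq_0_iff)
next
  assume *: "\<forall>x y z. \<tau> x y z = 0"
  have "\<tau>' (vmap f x) y z = 0" for x y z
    using bilin_extends_zero_iff[OF assms(1)[of x]] * by simp
  then have "(\<lambda>x. \<tau>' x y z) = (\<lambda>x. 0)" for y z
    by (intro lin_eq_vmapI assms(2)) (auto intro: linI)
  then show "\<forall>x y z. \<tau>' x y z = 0" by metis
qed

text \<open>Descent uses that an injective endomorphism of a finite-dimensional space is onto;
  ascent extends the inverse and checks both composites on \<open>vmap f x\<close>.\<close>

lemma bij_extends_iff:
  fixes \<phi> :: "'a ^ 'n \<Rightarrow> 'a ^ 'n"
  assumes "lin_extends f \<phi> \<phi>'"
  shows "bij \<phi>' \<longleftrightarrow> bij \<phi>"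
proof
  assume "bij \<phi>'"
  then have "inj \<phi>"
    by (metis assms bij_is_inj injD injI lin_extendsD(3) vmap_eq_iff)
  then show "bij \<phi>"
    using vec.linear_inj_imp_surj lin_extendsD(1)[OF assms] by (auto simp: bij_def)
next
  assume b: "bij \<phi>"
  define \<psi> where "\<psi> = inv_into UNIV \<phi>"
  have i: "\<psi> (\<phi> x) = x" "\<phi> (\<psi> x) = x" for x
    using b by (auto simp: \<psi>_def bij_is_inj bij_is_surj surj_f_inv_f)
  have \<psi>: "lin_extends f \<psi> (ext_lin f \<psi>)"
    unfolding \<psi>_def by (intro lin_extends_ext_lin lin_inv b lin_extendsD(1)[OF assms])
  have "(\<lambda>x. ext_lin f \<psi> (\<phi>' x)) = (\<lambda>x. x)"
    by (rule lin_eq_vmapI)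
      (simp_all add: lin_comp lin_extendsD[OF assms] lin_extendsD[OF \<psi>] i lin_id)
  moreover have "(\<lambda>x. \<phi>' (ext_lin f \<psi> x)) = (\<lambda>x. x)"
    by (rule lin_eq_vmapI)
      (simp_all add: lin_comp lin_extendsD[OF assms] lin_extendsD[OF \<psi>] i lin_id)
  ultimately show "bij \<phi>'"
    by (intro o_bij[of "ext_lin f \<psi>"]) (simp_all add: comp_def id_def)
qed

end

text \<open>The law \<open>br x x = 0\<close> is quadratic in \<open>x\<close> and cannot be tested
  on a basis; polarised, it is bilinear and fits the transfer lemmas. Halving uses characteristic
  zero.\<close>

lemma lie_algebra_iff:
  fixes br :: "('a::field_char_0, 'n::finite) bracket"
  shows "lie_algebra br \<longleftrightarrow> bilin br \<and> (\<forall>x y. br x y + br y x = 0) \<and>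
    (\<forall>x y z. br x (br y z) + br y (br z x) + br z (br x y) = 0)"
proof -
  have "(\<forall>x. br x x = 0) \<longleftrightarrow> (\<forall>x y. br x y + br y x = 0)" if b: "bilin br"
  proof
    assume *: "\<forall>x. br x x = 0"
    have "br x y + br y x = 0" for x y
    proof -
      have "br (x + y) (x + y) = br x x + br x y + (br y x + br y y)"
        by (simp add: bilin_simps[OF b])
      then show ?thesis using * by (simp add: add.assoc)
    qed
    then show "\<forall>x y. br x y + br y x = 0" by simp
  next
    assume *: "\<forall>x y. br x y + br y x = 0"
    have "br x x = 0" for x
    proof -
      have "(2 :: 'a) *s br x x = br x x + br x x"
        by (simp add: vec_eq_iff)
      then show ?thesis using * by simp
    qed
    then show "\<forall>x. br x x = 0" by simp
  qed
  then show ?thesis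
    by (auto simp: lie_algebra_def bilin_def)
qed

lemma lie_algebra_extends_iff:
  fixes f :: "'a::field_char_0 \<Rightarrow> 'b::field_char_0"
  assumes "field_hom f" "bilin_extends f br br'"
  shows "lie_algebra br' \<longleftrightarrow> lie_algebra br"
proof -
  interpret field_hom f by fact
  note e = bilin_extendsD(3)[OF assms(2)]
  note ls = bilin_simps[OF bilin_extendsD(1)[OF assms(2)]] bilin_simps[OF bilin_extendsD(2)[OF assms(2)]]
    vec.scale_right_distrib
  have "bilin_extends f (\<lambda>x y. br x y + br y x) (\<lambda>x y. br' x y + br' y x)"
    unfolding bilin_extends_def by (auto intro!: bilinI linI simp: ls e vmap_add)
  note 1 = bilin_extends_zero_iff[OF this]
  have "(\<forall>x y z. br' x (br' y z) + br' y (br' z x) + br' z (br' x y) = 0) \<longleftrightarrow>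
        (\<forall>x y z. br x (br y z) + br y (br z x) + br z (br x y) = 0)"
    by (rule trilin_extends_zero_iff; (unfold bilin_extends_def)?)
      (auto intro!: bilinI linI simp: ls e vmap_add)
  with 1 show ?thesis
    using bilin_extendsD(1,2)[OF assms(2)] by (simp add: lie_algebra_iff)
qed

lemma lie_bialgebra_extends_iff:
  fixes f :: "'a::field_char_0 \<Rightarrow> 'b::field_char_0"
  assumes "field_hom f" "bilin_extends f br br'" "lin_extends f \<delta> \<delta>'"
  shows "lie_bialgebra br' \<delta>' \<longleftrightarrow> lie_bialgebra br \<delta>"
proof -
  interpret field_hom f by fact
  have d: "lin \<delta>" "lin \<delta>'" "\<And>x. \<delta>' (vmap f x) = vmap f (\<delta> x)"
    by (rule lin_extendsD[OF assms(3)])+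
  have l: "lin (br x)" "lin (\<lambda>x. br x y)" "lin (br' x')" "lin (\<lambda>x. br' x y')" for x y x' y'
    by (rule bilin_lin[OF bilin_extendsD(1)[OF assms(2)]] bilin_lin[OF bilin_extendsD(2)[OF assms(2)]])+
  note ad = bilin_lin[OF bilin_ad2[OF bilin_extendsD(1)[OF assms(2)]]] bilin_lin[OF bilin_ad2[OF bilin_extendsD(2)[OF assms(2)]]]
  note T = lin_extends_comp[OF lin_extends_tensor_map[OF lin_extends_id(1) assms(3)] assms(3)]
  note C = lin_extends_plus[OF lin_extends_plus[OF T lin_extends_comp[OF lin_extends_cycle3 T]]
      lin_extends_comp[OF lin_extends_cycle3 lin_extends_comp[OF lin_extends_cycle3 T]]]
  note 1 = lin_extends_zero_iff[OF lin_extends_plus[OF lin_extends_comp[OF lin_extends_flip assms(3)] assms(3)]]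
  have "bilin_extends f (\<lambda>a b. \<delta> (br a b) - (ad2 br a (\<delta> b) - ad2 br b (\<delta> a)))
     (\<lambda>a b. \<delta>' (br' a b) - (ad2 br' a (\<delta>' b) - ad2 br' b (\<delta>' a)))"
    unfolding bilin_extends_def
    by (intro conjI bilinI allI lin_minus lin_comp[OF d(1)] lin_comp[OF d(2)] l
          lin_comp[OF ad(1) d(1)] lin_comp[OF ad(3) d(2)] ad)
       (simp add: bilin_extendsD(3)[OF assms(2)] d(3) ad2_vmap[OF assms(2)] vmap_diff)
  note 2 = bilin_extends_zero_iff[OF this]
  show ?thesis
    using 1 2 lin_extends_zero_iff[OF C] lie_algebra_extends_iff[OF assms(1,2)]
    by (simp add: lie_bialgebra_def d Let_def eq_neg_iff_add_eq_0)
qed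

lemma lie_iso_extends_iff:
  assumes "field_hom f" "bilin_extends f b1 b1'" "bilin_extends f b2 b2'" "lin_extends f \<phi> \<phi>'"
  shows "lie_iso b1' b2' \<phi>' \<longleftrightarrow> lie_iso b1 b2 \<phi>"
proof -
  interpret field_hom f by fact
  have p: "lin \<phi>" "lin \<phi>'" "\<And>x. \<phi>' (vmap f x) = vmap f (\<phi> x)"
    by (rule lin_extendsD[OF assms(4)])+
  have l: "lin (b1 x)" "lin (\<lambda>x. b1 x y)" "lin (b1' x')" "lin (\<lambda>x. b1' x y')"
     "lin (b2 x)" "lin (\<lambda>x. b2 x y)" "lin (b2' x')" "lin (\<lambda>x. b2' x y')" for x y x' y'
    by (rule bilin_lin[OF bilin_extendsD(1)[OF assms(2)]] bilin_lin[OF bilin_extendsD(2)[OF assms(2)]]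
        bilin_lin[OF bilin_extendsD(1)[OF assms(3)]] bilin_lin[OF bilin_extendsD(2)[OF assms(3)]])+
  have "bilin_extends f (\<lambda>x y. \<phi> (b1 x y) - b2 (\<phi> x) (\<phi> y)) (\<lambda>x y. \<phi>' (b1' x y) - b2' (\<phi>' x) (\<phi>' y))"
    unfolding bilin_extends_def
    by (intro conjI bilinI allI lin_minus lin_comp[OF p(1)] lin_comp[OF p(2)] l
        lin_comp[OF l(5) p(1)] lin_comp[OF l(6) p(1)] lin_comp[OF l(7) p(2)] lin_comp[OF l(8) p(2)])
       (simp add: bilin_extendsD(3)[OF assms(2)] bilin_extendsD(3)[OF assms(3)] p(3) vmap_diff)
  note 2 = bilin_extends_zero_iff[OF this]
  show ?thesis
    using 2 bij_extends_iff[OF assms(4)] p by (simp add: lie_iso_def)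
qed

lemma lie_bialgebra_iso_extends_iff:
  assumes "field_hom f" "bilin_extends f b1 b1'" "bilin_extends f b2 b2'" "lin_extends f \<phi> \<phi>'"
    and "lin_extends f \<delta>1 \<delta>1'" "lin_extends f \<delta>2 \<delta>2'"
  shows "lie_bialgebra_iso b1' \<delta>1' b2' \<delta>2' \<phi>' \<longleftrightarrow> lie_bialgebra_iso b1 \<delta>1 b2 \<delta>2 \<phi>"
proof -
  interpret field_hom f by fact
  note 1 = lin_extends_zero_iff[OF lin_extends_minus[OF lin_extends_comp[OF
      lin_extends_tensor_map[OF assms(4,4)] assms(5)] lin_extends_comp[OF assms(6,4)]]]
  then show ?thesis
    using lie_iso_extends_iff[OF assms(1-4)] by (simp add: lie_bialgebra_iso_def)
qed

section \<open>The groupoid of Lie bialgebras\<close>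

lemma lie_iso_inv:
  assumes "lie_iso b1 b2 \<phi>"
  shows "lie_iso b2 b1 (inv_into UNIV \<phi>)"
proof -
  have b: "bij \<phi>" using assms by (simp add: lie_iso_def)
  then have i: "inv_into UNIV \<phi> (\<phi> x) = x" "\<phi> (inv_into UNIV \<phi> x) = x" for x
    by (auto simp: bij_is_inj bij_is_surj surj_f_inv_f)
  show ?thesis
    using assms b i bij_imp_bij_inv lin_inv unfolding lie_iso_def by metis
qed

lemma lie_iso_comp: "lie_iso b1 b2 \<phi> \<Longrightarrow> lie_iso b2 b3 \<psi> \<Longrightarrow> lie_iso b1 b3 (\<psi> \<circ> \<phi>)"
  by (auto simp: lie_iso_def bij_comp lin_o)

lemma lie_bialgebra_iso_id: "lie_bialgebra_iso b \<delta> b \<delta> id"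
  by (simp add: lie_bialgebra_iso_def lie_iso_def lin_id tensor_map_id)

lemma lie_bialgebra_iso_comp:
  "lie_bialgebra_iso b1 \<delta>1 b2 \<delta>2 \<phi> \<Longrightarrow> lie_bialgebra_iso b2 \<delta>2 b3 \<delta>3 \<psi> \<Longrightarrow>
    lie_bialgebra_iso b1 \<delta>1 b3 \<delta>3 (\<psi> \<circ> \<phi>)"
  unfolding lie_bialgebra_iso_def
  by (auto simp: lie_iso_comp lie_iso_def simp flip: tensor_map_comp intro: lie_iso_comp lin_o bij_comp)

lemma lie_bialgebra_iso_inv:
  assumes "lie_bialgebra_iso b1 \<delta>1 b2 \<delta>2 \<phi>"
  shows "lie_bialgebra_iso b2 \<delta>2 b1 \<delta>1 (inv_into UNIV \<phi>)"
proof -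
  have l: "lin \<phi>" and b: "bij \<phi>" and d: "\<And>x. tensor_map \<phi> \<phi> (\<delta>1 x) = \<delta>2 (\<phi> x)"
    using assms by (auto simp: lie_bialgebra_iso_def lie_iso_def)
  have c: "inv_into UNIV \<phi> \<circ> \<phi> = id" and i: "\<phi> (inv_into UNIV \<phi> x) = x" for x
    using b by (auto simp: bij_is_inj bij_is_surj surj_f_inv_f)
  have "tensor_map (inv_into UNIV \<phi>) (inv_into UNIV \<phi>) (\<delta>2 x) = \<delta>1 (inv_into UNIV \<phi> x)" for x
    using arg_cong[OF d[of "inv_into UNIV \<phi> x"], of "tensor_map (inv_into UNIV \<phi>) (inv_into UNIV \<phi>)"]
    by (simp add: tensor_map_comp l lin_inv b c i tensor_map_id)
  then show ?thesis
    using assms lie_iso_inv by (auto simp: lie_bialgebra_iso_def)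
qed

lemma lie_bialgebra_iso_scale:
  assumes "lie_bialgebra_iso b1 \<delta>1 b2 \<delta>2 \<phi>"
  shows "lie_bialgebra_iso b1 (\<lambda>x. c *s \<delta>1 x) b2 (\<lambda>x. c *s \<delta>2 x) \<phi>"
  using assms by (simp add: lie_bialgebra_iso_def lin_smult[OF lin_tensor_map])

lemma lie_bialgebra_iso_scale_iff:
  assumes "c \<noteq> 0"
  shows "lie_bialgebra_iso b1 (\<lambda>x. c *s \<delta>1 x) b2 (\<lambda>x. c *s \<delta>2 x) \<phi> \<longleftrightarrow> lie_bialgebra_iso b1 \<delta>1 b2 \<delta>2 \<phi>"
  using lie_bialgebra_iso_scale[of b1 "\<lambda>x. c *s \<delta>1 x" b2 "\<lambda>x. c *s \<delta>2 x" \<phi> "inverse c"]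
    lie_bialgebra_iso_scale[of b1 \<delta>1 b2 \<delta>2 \<phi> c] assms
  by (auto simp: vec.scale_scale)

text \<open>Every axiom involving \<delta> is homogeneous in it; co-Jacobi has degree two, which is
  where \<open>c * c\<close> comes from.\<close>

lemma lie_bialgebra_scale:
  assumes "lie_bialgebra br \<delta>"
  shows "lie_bialgebra br (\<lambda>x. c *s \<delta> x)"
proof -
  have l: "lin \<delta>" using assms by (simp add: lie_bialgebra_def)
  have t: "tensor_map id (\<lambda>x. c *s \<delta> x) (c *s \<delta> x) = (c * c) *s tensor_map id \<delta> (\<delta> x)" for x
    by (simp add: tensor_map_scale lin_smult[OF lin_tensor_map] vec.scale_scale)
  have co: "\<forall>x. tensor_map id \<delta> (\<delta> x) + cycle3 (tensor_map id \<delta> (\<delta> x)) + cycle3 (cycle3 (tensor_map id \<delta> (\<delta> x))) = 0"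
    using assms by (simp add: lie_bialgebra_def Let_def)
  have 1: "flip (c *s \<delta> x) = - (c *s \<delta> x)" for x
    using assms by (simp add: lie_bialgebra_def lin_smult[OF lin_flip])
  have 2: "c *s \<delta> (br a b) = ad2 br a (c *s \<delta> b) - ad2 br b (c *s \<delta> a)" for a b
    using assms by (simp add: lie_bialgebra_def lin_smult[OF lin_ad2] vec.scale_right_diff_distrib)
  have "(c * c) *s T + cycle3 ((c * c) *s T) + cycle3 (cycle3 ((c * c) *s T)) =
      (c * c) *s (T + cycle3 T + cycle3 (cycle3 T))" for T :: "'a ^ ('b \<times> 'b \<times> 'b)"
    by (simp only: lin_smult[OF lin_cycle3] vec.scale_right_distrib)
  then have 3: "let T = tensor_map id (\<lambda>x. c *s \<delta> x) (c *s \<delta> x) in T + cycle3 T + cycle3 (cycle3 T) = 0" for x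
    unfolding Let_def t using co by (simp only: vec.scale_zero_right)
  show ?thesis
    using assms 1 2 3 lin_scale[OF l] unfolding lie_bialgebra_def by blast
qed

lemma ad2_iso:
  assumes "lie_iso b1 b2 \<phi>" "bilin b1" "bilin b2"
  shows "ad2 b2 (\<phi> a) (tensor_map \<phi> \<phi> T) = tensor_map \<phi> \<phi> (ad2 b1 a T)"
proof -
  have l: "lin \<phi>" using assms by (simp add: lie_iso_def)
  have e: "b2 (\<phi> a) (\<phi> x) = \<phi> (b1 a x)" for x using assms by (simp add: lie_iso_def)
  have "(\<lambda>T. ad2 b2 (\<phi> a) (tensor_map \<phi> \<phi> T)) = (\<lambda>T. tensor_map \<phi> \<phi> (ad2 b1 a T))"
    by (rule lin_eq_tensorI[OF lin_comp[OF lin_ad2 lin_tensor_map] lin_comp[OF lin_tensor_map lin_ad2]])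
      (simp add: tensor_map_tensor l ad2_tensor assms e lin_add[OF lin_tensor_map])
  then show ?thesis by metis
qed

lemma lie_algebra_transport:
  assumes "lie_algebra b1" "lie_iso b1 b2 \<phi>"
  shows "lie_algebra b2"
proof -
  define \<psi> where "\<psi> = inv_into UNIV \<phi>"
  have l: "lin \<phi>" and b: "bij \<phi>" and h: "\<And>x y. \<phi> (b1 x y) = b2 (\<phi> x) (\<phi> y)"
    using assms by (auto simp: lie_iso_def)
  have i: "\<phi> (\<psi> x) = x" for x
    using b by (auto simp: bij_is_surj surj_f_inv_f \<psi>_def)
  have lp: "lin \<psi>" unfolding \<psi>_def by (intro lin_inv l b)
  have b2: "b2 = (\<lambda>x y. \<phi> (b1 (\<psi> x) (\<psi> y)))"
    by (simp add: h i)
  have bl: "lin (b1 x)" "lin (\<lambda>x. b1 x y)" for x y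
    using assms(1) by (auto simp: lie_algebra_def)
  have "\<psi> (\<phi> x) = x" for x
    using b by (auto simp: bij_is_inj \<psi>_def)
  then show ?thesis
    using assms(1) unfolding lie_algebra_def b2
    by (auto intro!: lin_comp[OF l] lin_comp[OF bl(1) lp] lin_comp[OF bl(2) lp]
        simp: lin_zero[OF l] simp flip: lin_add[OF l])
qed

lemma lie_bialgebra_transport:
  assumes "lie_bialgebra b1 \<delta>1" "lie_bialgebra_iso b1 \<delta>1 b2 \<delta>2 \<phi>"
  shows "lie_bialgebra b2 \<delta>2"
proof -
  define \<psi> where "\<psi> = inv_into UNIV \<phi>"
  have iso: "lie_iso b1 b2 \<phi>" and l: "lin \<phi>" and b: "bij \<phi>" and h: "\<And>x y. \<phi> (b1 x y) = b2 (\<phi> x) (\<phi> y)"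
    and d: "\<And>x. \<delta>2 (\<phi> x) = tensor_map \<phi> \<phi> (\<delta>1 x)"
    using assms by (auto simp: lie_iso_def lie_bialgebra_iso_def)
  have i: "\<phi> (\<psi> x) = x" for x
    using b by (auto simp: bij_is_surj surj_f_inv_f \<psi>_def)
  have lp: "lin \<psi>" unfolding \<psi>_def by (intro lin_inv l b)
  have L1: "lie_algebra b1" and ld: "lin \<delta>1" and fl: "\<And>x. flip (\<delta>1 x) = - \<delta>1 x"
    and co: "\<And>x. let T = tensor_map id \<delta>1 (\<delta>1 x) in T + cycle3 T + cycle3 (cycle3 T) = 0"
    and cy: "\<And>x y. \<delta>1 (b1 x y) = ad2 b1 x (\<delta>1 y) - ad2 b1 y (\<delta>1 x)"
    using assms(1) by (auto simp: lie_bialgebra_def)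
  have L2: "lie_algebra b2" by (rule lie_algebra_transport[OF L1 iso])
  have d2: "\<delta>2 = (\<lambda>x. tensor_map \<phi> \<phi> (\<delta>1 (\<psi> x)))"
    by (rule ext) (metis d i)
  have ld2: "lin \<delta>2" unfolding d2 by (rule lin_comp[OF lin_tensor_map lin_comp[OF ld lp]])
  \<comment> \<open>Iterated cobrackets correspond under \<phi> in all three factors, so co-Jacobi
    moves across.\<close>
  have "tensor_map id \<delta>2 (tensor_map \<phi> \<phi> T) = tensor_map \<phi> (tensor_map \<phi> \<phi>) (tensor_map id \<delta>1 T)" for T
  proof -
    have "id \<circ> \<phi> = \<phi> \<circ> id" "\<delta>2 \<circ> \<phi> = tensor_map \<phi> \<phi> \<circ> \<delta>1"
      by (auto simp: d)
    then show ?thesis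
      by (simp only: tensor_map_comp[OF lin_id(1) ld2 l l] tensor_map_comp[OF l lin_tensor_map lin_id(1) ld])
  qed
  then have co2: "let T = tensor_map id \<delta>2 (\<delta>2 (\<phi> x)) in T + cycle3 T + cycle3 (cycle3 T) = 0" for x
    using co[of x] by (simp add: Let_def d cycle3_tensor_map l lin_zero[OF lin_tensor_map] flip: lin_add[OF lin_tensor_map])
  have "flip (\<delta>2 (\<phi> x)) = - \<delta>2 (\<phi> x)" for x
    by (simp add: d flip_tensor_map l fl lin_uminus[OF lin_tensor_map])
  moreover have "\<delta>2 (b2 (\<phi> x) (\<phi> y)) = ad2 b2 (\<phi> x) (\<delta>2 (\<phi> y)) - ad2 b2 (\<phi> y) (\<delta>2 (\<phi> x))" for x y
    by (simp add: d cy lin_diff[OF lin_tensor_map] ad2_iso[OF iso lie_algebra_bilin[OF L1] lie_algebra_bilin[OF L2]]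
       flip: h)
  ultimately show ?thesis
    using L2 ld2 co2 unfolding lie_bialgebra_def by (metis i)
qed

section \<open>The fixed field of the absolute Galois group\<close>

text \<open>
  A \<open>K\<close>-homomorphism from a ring between \<open>K\<close> and its algebraic closure to the algebraic closure
  is represented by its graph. Single-valuedness needs to be required at \<open>0\<close> only, and injectivity
  is automatic because such a ring is a field.
\<close>

definition partial_hom :: "('k::field alg_closure \<times> 'k alg_closure) set \<Rightarrow> bool" where
  "partial_hom G \<longleftrightarrow> (\<forall>k. (to_ac k, to_ac k) \<in> G) \<and>
     (\<forall>a b c d. (a, b) \<in> G \<longrightarrow> (c, d) \<in> G \<longrightarrow> (a + c, b + d) \<in> G \<and> (a * c, b * d) \<in> G) \<and>
     (\<forall>b. (0, b) \<in> G \<longrightarrow> b = 0)"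

text \<open>\<open>q\<close> is \<open>p\<close> with the partial homomorphism applied to its
  coefficients; a relation, because \<open>G\<close> is a graph and not yet a function.\<close>

definition rel_poly :: "('a::zero \<times> 'b::zero) set \<Rightarrow> 'a poly \<Rightarrow> 'b poly \<Rightarrow> bool" where
  "rel_poly G p q \<longleftrightarrow> (\<forall>i. (Polynomial.coeff p i, Polynomial.coeff q i) \<in> G)"

text \<open>Strip vanishing constant terms from a polynomial over K that annihilates
  \<open>a\<close>: since \<open>a \<noteq> 0\<close>, the rest still annihilates it, and the first
  nonzero constant term is minus a multiple of \<open>a\<close>. Hence a ring containing K and
  \<open>a\<close> contains the inverse of \<open>a\<close>.\<close>

lemma inverse_polynomial:
  fixes a :: "'k::field alg_closure"
  assumes "a \<noteq> 0"
  obtains q :: "'k poly" where "a * poly (map_poly to_ac q) a = 1"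
proof -
  have "\<exists>q :: 'k poly. a * poly (map_poly to_ac q) a = 1"
    if "p \<noteq> 0" "poly (map_poly to_ac p) a = 0" for p :: "'k poly"
    using that
  proof (induction p)
    case 0
    then show ?case by simp
  next
    case (pCons c p)
    have e: "to_ac c + a * poly (map_poly to_ac p) a = 0"
      using pCons.prems(2) by (simp add: map_poly_pCons)
    show ?case
    proof (cases "c = 0")
      case True
      then show ?thesis using pCons e assms by auto
    next
      case False
      have "a * poly (map_poly to_ac p) a = - to_ac c"
        using e by (simp add: eq_neg_iff_add_eq_0 add.commute)
      moreover have "map_poly to_ac (Polynomial.smult (- inverse c) p) = Polynomial.smult (- inverse (to_ac c)) (map_poly to_ac p)"
        by (rule poly_eqI) (simp add: coeff_map_poly)
      ultimately have "a * poly (map_poly to_ac (Polynomial.smult (- inverse c) p)) a = - inverse (to_ac c) * (- to_ac c)"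
        using mult.left_commute[of a "- inverse (to_ac c)" "poly (map_poly to_ac p) a"] by (simp only: poly_smult)
      then have "a * poly (map_poly to_ac (Polynomial.smult (- inverse c) p)) a = 1"
        using False by simp
      then show ?thesis by blast
    qed
  qed
  then show ?thesis
    using that alg_closure_algebraic[of a] by metis
qed

section \<open>Extending a partial homomorphism by one element\<close>

context
  fixes G :: "('k::field alg_closure \<times> 'k alg_closure) set"
  assumes G: "partial_hom G"
begin

lemma ph_const: "(to_ac k, to_ac k) \<in> G"
  and ph_add: "(a, b) \<in> G \<Longrightarrow> (c, d) \<in> G \<Longrightarrow> (a + c, b + d) \<in> G"
  and ph_mult: "(a, b) \<in> G \<Longrightarrow> (c, d) \<in> G \<Longrightarrow> (a * c, b * d) \<in> G"
  and ph_zeroD: "(0, b) \<in> G \<Longrightarrow> b = 0"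
  using G by (auto simp: partial_hom_def)

lemma ph_zero: "(0, 0) \<in> G" and ph_one: "(1, 1) \<in> G"
  using ph_const[of 0] ph_const[of 1] by simp_all

lemma ph_minus: "(a, b) \<in> G \<Longrightarrow> (- a, - b) \<in> G"
  using ph_mult[OF ph_const[of "-1"]] by fastforce

lemma ph_diff: "(a, b) \<in> G \<Longrightarrow> (c, d) \<in> G \<Longrightarrow> (a - c, b - d) \<in> G"
  using ph_add[OF _ ph_minus] by fastforce

lemma ph_unique: "(a, b) \<in> G \<Longrightarrow> (a, c) \<in> G \<Longrightarrow> b = c"
  using ph_diff[of a b a c] ph_zeroD[of "b - c"] by simp

lemma ph_sum: "(\<And>i. i \<in> A \<Longrightarrow> (f i, g i) \<in> G) \<Longrightarrow> (sum f A, sum g A) \<in> G"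
  by (induction A rule: infinite_finite_induct) (auto simp: ph_zero ph_add)

lemma ph_poly:
  assumes "rel_poly G p q" "(a, b) \<in> G"
  shows "(poly p a, poly q b) \<in> G"
proof -
  have pw: "(a ^ n, b ^ n) \<in> G" for n
    by (induction n) (auto simp: ph_one ph_mult assms)
  have *: "poly p a = (\<Sum>i\<le>N. Polynomial.coeff p i * a ^ i)" if "Polynomial.degree p \<le> N"
    for p :: "'k alg_closure poly" and a N
    unfolding poly_altdef
    by (rule sum.mono_neutral_left) (use that in \<open>auto simp: coeff_eq_0\<close>)
  let ?N = "max (Polynomial.degree p) (Polynomial.degree q)"
  have "poly p a = (\<Sum>i\<le>?N. Polynomial.coeff p i * a ^ i)" "poly q b = (\<Sum>i\<le>?N. Polynomial.coeff q i * b ^ i)"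
    by (intro *; simp)+
  then show ?thesis
    using assms(1) pw by (auto simp: rel_poly_def intro!: ph_sum ph_mult)
qed

lemma rel_poly_const: "rel_poly G (map_poly to_ac p) (map_poly to_ac p)"
  by (simp add: rel_poly_def coeff_map_poly ph_const)

lemma rel_poly_arith:
  assumes "rel_poly G p q" "rel_poly G p' q'"
  shows "rel_poly G (p + p') (q + q')" "rel_poly G (p - p') (q - q')" "rel_poly G (p * p') (q * q')"
  using assms by (auto simp: rel_poly_def coeff_mult intro!: ph_add ph_diff ph_sum ph_mult)

lemma rel_poly_monom: "(a, b) \<in> G \<Longrightarrow> rel_poly G (Polynomial.monom a n) (Polynomial.monom b n)"
  by (simp add: rel_poly_def coeff_monom ph_zero)

text \<open>The inverse of \<open>a\<close> is a polynomial in \<open>a\<close> over K, so sending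
  \<open>a\<close> to 0 would send 1 to 0.\<close>

lemma ph_inj:
  assumes "(a, 0) \<in> G"
  shows "a = 0"
proof (rule ccontr)
  assume "a \<noteq> 0"
  then obtain q :: "'k poly" where q: "a * poly (map_poly to_ac q) a = 1"
    by (rule inverse_polynomial)
  have "(a * poly (map_poly to_ac q) a, 0 * poly (map_poly to_ac q) 0) \<in> G"
    by (intro ph_mult assms ph_poly rel_poly_const)
  then have "(1, 0) \<in> G" by (simp add: q)
  then show False by (metis ph_unique ph_one zero_neq_one)
qed

lemma rel_poly_degree: 
  assumes "rel_poly G p q"
  shows "Polynomial.degree q = Polynomial.degree p"
proof -
  have "Polynomial.coeff p i = 0 \<longleftrightarrow> Polynomial.coeff q i = 0" for i
    using assms ph_inj ph_zeroD unfolding rel_poly_def by metis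
  then show ?thesis by (simp add: Polynomial.degree_def)
qed

text \<open>As for simple field extensions, a root of the minimal polynomial \<open>m\<close> may be
  sent to any root of the image polynomial. The new graph collects the values at \<open>z\<close>
  and \<open>w\<close> of corresponding polynomials.\<close>

lemma partial_hom_adjoin:
  assumes m: "rel_poly G m m'" "m \<noteq> 0" "poly m z = 0" "poly m' w = 0"
    and min: "\<And>p p'. rel_poly G p p' \<Longrightarrow> p \<noteq> 0 \<Longrightarrow> poly p z = 0 \<Longrightarrow> Polynomial.degree m \<le> Polynomial.degree p"
  shows "\<exists>G'. partial_hom G' \<and> G \<subseteq> G' \<and> (z, w) \<in> G'"
proof -
  \<comment> \<open>Single-valuedness of the new graph at 0, obtained by dividing by
    \<open>m\<close> with descent on the degree.\<close>
  have root: "poly p' w = 0" if "rel_poly G p p'" "poly p z = 0" for p p'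
    using that
  proof (induction "Polynomial.degree p" arbitrary: p p' rule: less_induct)
    case (less p p')
    show ?case
    proof (cases "p = 0")
      case True
      then have "p' = 0"
        using less.prems(1) ph_zeroD by (auto simp: rel_poly_def poly_eq_iff)
      then show ?thesis by simp
    next
      case False
      let ?d = "Polynomial.degree p - Polynomial.degree m"
      let ?lp = "Polynomial.coeff p (Polynomial.degree p)" and ?lp' = "Polynomial.coeff p' (Polynomial.degree p)"
      let ?lm = "Polynomial.coeff m (Polynomial.degree m)" and ?lm' = "Polynomial.coeff m' (Polynomial.degree m)"
      \<comment> \<open>One step of pseudo-division: multiplying through by leading coefficients
        cancels the top terms and calls for no inverse in the domain of \<open>G\<close>.\<close>
      define q where "q = Polynomial.monom ?lm 0 * p - Polynomial.monom ?lp ?d * m"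
      define q' where "q' = Polynomial.monom ?lm' 0 * p' - Polynomial.monom ?lp' ?d * m'"
      have le: "Polynomial.degree m \<le> Polynomial.degree p"
        using min less.prems False by blast
      have lm: "(?lm, ?lm') \<in> G" "?lm \<noteq> 0" and lp: "(?lp, ?lp') \<in> G"
        using m less.prems by (auto simp: rel_poly_def)
      have rq: "rel_poly G q q'"
        unfolding q_def q'_def by (intro rel_poly_arith rel_poly_monom lm lp m(1) less.prems(1))
      have zq: "poly q z = 0"
        by (simp add: q_def m less.prems)
      have "poly q' w = 0"
      proof (cases "q = 0")
        case True
        then have "q' = 0"
          using rq ph_zeroD by (auto simp: rel_poly_def poly_eq_iff)
        then show ?thesis by simp
      next
        case False
        have "Polynomial.degree q < Polynomial.degree p"
        proof -
          have "Polynomial.degree q \<le> Polynomial.degree p"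
            unfolding q_def
            by (intro degree_diff_le order_trans[OF degree_mult_le])
               (use le in \<open>auto simp: monom_0 intro: order_trans[OF add_right_mono[OF degree_monom_le]]\<close>)
          moreover have "Polynomial.coeff q (Polynomial.degree p) = 0"
            using le by (simp add: q_def coeff_monom_mult)
          ultimately show ?thesis
            using False by (metis leading_coeff_0_iff le_neq_implies_less)
        qed
        moreover have "rel_poly G q q'" by (rule rq)
        ultimately show ?thesis using less.hyps zq by blast
      qed
      then have "?lm' * poly p' w = 0"
        by (simp add: q'_def m poly_monom)
      moreover have "?lm' \<noteq> 0"
        using lm ph_inj by metis
      ultimately show ?thesis by simp
    qed
  qed
  define G' where "G' = {(poly p z, poly p' w) | p p'. rel_poly G p p'}"
  have in_G': "(poly p z, poly p' w) \<in> G'" if "rel_poly G p p'" for p p'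
    using that by (auto simp: G'_def)
  have "(a, b) \<in> G'" if "(a, b) \<in> G" for a b
    using in_G'[OF rel_poly_monom[OF that, of 0]] by (simp add: poly_monom)
  then have sub: "G \<subseteq> G'" by auto
  have "(z, w) \<in> G'"
    using in_G'[OF rel_poly_monom[OF ph_one, of 1]] by (simp add: poly_monom)
  moreover have "partial_hom G'"
    unfolding partial_hom_def
  proof (intro conjI allI impI)
    show "(to_ac k, to_ac k) \<in> G'" for k using sub ph_const by blast
    fix a b c d assume "(a, b) \<in> G'" "(c, d) \<in> G'"
    then obtain p p' q q' where "a = poly p z" "b = poly p' w" "c = poly q z" "d = poly q' w"
      "rel_poly G p p'" "rel_poly G q q'"
      by (auto simp: G'_def)
    then show "(a + c, b + d) \<in> G'" "(a * c, b * d) \<in> G'"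
      using in_G'[of "p + q" "p' + q'"] in_G'[of "p * q" "p' * q'"] by (simp_all add: rel_poly_arith)
  next
    fix b assume "(0, b) \<in> G'"
    then show "b = 0" using root by (auto simp: G'_def)
  qed
  ultimately show ?thesis using sub by blast
qed

lemma minimal_rel_poly:
  obtains m m' where "rel_poly G m m'" "m \<noteq> 0" "poly m z = 0"
    "\<And>p p'. rel_poly G p p' \<Longrightarrow> p \<noteq> 0 \<Longrightarrow> poly p z = 0 \<Longrightarrow> Polynomial.degree m \<le> Polynomial.degree p"
proof -
  let ?P = "\<lambda>(m, m'). rel_poly G m m' \<and> m \<noteq> 0 \<and> poly m z = 0"
  obtain p :: "'k poly" where p: "p \<noteq> 0" "poly (map_poly to_ac p) z = 0"
    by (rule alg_closure_algebraic)
  have "?P (map_poly to_ac p, map_poly to_ac p)"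
    using p by (auto simp: rel_poly_const map_poly_eq_0_iff)
  from ex_has_least_nat[of ?P, OF this, of "\<lambda>(m, m'). Polynomial.degree m"]
  show ?thesis using that by fastforce
qed

end

text \<open>Zorn's lemma on graphs: a maximal one has full domain, because any \<open>z\<close> can
  be adjoined.\<close>

lemma partial_hom_total:
  assumes "partial_hom G"
  obtains M where "partial_hom M" "G \<subseteq> M" "Domain M = UNIV"
proof -
  let ?A = "{M. partial_hom M \<and> G \<subseteq> M}"
  have "\<exists>M\<in>?A. \<forall>U\<in>?A. M \<subseteq> U \<longrightarrow> U = M"
  proof (rule subset_Zorn_nonempty)
    show "?A \<noteq> {}" using assms by auto
    fix C assume C: "C \<noteq> {}" "subset.chain ?A C"
    have ph: "partial_hom U" "G \<subseteq> U" if "U \<in> C" for U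
      using C that by (auto simp: subset.chain_def)
    have both: "\<exists>U\<in>C. x \<in> U \<and> y \<in> U" if xy: "x \<in> \<Union>C" "y \<in> \<Union>C" for x y
    proof -
      obtain U V where "x \<in> U" "y \<in> V" "U \<in> C" "V \<in> C" using xy by blast
      moreover then have "U \<subseteq> V \<or> V \<subseteq> U"
        using C(2) unfolding subset_chain_def by blast
      ultimately show ?thesis by blast
    qed
    have "partial_hom (\<Union>C)"
      unfolding partial_hom_def
    proof (intro conjI allI impI)
      show "(to_ac k, to_ac k) \<in> \<Union>C" for k
        using C(1) ph ph_const by blast
      fix a b c d assume "(a, b) \<in> \<Union>C" "(c, d) \<in> \<Union>C"
      then obtain U where "U \<in> C" "(a, b) \<in> U" "(c, d) \<in> U" using both by blast
      then show "(a + c, b + d) \<in> \<Union>C" "(a * c, b * d) \<in> \<Union>C"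
        using ph ph_add ph_mult by blast+
    next
      fix b assume "(0, b) \<in> \<Union>C"
      then show "b = 0" using ph ph_zeroD by blast
    qed
    then show "\<Union>C \<in> ?A" using C(1) ph by blast
  qed
  then obtain M where M: "partial_hom M" "G \<subseteq> M" and max: "\<And>U. partial_hom U \<Longrightarrow> M \<subseteq> U \<Longrightarrow> U = M"
    by (auto 0 4)
  have "z \<in> Domain M" for z
  proof -
    obtain m m' where m: "rel_poly M m m'" "m \<noteq> 0" "poly m z = 0"
      and min: "\<And>p p'. rel_poly M p p' \<Longrightarrow> p \<noteq> 0 \<Longrightarrow> poly p z = 0 \<Longrightarrow> Polynomial.degree m \<le> Polynomial.degree p"
      by (rule minimal_rel_poly[OF M(1)]) blast
    \<comment> \<open>A nonzero constant has no root, so \<open>m\<close> is not constant; its image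
      has the same degree and therefore a root in the closure.\<close>
    have "Polynomial.degree m \<noteq> 0"
      using m by (metis degree_0_id leading_coeff_0_iff mult_zero_right poly_const_conv pCons_0_0)
    then have "Polynomial.degree m' \<noteq> 0"
      using rel_poly_degree[OF M(1) m(1)] by simp
    then obtain w where "poly m' w = 0"
      using alg_closed_imp_poly_has_root[of m'] by auto
    then have "\<exists>G'. partial_hom G' \<and> M \<subseteq> G' \<and> (z, w) \<in> G'"
      by (rule partial_hom_adjoin[OF M(1) m]) (rule min)
    then show ?thesis using max by blast
  qed
  then show ?thesis using that M by blast
qed

lemma partial_hom_in_abs_gal:
  assumes M: "partial_hom M" "Domain M = UNIV"
  obtains \<sigma> where "\<sigma> \<in> abs_gal" "\<And>a b. (a, b) \<in> M \<Longrightarrow> \<sigma> a = b"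
proof -
  define \<sigma> where "\<sigma> a = (THE b. (a, b) \<in> M)" for a
  have \<sigma>: "\<sigma> a = b" if "(a, b) \<in> M" for a b
    unfolding \<sigma>_def using that ph_unique[OF M(1)] by blast
  have inM: "(a, \<sigma> a) \<in> M" for a
    using M(2) \<sigma> by blast
  have add: "\<sigma> (a + b) = \<sigma> a + \<sigma> b" and mult: "\<sigma> (a * b) = \<sigma> a * \<sigma> b" and const: "\<sigma> (to_ac k) = to_ac k" for a b k
    by (intro \<sigma> ph_add ph_mult ph_const M inM)+
  have inj: "inj \<sigma>"
  proof (rule injI)
    fix a b assume "\<sigma> a = \<sigma> b"
    then have "(a - b, 0) \<in> M"
      using ph_diff[OF M(1) inM[of a] inM[of b]] by simp
    then show "a = b" using ph_inj[OF M(1), of "a - b"] by simp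
  qed
  \<comment> \<open>An injective \<sigma> over K maps the finite root set of a polynomial over K
    into itself, hence onto itself.\<close>
  have "\<exists>a. \<sigma> a = b" for b
  proof -
    obtain p :: "'a poly" where p: "p \<noteq> 0" "poly (map_poly to_ac p) b = 0"
      by (rule alg_closure_algebraic)
    let ?R = "{a. poly (map_poly to_ac p) a = 0}"
    have "finite ?R"
      using p by (intro poly_roots_finite) (simp add: map_poly_eq_0_iff)
    moreover have "poly (map_poly to_ac p) (\<sigma> a) = \<sigma> (poly (map_poly to_ac p) a)" for a
      using \<sigma>[OF ph_poly[OF M(1) rel_poly_const[OF M(1)] inM]] by simp
    then have "\<sigma> ` ?R \<subseteq> ?R"
      using const[of 0] by auto
    ultimately have "\<sigma> ` ?R = ?R"
      using endo_inj_surj inj by (metis inj_on_subset subset_UNIV)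
    then have "b \<in> \<sigma> ` ?R" using p by simp
    then show ?thesis by blast
  qed
  then have "bij \<sigma>" using inj by (metis bij_def surjI)
  then have "\<sigma> \<in> abs_gal"
    using add mult const by (auto simp: gal_def)
  then show ?thesis using that \<sigma> by blast
qed

text \<open>If the minimal polynomial of \<open>x\<close> is not linear, it has a second root
  \<open>y\<close>, since its roots are simple in characteristic zero. Sending \<open>x\<close> to
  \<open>y\<close> then extends to a Galois element that moves \<open>x\<close>.\<close>

theorem fixed_field_abs_gal:
  fixes x :: "'k::field_char_0 alg_closure"
  assumes "\<forall>\<gamma>\<in>abs_gal. \<gamma> x = x"
  shows "x \<in> range to_ac"
proof -
  define G :: "('k alg_closure \<times> 'k alg_closure) set" where "G = {(to_ac k, to_ac k) | k. True}"
  have G: "partial_hom G"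
    by (auto simp: partial_hom_def G_def) (metis to_ac_add, metis to_ac_mult)
  have diag: "p = p'" if "rel_poly G p p'" for p p'
    using that by (auto simp: rel_poly_def G_def poly_eq_iff) metis
  obtain m m' where m: "rel_poly G m m'" "m \<noteq> 0" "poly m x = 0"
    and min: "\<And>p p'. rel_poly G p p' \<Longrightarrow> p \<noteq> 0 \<Longrightarrow> poly p x = 0 \<Longrightarrow> Polynomial.degree m \<le> Polynomial.degree p"
    by (rule minimal_rel_poly[OF G]) blast
  have mm: "m' = m" using diag[OF m(1)] by simp
  have coeff: "Polynomial.coeff m i \<in> range to_ac" for i
    using m(1) by (auto simp: rel_poly_def G_def)
  from m(3) obtain q where q: "m = [:- x, 1:] * q"
    by (auto simp: poly_eq_0_iff_dvd dvd_def)
  have q0: "q \<noteq> 0" using m q by auto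
  have deg: "Polynomial.degree m = Suc (Polynomial.degree q)"
    unfolding q using q0 by (subst degree_mult_eq) auto
  \<comment> \<open>A double root would make \<open>x\<close> a root of the derivative, which is
    nonzero in characteristic zero and of smaller degree than the minimal \<open>m\<close>.\<close>
  have sep: "poly q x \<noteq> 0"
  proof
    assume "poly q x = 0"
    then have "poly (pderiv m) x = 0"
      by (simp only: q pderiv_mult poly_add poly_mult) simp
    moreover have "rel_poly G (pderiv m) (pderiv m)"
    proof -
      have "Polynomial.coeff (pderiv m) i \<in> range to_ac" for i
        using coeff[of "Suc i"] by (auto simp: coeff_pderiv) (metis rangeI to_ac_mult to_ac_of_nat to_ac_add to_ac_1)
      then show ?thesis by (auto simp: rel_poly_def G_def)
    qed
    moreover have "pderiv m \<noteq> 0" using deg by (simp add: pderiv_eq_0_iff)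
    ultimately have "Polynomial.degree m \<le> Polynomial.degree (pderiv m)" by (rule min[rotated 2])
    then show False using deg by (simp add: degree_pderiv)
  qed
  show ?thesis
  proof (cases "Polynomial.degree q = 0")
    case True
    then obtain c where c: "q = [:c:]" by (metis degree_eq_zeroE)
    have "Polynomial.coeff m 0 = - x * c" "Polynomial.coeff m 1 = c"
      by (simp_all add: q c)
    then obtain k l where "to_ac k = - x * c" "to_ac l = c"
      using coeff[of 0] coeff[of 1] by (metis imageE)
    moreover have "c \<noteq> 0" using c q0 by auto
    ultimately have "x = to_ac (- k / l)" by simp
    then show ?thesis by blast
  next
    case False
    then obtain y where y: "poly q y = 0"
      using alg_closed_imp_poly_has_root[of q] by auto
    then have "poly m' y = 0" by (simp add: mm q)
    then have "\<exists>G'. partial_hom G' \<and> G \<subseteq> G' \<and> (x, y) \<in> G'"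
      by (rule partial_hom_adjoin[OF G m]) (rule min)
    then obtain G' where G': "partial_hom G'" "(x, y) \<in> G'" by blast
    obtain M where M: "partial_hom M" "G' \<subseteq> M" "Domain M = UNIV"
      by (rule partial_hom_total[OF G'(1)])
    obtain \<sigma> where "\<sigma> \<in> abs_gal" "\<And>a b. (a, b) \<in> M \<Longrightarrow> \<sigma> a = b"
      by (rule partial_hom_in_abs_gal[OF M(1,3)]) blast
    then have "y = x" using assms G' M by blast
    then show ?thesis using y sep by simp
  qed
qed

section \<open>The Galois action on linear maps\<close>

lemma field_hom_to_ac: "field_hom to_ac"
  by unfold_locales auto

lemma field_hom_of_rat: "field_hom (of_rat :: rat \<Rightarrow> 'a::field_char_0)"
  by unfold_locales (auto simp: of_rat_add of_rat_mult)

lemma abs_galD: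
  assumes "\<gamma> \<in> abs_gal"
  shows "bij \<gamma>" "\<gamma> (x + y) = \<gamma> x + \<gamma> y" "\<gamma> (x * y) = \<gamma> x * \<gamma> y" "\<gamma> (to_ac k) = to_ac k"
  using assms by (auto simp: gal_def)

lemma field_hom_abs_gal: "\<gamma> \<in> abs_gal \<Longrightarrow> field_hom \<gamma>"
  by unfold_locales (use abs_galD(2-4)[of \<gamma>] to_ac_1 in metis)+

lemma abs_gal_id: "id \<in> abs_gal"
  by (simp add: gal_def)

lemma abs_gal_comp: "\<gamma> \<in> abs_gal \<Longrightarrow> \<eta> \<in> abs_gal \<Longrightarrow> \<gamma> \<circ> \<eta> \<in> abs_gal"
  by (auto simp: gal_def bij_comp)

lemma abs_gal_inv_cancel:
  assumes "\<gamma> \<in> abs_gal"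
  shows "\<gamma> (inv_into UNIV \<gamma> x) = x" "inv_into UNIV \<gamma> (\<gamma> x) = x"
  using abs_galD(1)[OF assms] by (auto simp: bij_is_inj bij_is_surj surj_f_inv_f)

lemma abs_gal_inv:
  assumes "\<gamma> \<in> abs_gal"
  shows "inv_into UNIV \<gamma> \<in> abs_gal"
proof -
  note c = abs_gal_inv_cancel[OF assms] and g = abs_galD[OF assms]
  have "inv_into UNIV \<gamma> (x + y) = inv_into UNIV \<gamma> x + inv_into UNIV \<gamma> y"
    "inv_into UNIV \<gamma> (x * y) = inv_into UNIV \<gamma> x * inv_into UNIV \<gamma> y" for x y
    by (metis c g(2)) (metis c g(3))
  moreover have "inv_into UNIV \<gamma> (to_ac k) = to_ac k" for k
    by (metis c(2) g(4))
  ultimately show ?thesis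
    using bij_imp_bij_inv[OF g(1)] by (auto simp: gal_def)
qed

lemma vmap_inv_cancel:
  assumes "\<gamma> \<in> abs_gal"
  shows "vmap \<gamma> (vmap (inv_into UNIV \<gamma>) x) = x" "vmap (inv_into UNIV \<gamma>) (vmap \<gamma> x) = x"
  by (simp_all add: vec_eq_iff abs_gal_inv_cancel[OF assms])

lemma gal_act_vmap: "\<gamma> \<in> abs_gal \<Longrightarrow> gal_act \<gamma> \<phi> (vmap \<gamma> x) = vmap \<gamma> (\<phi> x)"
  by (simp add: gal_act_def vmap_inv_cancel)

lemma gal_act_eqI:
  assumes "\<gamma> \<in> abs_gal" "\<And>x. \<psi> (vmap \<gamma> x) = vmap \<gamma> (\<phi> x)"
  shows "gal_act \<gamma> \<phi> = \<psi>"
proof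
  fix x
  show "gal_act \<gamma> \<phi> x = \<psi> x"
    using assms(2)[of "vmap (inv_into UNIV \<gamma>) x"] by (simp add: gal_act_def vmap_inv_cancel assms(1))
qed

lemma lin_gal_act:
  assumes "\<gamma> \<in> abs_gal" "lin \<phi>"
  shows "lin (gal_act \<gamma> \<phi>)"
proof -
  interpret g: field_hom \<gamma> by (rule field_hom_abs_gal[OF assms(1)])
  interpret i: field_hom "inv_into UNIV \<gamma>" by (rule field_hom_abs_gal[OF abs_gal_inv[OF assms(1)]])
  show ?thesis
    by (rule linI) (simp_all add: gal_act_def g.vmap_add i.vmap_add g.vmap_smult i.vmap_smult
      lin_add[OF assms(2)] lin_smult[OF assms(2)] abs_gal_inv_cancel[OF assms(1)])
qed

text \<open>Conjugation by \<gamma> is an instance of extension of scalars along \<gamma>, so the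
  transfer lemmas apply to the Galois action.\<close>

lemma lin_extends_gal_act:
  "\<gamma> \<in> abs_gal \<Longrightarrow> lin \<phi> \<Longrightarrow> lin_extends \<gamma> \<phi> (gal_act \<gamma> \<phi>)"
  by (simp add: lin_extends_def lin_gal_act gal_act_vmap)

lemma gal_act_comp: "\<gamma> \<in> abs_gal \<Longrightarrow> gal_act \<gamma> (\<phi> \<circ> \<psi>) = gal_act \<gamma> \<phi> \<circ> gal_act \<gamma> \<psi>"
  by (rule gal_act_eqI) (simp_all add: gal_act_vmap)

lemma gal_act_id: "\<gamma> \<in> abs_gal \<Longrightarrow> gal_act \<gamma> id = id"
  by (rule gal_act_eqI) simp_all

lemma gal_act_gal_act:
  "\<gamma> \<in> abs_gal \<Longrightarrow> \<eta> \<in> abs_gal \<Longrightarrow> gal_act (\<gamma> \<circ> \<eta>) \<phi> = gal_act \<gamma> (gal_act \<eta> \<phi>)"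
  by (rule gal_act_eqI) (simp_all add: abs_gal_comp gal_act_vmap flip: vmap_comp)

lemma gal_act_by_id: "gal_act id \<phi> = \<phi>"
  by (rule gal_act_eqI) (simp_all add: abs_gal_id vec_eq_iff vmap_def)

lemma bij_gal_act:
  assumes "\<gamma> \<in> abs_gal" "bij \<phi>"
  shows "bij (gal_act \<gamma> \<phi>)" "gal_act \<gamma> (inv_into UNIV \<phi>) = inv_into UNIV (gal_act \<gamma> \<phi>)"
proof -
  have 1: "gal_act \<gamma> \<phi> \<circ> gal_act \<gamma> (inv_into UNIV \<phi>) = id"
    using assms by (simp add: gal_act_id surj_iff[THEN iffD1, OF bij_is_surj] flip: gal_act_comp)
  have 2: "gal_act \<gamma> (inv_into UNIV \<phi>) \<circ> gal_act \<gamma> \<phi> = id"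
    using assms by (simp add: bij_is_inj gal_act_id flip: gal_act_comp)
  show "bij (gal_act \<gamma> \<phi>)" by (rule o_bij[OF 2 1])
  show "gal_act \<gamma> (inv_into UNIV \<phi>) = inv_into UNIV (gal_act \<gamma> \<phi>)"
    using 1 2 by (simp add: inv_unique_comp)
qed

lemma vmap_to_ac_fixed: "\<gamma> \<in> abs_gal \<Longrightarrow> vmap \<gamma> (vmap to_ac x) = vmap to_ac x"
  by (simp add: vec_eq_iff abs_galD(4))

lemma gal_act_extension:
  assumes "\<gamma> \<in> abs_gal" "lin_extends to_ac \<psi> \<phi>"
  shows "gal_act \<gamma> \<phi> = \<phi>"
proof (rule field_hom.lin_eq_vmapI[OF field_hom_to_ac])
  have l: "lin \<phi>" using assms by (simp add: lin_extends_def)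
  show "lin (gal_act \<gamma> \<phi>)" "lin \<phi>" by (intro lin_gal_act assms l)+
  fix x
  show "gal_act \<gamma> \<phi> (vmap to_ac x) = \<phi> (vmap to_ac x)"
    using gal_act_vmap[OF assms(1), of \<phi> "vmap to_ac x"]
    by (simp add: vmap_to_ac_fixed assms(1) lin_extendsD(3)[OF assms(2)])
qed

section \<open>Descent of vectors and maps\<close>

lemma vmap_fixed:
  fixes x :: "'k::field_char_0 alg_closure ^ 'n"
  assumes "\<And>\<gamma>. \<gamma> \<in> abs_gal \<Longrightarrow> vmap \<gamma> x = x"
  obtains y where "x = vmap to_ac y"
proof -
  have "x $ i \<in> range to_ac" for i
    by (rule fixed_field_abs_gal) (metis assms vmap_nth)
  then have "x = vmap to_ac (\<chi> i. of_ac (x $ i))"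
    by (simp add: vec_eq_iff to_ac_of_ac)
  then show ?thesis using that by blast
qed

text \<open>Equivariance makes the image of a K-rational vector Galois invariant, hence K-rational
  because the fixed field is K.\<close>

lemma descend_lin:
  fixes \<phi> :: "'k::field_char_0 alg_closure ^ 'm::finite \<Rightarrow> 'k alg_closure ^ 'n::finite"
  assumes "lin \<phi>" "\<And>\<gamma> x. \<gamma> \<in> abs_gal \<Longrightarrow> \<phi> (vmap \<gamma> x) = vmap \<gamma> (\<phi> x)"
  obtains \<psi> where "lin_extends to_ac \<psi> \<phi>"
proof -
  interpret field_hom "to_ac :: 'k \<Rightarrow> _" by (rule field_hom_to_ac)
  have "\<exists>y. \<phi> (vmap to_ac x) = vmap to_ac y" for x
    by (rule vmap_fixed[of "\<phi> (vmap to_ac x)"]) (auto simp: vmap_to_ac_fixed simp flip: assms(2))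
  then obtain \<psi> where \<psi>: "\<And>x. \<phi> (vmap to_ac x) = vmap to_ac (\<psi> x)" by metis
  have "lin \<psi>"
  proof (rule linI)
    show "\<psi> (x + y) = \<psi> x + \<psi> y" for x y
      by (metis \<psi> vmap_add vmap_eq_iff lin_add[OF assms(1)])
    show "\<psi> (c *s x) = c *s \<psi> x" for c x
      by (metis \<psi> vmap_smult vmap_eq_iff lin_smult[OF assms(1)])
  qed
  then show ?thesis using that \<psi> assms(1) by (auto simp: lin_extends_def)
qed

lemma descend_bilin:
  fixes \<beta> :: "'k::field_char_0 alg_closure ^ 'm::finite \<Rightarrow> 'k alg_closure ^ 'p::finite \<Rightarrow> 'k alg_closure ^ 'n::finite"
  assumes "bilin \<beta>" "\<And>\<gamma> x y. \<gamma> \<in> abs_gal \<Longrightarrow> \<beta> (vmap \<gamma> x) (vmap \<gamma> y) = vmap \<gamma> (\<beta> x y)"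
  obtains \<beta>' where "bilin_extends to_ac \<beta>' \<beta>"
proof -
  interpret field_hom "to_ac :: 'k \<Rightarrow> _" by (rule field_hom_to_ac)
  have "\<exists>z. \<beta> (vmap to_ac x) (vmap to_ac y) = vmap to_ac z" for x y
    by (rule vmap_fixed[of "\<beta> (vmap to_ac x) (vmap to_ac y)"]) (auto simp: vmap_to_ac_fixed simp flip: assms(2))
  then obtain \<beta>' where \<beta>': "\<And>x y. \<beta> (vmap to_ac x) (vmap to_ac y) = vmap to_ac (\<beta>' x y)" by metis
  note l = lin_add[OF bilin_lin(1)[OF assms(1)]] lin_add[OF bilin_lin(2)[OF assms(1)]]
    lin_smult[OF bilin_lin(1)[OF assms(1)]] lin_smult[OF bilin_lin(2)[OF assms(1)]]
  have "bilin \<beta>'"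
  proof (intro bilinI linI)
    show "\<beta>' x (y + z) = \<beta>' x y + \<beta>' x z" for x y z
      by (metis \<beta>' vmap_add vmap_eq_iff l)
    show "\<beta>' x (c *s y) = c *s \<beta>' x y" for c x y
      by (metis \<beta>' vmap_smult vmap_eq_iff l)
    show "\<beta>' (y + z) x = \<beta>' y x + \<beta>' z x" for x y z
      by (metis \<beta>' vmap_add vmap_eq_iff l)
    show "\<beta>' (c *s y) x = c *s \<beta>' y x" for c x y
      by (metis \<beta>' vmap_smult vmap_eq_iff l)
  qed
  then show ?thesis using that \<beta>' assms(1) by (auto simp: bilin_extends_def)
qed

section \<open>Continuity in the Krull topology\<close>

text \<open>The preimage of the single point \<open>u id\<close> is open, and a basic neighbourhood
  of \<open>id\<close> inside it constrains values at finitely many elements only.\<close>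

lemma continuous_krullD:
  assumes "continuous_map krull_topology (discrete_topology A) u"
  obtains F where "finite F" "\<And>\<gamma>. \<gamma> \<in> abs_gal \<Longrightarrow> (\<And>a. a \<in> F \<Longrightarrow> \<gamma> a = a) \<Longrightarrow> u \<gamma> = u id"
proof -
  have ts: "topspace krull_topology = abs_gal" by (simp add: krull_topology_def)
  then have "u id \<in> A"
    using assms abs_gal_id by (auto simp: continuous_map_def)
  then have "openin krull_topology {\<gamma> \<in> abs_gal. u \<gamma> \<in> {u id}}"
    using openin_continuous_map_preimage[OF assms, of "{u id}"] by (simp add: ts)
  then obtain T where T: "openin (product_topology (\<lambda>_. discrete_topology UNIV) UNIV) T"
    "{\<gamma> \<in> abs_gal. u \<gamma> \<in> {u id}} = T \<inter> abs_gal"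
    unfolding krull_topology_def openin_subtopology by blast
  have "id \<in> T" using T(2) abs_gal_id by blast
  from product_topology_open_contains_basis[OF T(1) this]
  obtain V where V: "id \<in> (\<Pi>\<^sub>E i\<in>UNIV. V i)" "finite {i. V i \<noteq> UNIV}" "(\<Pi>\<^sub>E i\<in>UNIV. V i) \<subseteq> T"
    by auto
  show ?thesis
  proof (rule that[OF V(2)])
    fix \<gamma> assume \<gamma>: "\<gamma> \<in> abs_gal" "\<And>a. a \<in> {i. V i \<noteq> UNIV} \<Longrightarrow> \<gamma> a = a"
    have "\<gamma> i \<in> V i" for i
      using \<gamma>(2)[of i] V(1) by (cases "V i = UNIV") (auto simp: PiE_iff)
    then have "\<gamma> \<in> T" using V(3) by (auto simp: PiE_iff)
    then show "u \<gamma> = u id" using T(2) \<gamma>(1) by blast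
  qed
qed

text \<open>Prescribing values on the finite set \<open>F\<close> cuts out an open set, so a map
  that depends only on these values has open fibres.\<close>

lemma continuous_krullI:
  assumes "finite F" "\<And>\<gamma>. \<gamma> \<in> abs_gal \<Longrightarrow> u \<gamma> \<in> A"
    and "\<And>\<gamma> \<eta>. \<gamma> \<in> abs_gal \<Longrightarrow> \<eta> \<in> abs_gal \<Longrightarrow> (\<And>a. a \<in> F \<Longrightarrow> \<gamma> a = \<eta> a) \<Longrightarrow> u \<gamma> = u \<eta>"
  shows "continuous_map krull_topology (discrete_topology A) u"
proof -
  have ts: "topspace krull_topology = abs_gal" by (simp add: krull_topology_def)
  let ?P = "product_topology (\<lambda>_. discrete_topology UNIV) UNIV"
  have "openin krull_topology {\<gamma> \<in> abs_gal. u \<gamma> \<in> U}" for U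
  proof -
    define N where "N \<gamma> = (\<Pi>\<^sub>E a\<in>UNIV. if a \<in> F then {\<gamma> a} else UNIV)" for \<gamma> :: "'a alg_closure \<Rightarrow> 'a alg_closure"
    have "openin ?P (N \<gamma>)" for \<gamma>
      unfolding N_def
      by (rule product_topology_basis) (auto intro: finite_subset[OF _ assms(1)] split: if_splits)
    then have "openin ?P (\<Union>\<gamma>\<in>{\<gamma> \<in> abs_gal. u \<gamma> \<in> U}. N \<gamma>)"
      by blast
    moreover have N: "\<eta> \<in> N \<gamma> \<longleftrightarrow> (\<forall>a\<in>F. \<eta> a = \<gamma> a)" for \<eta> \<gamma>
      by (auto simp: N_def PiE_iff)
    moreover have "{\<gamma> \<in> abs_gal. u \<gamma> \<in> U} = (\<Union>\<gamma>\<in>{\<gamma> \<in> abs_gal. u \<gamma> \<in> U}. N \<gamma>) \<inter> abs_gal"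
    proof (intro equalityI subsetI)
      fix \<eta> assume "\<eta> \<in> (\<Union>\<gamma>\<in>{\<gamma> \<in> abs_gal. u \<gamma> \<in> U}. N \<gamma>) \<inter> abs_gal"
      then obtain \<gamma> where "\<gamma> \<in> abs_gal" "u \<gamma> \<in> U" "\<And>a. a \<in> F \<Longrightarrow> \<eta> a = \<gamma> a" "\<eta> \<in> abs_gal"
        using N by auto
      then show "\<eta> \<in> {\<gamma> \<in> abs_gal. u \<gamma> \<in> U}"
        using assms(3)[of \<eta> \<gamma>] by simp
    qed (use N in auto)
    ultimately show ?thesis
      unfolding krull_topology_def openin_subtopology by blast
  qed
  then show ?thesis
    using assms(2) by (auto simp: continuous_map_def ts)
qed

section \<open>Hilbert 90 for the general linear group\<close>

text \<open>Galois elements permute the roots of any polynomial over K that annihilates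
  \<open>a\<close>.\<close>

lemma finite_abs_gal_orbit:
  fixes a :: "'k::field alg_closure"
  shows "finite {\<gamma> a | \<gamma>. \<gamma> \<in> abs_gal}"
proof -
  obtain p :: "'k poly" where p: "p \<noteq> 0" "poly (map_poly to_ac p) a = 0"
    by (rule alg_closure_algebraic)
  let ?R = "{a. poly (map_poly to_ac p) a = 0}"
  have "finite ?R"
    using p by (intro poly_roots_finite) (simp add: map_poly_eq_0_iff)
  moreover have "\<gamma> a \<in> ?R" if g: "\<gamma> \<in> abs_gal" for \<gamma>
  proof -
    interpret field_hom \<gamma> by (rule field_hom_abs_gal[OF g])
    have pw: "\<gamma> (x ^ n) = \<gamma> x ^ n" for x n
      by (induction n) (simp_all add: hom_one hom_mult)
    have "poly (map_poly to_ac p) (\<gamma> a) = \<gamma> (poly (map_poly to_ac p) a)"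
      by (simp add: poly_altdef coeff_map_poly hom_sum hom_mult pw abs_galD(4)[OF g])
    then show ?thesis using p(2) by (simp add: hom_zero)
  qed
  ultimately show ?thesis by (elim finite_subset[rotated]) auto
qed

text \<open>Independence of characters relative to a subspace: the coefficients are vectors, and
  vanishing becomes membership in \<open>W\<close>. The hypothesis is tested only on a
  multiplicative set \<open>L\<close> separating the characters, because the averages to which it is
  applied are fixed only for scalars from such a set.\<close>

lemma dedekind_independence:
  fixes S :: "('a::monoid_mult \<Rightarrow> 'b::field) set" and v :: "_ \<Rightarrow> 'b ^ 'n"
  assumes "finite S" "vec.subspace W" "1 \<in> L"
    and "\<And>a b. a \<in> L \<Longrightarrow> b \<in> L \<Longrightarrow> a * b \<in> L"
    and "\<And>s. s \<in> S \<Longrightarrow> s 1 = 1" "\<And>s a b. s \<in> S \<Longrightarrow> s (a * b) = s a * s b"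
    and "\<And>s t. s \<in> S \<Longrightarrow> t \<in> S \<Longrightarrow> s \<noteq> t \<Longrightarrow> \<exists>b\<in>L. s b \<noteq> t b"
    and "\<And>a. a \<in> L \<Longrightarrow> (\<Sum>s\<in>S. s a *s v s) \<in> W"
    and "s \<in> S"
  shows "v s \<in> W"
  using assms(1,5-9)
proof (induction S arbitrary: v s rule: finite_induct)
  case empty
  then show ?case by simp
next
  case (insert t S)
  have S: "v s \<in> W" if s: "s \<in> S" for s
  proof -
    obtain b where b: "b \<in> L" "s b \<noteq> t b"
      using insert.prems(3)[of s t] s insert.hyps(2) by auto
    have "(s b - t b) *s v s \<in> W"
    proof (rule insert.IH[of "\<lambda>s. (s b - t b) *s v s"])
      fix a assume a: "a \<in> L"
      \<comment> \<open>The relation at \<open>a * b\<close> minus \<open>t b\<close> times the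
        relation at \<open>a\<close>: the \<open>t\<close> term drops out and every other
        coefficient is scaled by \<open>s b - t b\<close>.\<close>
      have "(\<Sum>s\<in>insert t S. s (a * b) *s v s) - t b *s (\<Sum>s\<in>insert t S. s a *s v s) \<in> W"
        using insert.prems(4)[of "a * b"] insert.prems(4)[of a] a b(1) assms(2,4)
        by (intro vec.subspace_diff vec.subspace_scale) auto
      also have "(\<Sum>s\<in>insert t S. s (a * b) *s v s) - t b *s (\<Sum>s\<in>insert t S. s a *s v s) =
          (\<Sum>s\<in>insert t S. s a *s ((s b - t b) *s v s))"
        unfolding vec.scale_sum_right sum_subtractf[symmetric]
        by (rule sum.cong) (simp_all add: insert.prems(2) algebra_simps vec.scale_left_diff_distrib)
      also have "\<dots> = (\<Sum>s\<in>S. s a *s ((s b - t b) *s v s))"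
        using insert.hyps by simp
      finally show "(\<Sum>s\<in>S. s a *s ((s b - t b) *s v s)) \<in> W" .
    qed (use insert.prems s in auto)
    then have "inverse (s b - t b) *s ((s b - t b) *s v s) \<in> W"
      by (rule vec.subspace_scale[OF assms(2)])
    moreover have nz: "s b - t b \<noteq> 0" using b(2) by simp
    ultimately show ?thesis
      by (simp only: vec.scale_scale left_inverse[OF nz] vec.scale_one)
  qed
  have "v t \<in> W"
  proof -
    have "(\<Sum>s\<in>insert t S. s 1 *s v s) \<in> W"
      by (rule insert.prems(4)[OF assms(3)])
    also have "(\<Sum>s\<in>insert t S. s 1 *s v s) = (\<Sum>s\<in>insert t S. v s)"
      by (rule sum.cong[OF refl]) (metis insert.prems(1) vec.scale_one)
    finally have "v t + (\<Sum>s\<in>S. v s) \<in> W"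
      using insert.hyps by simp
    then have "v t + (\<Sum>s\<in>S. v s) - (\<Sum>s\<in>S. v s) \<in> W"
      by (intro vec.subspace_diff[OF assms(2)] vec.subspace_sum[OF assms(2)] S)
    then show ?thesis by simp
  qed
  then show ?case using S insert.prems(5) by auto
qed

lemma spanning_basis:
  fixes W :: "('a::field ^ 'n) set"
  assumes span: "vec.span W = UNIV"
  obtains \<rho> :: "'a ^ 'n \<Rightarrow> 'a ^ 'n" where "lin \<rho>" "bij \<rho>" "\<And>i. \<rho> (basis_vec i) \<in> W"
proof -
  obtain E where E: "E \<subseteq> W" "vec.independent E" "W \<subseteq> vec.span E" "card E = vec.dim W"
    by (rule vec.basis_exists)
  have spanE: "vec.span E = UNIV"
    using E(1,3) span by (metis UNIV_I subsetI subset_antisym vec.span_mono vec.span_span)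
  have finE: "finite E" using E(2) by (rule vec.finiteI_independent)
  have "card E = CARD('n)"
    using E(4) span by (metis vec.dim_span vec_dim_card)
  then obtain e :: "'n \<Rightarrow> _" where e: "bij_betw e UNIV E"
    using finE by (metis finite_same_card_bij finite)
  define \<rho> where "\<rho> x = (\<Sum>i\<in>UNIV. x $ i *s e i)" for x
  have lin\<rho>: "lin \<rho>"
    by (rule linI) (simp_all add: \<rho>_def vec.scale_left_distrib sum.distrib vec.scale_sum_right)
  have \<rho>_basis: "\<rho> (basis_vec i) = e i" for i
  proof -
    have "\<rho> (basis_vec i) = (\<Sum>j\<in>UNIV. if j = i then e j else 0)"
      unfolding \<rho>_def by (rule sum.cong) (auto simp: axis_def)
    then show ?thesis by simp
  qed
  have "E \<subseteq> range \<rho>"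
    using e \<rho>_basis by (metis bij_betw_imp_surj_on image_subset_iff rangeI)
  then have "surj \<rho>"
    using spanE vec.span_minimal[OF _ vec.linear_subspace_image[OF lin\<rho> vec.subspace_UNIV]] by blast
  then have "bij \<rho>"
    using vec.linear_surj_imp_inj[OF lin\<rho>] by (simp add: bij_def)
  moreover have "e i \<in> W" for i using e E(1) by (meson UNIV_I bij_betwE subset_iff)
  ultimately show ?thesis using that lin\<rho> by (simp add: \<rho>_basis)
qed

text \<open>
  The vectors fixed by the twisted semilinear action \<open>v \<mapsto> u\<^sub>\<gamma>(\<gamma> v)\<close> span: each
  average over a finite quotient of the Galois group is fixed, and by independence of characters
  the averages of the multiples \<open>a v\<close> span a space containing \<open>v\<close>.
\<close>

theorem hilbert_90:
  fixes u :: "('k::field, 'n::finite) cochain"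
  assumes u: "\<And>\<gamma>. \<gamma> \<in> abs_gal \<Longrightarrow> lin (u \<gamma>)" "\<And>\<gamma>. \<gamma> \<in> abs_gal \<Longrightarrow> bij (u \<gamma>)"
    and coc: "\<And>\<gamma> \<eta>. \<gamma> \<in> abs_gal \<Longrightarrow> \<eta> \<in> abs_gal \<Longrightarrow> u (\<gamma> \<circ> \<eta>) = u \<gamma> \<circ> gal_act \<gamma> (u \<eta>)"
    and cont: "continuous_map krull_topology (discrete_topology A) u"
  obtains \<rho> where "lin \<rho>" "bij \<rho>" "\<And>\<gamma>. \<gamma> \<in> abs_gal \<Longrightarrow> u \<gamma> \<circ> gal_act \<gamma> \<rho> = \<rho>"
proof -
  define Fix where "Fix = {v. \<forall>\<gamma>\<in>abs_gal. u \<gamma> (vmap \<gamma> v) = v}"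
  have uid: "u id = id"
  proof
    fix x
    have "u id (u id x) = u id x"
      using fun_cong[OF coc[OF abs_gal_id abs_gal_id], of x] by (simp add: gal_act_by_id)
    then show "u id x = id x"
      using u(2)[OF abs_gal_id] by (simp add: bij_is_inj inj_eq)
  qed
  obtain F where F: "finite F" "\<And>\<gamma>. \<gamma> \<in> abs_gal \<Longrightarrow> (\<And>a. a \<in> F \<Longrightarrow> \<gamma> a = a) \<Longrightarrow> u \<gamma> = id"
    by (rule continuous_krullD[OF cont]) (simp add: uid)
  \<comment> \<open>The inverse of \<gamma> composed with \<eta> fixes \<open>F\<close>, so the
    cocycle identity shows that \<open>u\<close> depends only on the restriction of \<gamma> to
    \<open>F\<close>.\<close>
  have agree: "u \<gamma> = u \<eta>" if "\<gamma> \<in> abs_gal" "\<eta> \<in> abs_gal" "\<And>a. a \<in> F \<Longrightarrow> \<gamma> a = \<eta> a" for \<gamma> \<eta>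
  proof -
    let ?\<theta> = "inv_into UNIV \<gamma> \<circ> \<eta>"
    have t: "?\<theta> \<in> abs_gal" by (intro abs_gal_comp abs_gal_inv that)
    moreover have "?\<theta> a = a" if "a \<in> F" for a
      using \<open>\<And>a. a \<in> F \<Longrightarrow> \<gamma> a = \<eta> a\<close>[OF that] abs_gal_inv_cancel(2)[OF \<open>\<gamma> \<in> abs_gal\<close>, of a] by simp
    ultimately have "u ?\<theta> = id" by (rule F(2))
    moreover have "\<gamma> \<circ> ?\<theta> = \<eta>"
      by (simp add: fun_eq_iff abs_gal_inv_cancel that)
    ultimately show ?thesis
      using coc[OF that(1) t] by (simp add: gal_act_id that)
  qed
  have "v \<in> vec.span Fix" for v
  proof -
    \<comment> \<open>Adding the coordinates of \<open>v\<close> makes both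
      \<open>u \<gamma>\<close> and \<open>vmap \<gamma> v\<close> functions of the restriction of
      \<gamma> to \<open>F'\<close>. Finite orbits leave finitely many restrictions, and
      \<open>S\<close> picks one Galois element for each.\<close>
    define F' where "F' = F \<union> range (\<lambda>i. v $ i)"
    define cls where "cls \<gamma> = restrict \<gamma> F'" for \<gamma> :: "'k alg_closure \<Rightarrow> 'k alg_closure"
    have cls_eq: "cls \<gamma> = cls \<eta> \<longleftrightarrow> (\<forall>a\<in>F'. \<gamma> a = \<eta> a)" for \<gamma> \<eta>
      unfolding cls_def restrict_def fun_eq_iff by auto
    define rep where "rep = inv_into abs_gal cls"
    define S where "S = rep ` (cls ` abs_gal)"
    have finF': "finite F'" by (simp add: F'_def F)
    have "cls ` abs_gal \<subseteq> (\<Pi>\<^sub>E a\<in>F'. {\<gamma> a | \<gamma>. \<gamma> \<in> abs_gal})"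
      unfolding cls_def by (force intro!: restrict_PiE_iff[THEN iffD2])
    moreover have "finite (\<Pi>\<^sub>E a\<in>F'. {\<gamma> a | \<gamma>. \<gamma> \<in> (abs_gal :: ('k alg_closure \<Rightarrow> 'k alg_closure) set)})"
      by (intro finite_PiE finF' finite_abs_gal_orbit)
    ultimately have "finite (cls ` abs_gal)"
      by (rule finite_subset)
    then have finS: "finite S"
      unfolding S_def by (rule finite_imageI)
    have rep: "rep (cls \<gamma>) \<in> abs_gal" "cls (rep (cls \<gamma>)) = cls \<gamma>" if "\<gamma> \<in> abs_gal" for \<gamma>
      unfolding rep_def using that by (simp_all add: inv_into_into f_inv_into_f[OF imageI])
    have S: "s \<in> abs_gal" if "s \<in> S" for s
      using that rep by (auto simp: S_def)
    have Suniq: "s = t" if "s \<in> S" "t \<in> S" "cls s = cls t" for s t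
      using that rep by (auto simp: S_def)
    have inS: "rep (cls \<gamma>) \<in> S" if "\<gamma> \<in> abs_gal" for \<gamma>
      using that by (auto simp: S_def)
    \<comment> \<open>\<open>L\<close> plays the part of the finite extension generated by
      \<open>F'\<close>: the scalars on which \<gamma> is determined by its class.\<close>
    define L where "L = {a. \<forall>\<gamma>\<in>abs_gal. \<forall>\<eta>\<in>abs_gal. cls \<gamma> = cls \<eta> \<longrightarrow> \<gamma> a = \<eta> a}"
    define g where "g a \<gamma> = \<gamma> a *s u \<gamma> (vmap \<gamma> v)" for a and \<gamma> :: "'k alg_closure \<Rightarrow> 'k alg_closure"
    have g_cls: "g a \<gamma> = g a \<eta>" if "a \<in> L" "\<gamma> \<in> abs_gal" "\<eta> \<in> abs_gal" "cls \<gamma> = cls \<eta>" for a \<gamma> \<eta>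
    proof -
      have "\<gamma> b = \<eta> b" if "b \<in> F'" for b using \<open>cls \<gamma> = cls \<eta>\<close> that by (simp add: cls_eq)
      then have "u \<gamma> = u \<eta>" "vmap \<gamma> v = vmap \<eta> v"
        using that by (auto intro!: agree simp: F'_def vec_eq_iff)
      then show ?thesis using that by (auto simp: g_def L_def)
    qed
    have g_act: "u \<gamma> (vmap \<gamma> (g a s)) = g a (\<gamma> \<circ> s)" if "\<gamma> \<in> abs_gal" "s \<in> abs_gal" for \<gamma> a s
    proof -
      interpret field_hom \<gamma> by (rule field_hom_abs_gal[OF that(1)])
      show ?thesis
        by (simp add: g_def vmap_smult lin_smult[OF u(1)] that coc gal_act_vmap flip: vmap_comp)
    qed
    \<comment> \<open>Left translation by \<gamma> permutes the classes, so it only reorders the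
      sum.\<close>
    have avg: "(\<Sum>s\<in>S. g a s) \<in> Fix" if a: "a \<in> L" for a
      unfolding Fix_def
    proof (intro CollectI ballI)
      fix \<gamma> :: "'k alg_closure \<Rightarrow> 'k alg_closure" assume \<gamma>: "\<gamma> \<in> abs_gal"
      interpret field_hom \<gamma> by (rule field_hom_abs_gal[OF \<gamma>])
      let ?h = "\<lambda>s. rep (cls (\<gamma> \<circ> s))"
      have hS: "?h ` S \<subseteq> S"
        using inS S abs_gal_comp[OF \<gamma>] by blast
      have "inj_on ?h S"
      proof (rule inj_onI)
        fix s t assume st: "s \<in> S" "t \<in> S" "?h s = ?h t"
        then have "cls (\<gamma> \<circ> s) = cls (\<gamma> \<circ> t)"
          by (metis rep(2) S abs_gal_comp[OF \<gamma>])
        then have "cls s = cls t"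
          using abs_galD(1)[OF \<gamma>] by (simp add: cls_eq bij_is_inj inj_eq)
        then show "s = t" using Suniq st by blast
      qed
      then have bij: "bij_betw ?h S S"
        using hS finS endo_inj_surj[of S ?h] by (auto simp: bij_betw_def)
      have "u \<gamma> (vmap \<gamma> (\<Sum>s\<in>S. g a s)) = (\<Sum>s\<in>S. g a (\<gamma> \<circ> s))"
        by (simp add: vmap_sum lin_sum[OF u(1)[OF \<gamma>]] g_act \<gamma> S)
      also have "\<dots> = (\<Sum>s\<in>S. g a (?h s))"
        by (rule sum.cong[OF refl], rule g_cls[OF a]) (simp_all add: rep abs_gal_comp \<gamma> S)
      also have "\<dots> = (\<Sum>s\<in>S. g a s)"
        by (rule sum.reindex_bij_betw[OF bij])
      finally show "u \<gamma> (vmap \<gamma> (\<Sum>s\<in>S. g a s)) = (\<Sum>s\<in>S. g a s)" .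
    qed
    have L1: "1 \<in> L"
      by (simp add: L_def field_hom.hom_one[OF field_hom_abs_gal])
    have L2: "a * b \<in> L" if "a \<in> L" "b \<in> L" for a b
      using that unfolding L_def by (simp add: abs_galD(3)) metis
    have L3: "F' \<subseteq> L"
      by (auto simp: L_def cls_eq)
    \<comment> \<open>The representative of the class of \<open>id\<close> fixes \<open>F\<close>
      and the coordinates of \<open>v\<close>, so its coefficient vector in the averages is
      \<open>v\<close> itself.\<close>
    define s0 where "s0 = rep (cls (id :: 'k alg_closure \<Rightarrow> _))"
    have s0: "s0 \<in> S" "s0 \<in> abs_gal" "cls s0 = cls id"
      using rep inS abs_gal_id by (auto simp: s0_def)
    have "u s0 (vmap s0 v) \<in> vec.span Fix"
    proof (rule dedekind_independence[OF finS, of "vec.span Fix" L "\<lambda>s. u s (vmap s v)"])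
      show "s 1 = 1" "s (a * b) = s a * s b" if "s \<in> S" for s a b
        using field_hom_abs_gal[OF S[OF that]] by (simp_all add: field_hom_def)
      show "\<exists>b\<in>L. s b \<noteq> t b" if "s \<in> S" "t \<in> S" "s \<noteq> t" for s t
        using Suniq[OF that(1,2)] that(3) L3 by (auto simp: cls_eq)
      show "(\<Sum>s\<in>S. s a *s u s (vmap s v)) \<in> vec.span Fix" if "a \<in> L" for a
        using avg[OF that] by (simp add: g_def vec.span_base)
    qed (use s0 L1 L2 in auto)
    also have "u s0 (vmap s0 v) = v"
    proof -
      have e: "s0 b = b" if "b \<in> F'" for b using s0(3) that by (simp add: cls_eq)
      then have "u s0 = id" using F(2)[OF s0(2)] by (simp add: F'_def)
      moreover have "vmap s0 v = v" using e by (simp add: vec_eq_iff F'_def)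
      ultimately show ?thesis by simp
    qed
    finally show ?thesis .
  qed
  then have span: "vec.span Fix = UNIV" by auto
  obtain \<rho> :: "('k, 'n) geom_map" where lin\<rho>: "lin \<rho>" and "bij \<rho>" and \<rho>_basis: "\<And>i. \<rho> (basis_vec i) \<in> Fix"
    by (rule spanning_basis[OF span]) blast
  have "u \<gamma> \<circ> gal_act \<gamma> \<rho> = \<rho>" if g: "\<gamma> \<in> abs_gal" for \<gamma>
  proof (rule lin_eqI)
    interpret field_hom \<gamma> by (rule field_hom_abs_gal[OF g])
    show "lin (u \<gamma> \<circ> gal_act \<gamma> \<rho>)" "lin \<rho>"
      using lin\<rho> by (auto intro: lin_o u g lin_gal_act)
    fix i
    have "gal_act \<gamma> \<rho> (basis_vec i) = vmap \<gamma> (\<rho> (basis_vec i))"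
      by (metis gal_act_vmap g vmap_basis)
    then show "(u \<gamma> \<circ> gal_act \<gamma> \<rho>) (basis_vec i) = \<rho> (basis_vec i)"
      using g \<rho>_basis[of i] by (simp add: Fix_def)
  qed
  then show ?thesis using that lin\<rho> \<open>bij \<rho>\<close> by blast
qed

section \<open>Forms and twisted cocycles\<close>

text \<open>A class of \<open>R\<close> is sent to everything related by \<open>T\<close> to one of
  its members. Totality on both sides and the equivalence \<open>iff\<close> make this a bijection
  without choosing a partner for each element.\<close>

lemma quotient_eqpoll:
  assumes R: "equiv S R" and Q: "Q \<subseteq> Z \<times> Z"
    and ex: "\<And>s. s \<in> S \<Longrightarrow> \<exists>u\<in>Z. T s u" "\<And>u. u \<in> Z \<Longrightarrow> \<exists>s\<in>S. T s u"
    and iff: "\<And>s t u v. s \<in> S \<Longrightarrow> t \<in> S \<Longrightarrow> u \<in> Z \<Longrightarrow> v \<in> Z \<Longrightarrow> T s u \<Longrightarrow> T t v \<Longrightarrow>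
      (s, t) \<in> R \<longleftrightarrow> (u, v) \<in> Q"
  shows "S // R \<approx> Z // Q"
proof -
  define h where "h c = {u \<in> Z. \<exists>s\<in>c. T s u}" for c
  have RS: "s \<in> S \<and> t \<in> S" if "(s, t) \<in> R" for s t
    using equiv_type[OF R] that by blast
  have refl: "(s, s) \<in> R" if "s \<in> S" for s
    unfolding equiv_class_eq_iff[OF R] by (simp add: that)
  have h: "h (R `` {s}) = Q `` {u}" if "s \<in> S" "u \<in> Z" "T s u" for s u
  proof (intro equalityI subsetI)
    fix v assume "v \<in> h (R `` {s})"
    then obtain t where t: "(s, t) \<in> R" "T t v" "v \<in> Z" by (auto simp: h_def)
    then show "v \<in> Q `` {u}" using iff[of s t u v] that RS[OF t(1)] by blast
  next
    fix v assume "v \<in> Q `` {u}"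
    then have v: "v \<in> Z" "(u, v) \<in> Q" using Q by auto
    then obtain t where "t \<in> S" "T t v" using ex(2) by blast
    then show "v \<in> h (R `` {s})" using iff[of s t u v] that v unfolding h_def by blast
  qed
  have "inj_on h (S // R)"
  proof (rule inj_onI)
    fix c d assume "c \<in> S // R" "d \<in> S // R" and eq: "h c = h d"
    then obtain s t where st: "s \<in> S" "c = R `` {s}" "t \<in> S" "d = R `` {t}"
      by (auto elim!: quotientE)
    obtain u where u: "u \<in> Z" "T s u" using ex(1) st by blast
    then have "u \<in> h d"
      using refl[OF st(1)] st unfolding eq[symmetric] by (auto simp: h_def)
    then obtain t' where "(t, t') \<in> R" "T t' u" using st by (auto simp: h_def)
    moreover from this have "(s, t') \<in> R"
      using iff[of s s u u] iff[of s t' u u] refl st u RS by blast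
    ultimately have "(s, t) \<in> R" using R by (meson equivE symE transE)
    then show "c = d" using st R by (simp add: equiv_class_eq_iff)
  qed
  moreover have "h ` (S // R) = Z // Q"
  proof (intro equalityI subsetI)
    fix y assume "y \<in> h ` (S // R)"
    then obtain s where s: "s \<in> S" "y = h (R `` {s})" by (auto elim!: quotientE)
    moreover obtain u where "u \<in> Z" "T s u" using ex(1) s by blast
    ultimately show "y \<in> Z // Q" using h by (simp add: quotientI)
  next
    fix y assume "y \<in> Z // Q"
    then obtain u where "u \<in> Z" "y = Q `` {u}" by (auto elim!: quotientE)
    moreover from this obtain s where "s \<in> S" "T s u" using ex(2) by blast
    ultimately show "y \<in> h ` (S // R)" using h by (metis imageI quotientI)
  qed
  ultimately show ?thesis
    unfolding eqpoll_def bij_betw_def by blast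
qed

lemma equiv_iso_rel: "equiv S (iso_rel S)"
proof (rule equivI)
  show "iso_rel S \<subseteq> S \<times> S" by (auto simp: iso_rel_def)
  show "refl_on S (iso_rel S)"
    using lie_bialgebra_iso_id by (auto simp: iso_rel_def refl_on_def)
  show "sym (iso_rel S)"
    using lie_bialgebra_iso_inv by (auto simp: iso_rel_def sym_def) blast
  show "trans (iso_rel S)"
    using lie_bialgebra_iso_comp by (auto simp: iso_rel_def trans_def) blast
qed

lemma lin_extends_unique: "lin_extends to_ac \<phi> \<phi>' \<Longrightarrow> \<phi>' = ext_lin to_ac \<phi>"
  using field_hom.lin_extends_ext_lin[OF field_hom_to_ac]
  by (intro field_hom.lin_eq_vmapI[OF field_hom_to_ac]) (auto simp: lin_extends_def)

lemma bilin_extends_unique: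
  assumes "bilin_extends to_ac \<beta> \<beta>'"
  shows "\<beta>' = ext_bilin to_ac \<beta>"
proof (intro ext)
  fix x y
  note e = field_hom.bilin_extends_ext_bilin[OF field_hom_to_ac bilin_extendsD(1)[OF assms]]
  show "\<beta>' x y = ext_bilin to_ac \<beta> x y"
    by (rule field_hom.bilin_eq_vmapI[OF field_hom_to_ac bilin_extendsD(2)[OF assms] bilin_extendsD(2)[OF e]])
      (simp add: bilin_extendsD(3)[OF assms] bilin_extendsD(3)[OF e])
qed

text \<open>A map defined over K has basis values fixed by \<gamma>, so it is its own extension
  along \<gamma>.\<close>

lemma lin_extends_galois:
  fixes \<phi>' :: "'k::field alg_closure ^ 'm \<Rightarrow> 'k alg_closure ^ 'n"
  assumes "\<gamma> \<in> abs_gal" "lin_extends to_ac \<phi> \<phi>'"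
  shows "lin_extends \<gamma> \<phi>' \<phi>'"
proof -
  interpret g: field_hom \<gamma> by (rule field_hom_abs_gal[OF assms(1)])
  note l = lin_extendsD(2)[OF assms(2)]
  have B: "vmap \<gamma> (\<phi>' (basis_vec i)) = \<phi>' (basis_vec i)" for i
    using lin_extendsD(3)[OF assms(2), of "basis_vec i"]
    by (simp add: field_hom.vmap_basis[OF field_hom_to_ac] vmap_to_ac_fixed[OF assms(1)])
  have "\<phi>' (vmap \<gamma> x) = vmap \<gamma> (\<phi>' x)" for x
  proof -
    have "vmap \<gamma> (\<phi>' x) = (\<Sum>i\<in>UNIV. \<gamma> (x $ i) *s \<phi>' (basis_vec i))"
      by (subst lin_expand[OF l]) (simp add: g.vmap_sum g.vmap_smult B)
    also have "\<dots> = \<phi>' (vmap \<gamma> x)"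
      by (subst (2) lin_expand[OF l]) simp
    finally show ?thesis ..
  qed
  then show ?thesis using l by (simp add: lin_extends_def)
qed

lemma bilin_extends_galois:
  fixes \<beta>' :: "'k::field alg_closure ^ 'm \<Rightarrow> 'k alg_closure ^ 'p \<Rightarrow> 'k alg_closure ^ 'n"
  assumes "\<gamma> \<in> abs_gal" "bilin_extends to_ac \<beta> \<beta>'"
  shows "bilin_extends \<gamma> \<beta>' \<beta>'"
proof -
  interpret g: field_hom \<gamma> by (rule field_hom_abs_gal[OF assms(1)])
  note b = bilin_extendsD(2)[OF assms(2)]
  have B: "vmap \<gamma> (\<beta>' (basis_vec i) (basis_vec j)) = \<beta>' (basis_vec i) (basis_vec j)" for i j
    using bilin_extendsD(3)[OF assms(2), of "basis_vec i" "basis_vec j"]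
    by (simp add: field_hom.vmap_basis[OF field_hom_to_ac] vmap_to_ac_fixed[OF assms(1)])
  have E1: "\<beta>' z w = (\<Sum>j\<in>UNIV. w $ j *s \<beta>' z (basis_vec j))"
    and E2: "\<beta>' z w = (\<Sum>i\<in>UNIV. z $ i *s \<beta>' (basis_vec i) w)" for z w
    using lin_expand[OF bilin_lin(1)[OF b]] lin_expand[OF bilin_lin(2)[OF b]] by blast+
  have "\<beta>' (vmap \<gamma> x) (vmap \<gamma> y) = vmap \<gamma> (\<beta>' x y)" for x y
  proof -
    have "vmap \<gamma> (\<beta>' x y) = (\<Sum>i\<in>UNIV. \<Sum>j\<in>UNIV. \<gamma> (x $ i) *s (\<gamma> (y $ j) *s \<beta>' (basis_vec i) (basis_vec j)))"
      by (subst lin_expand[OF bilin_lin(2)[OF b]], subst lin_expand[OF bilin_lin(1)[OF b]])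
        (simp add: g.vmap_sum g.vmap_smult B vec.scale_sum_right del: vec.scale_scale vector_smult_assoc)
    also have "\<dots> = (\<Sum>i\<in>UNIV. \<gamma> (x $ i) *s \<beta>' (basis_vec i) (vmap \<gamma> y))"
      by (simp only: E1[of _ "vmap \<gamma> y"] vec.scale_sum_right vmap_nth)
    also have "\<dots> = \<beta>' (vmap \<gamma> x) (vmap \<gamma> y)"
      by (simp only: E2[of "vmap \<gamma> x"] vmap_nth)
    finally show ?thesis ..
  qed
  then show ?thesis using b by (simp add: bilin_extends_def)
qed

text \<open>The cocycle set for an arbitrary scalar; it turns into ordinary cocycles, twisted
  cocycles or the empty set according to \<alpha>. The factor \<open>\<gamma> \<alpha>\<close> on
  the source appears because \<gamma> also acts on the scalar of the model.\<close>

definition twisted_automorphisms ::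
    "('k::field, 'n::finite) bracket \<Rightarrow> ('k, 'n) cobracket \<Rightarrow> 'k alg_closure \<Rightarrow> ('k, 'n) cochain set" where
  "twisted_automorphisms br \<delta> \<alpha> = {u \<in> gal_cocycles (aut_lie br). \<forall>\<gamma>\<in>abs_gal.
     lie_bialgebra_iso (ext_bilin to_ac br) (\<lambda>x. \<gamma> \<alpha> *s ext_lin to_ac \<delta> x)
       (ext_bilin to_ac br) (\<lambda>x. \<alpha> *s ext_lin to_ac \<delta> x) (u \<gamma>)}"

section \<open>Correspondence between forms and cocycles\<close>

context
  fixes br :: "('k::field_char_0, 'n::finite) bracket" and \<delta> :: "('k, 'n) cobracket" and \<alpha> :: "'k alg_closure"
  assumes lbr: "lie_bialgebra br \<delta>" and \<alpha>: "\<alpha> \<noteq> 0"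
begin

abbreviation (input) "br_ac \<equiv> ext_bilin to_ac br"
abbreviation (input) "cobr_ac c \<equiv> (\<lambda>x. c *s ext_lin to_ac \<delta> x)"

text \<open>The second condition makes \<open>u \<gamma>\<close> the composite of \<phi> with the
  inverse of its conjugate, with the inverse cleared. The isomorphism stays an argument because it
  is not unique.\<close>

definition is_descent :: "('k, 'n) bracket \<times> ('k, 'n) cobracket \<Rightarrow> ('k, 'n) geom_map \<Rightarrow> ('k, 'n) cochain \<Rightarrow> bool" where
  "is_descent s \<phi> u \<longleftrightarrow> lie_bialgebra_iso (ext_bilin to_ac (fst s)) (ext_lin to_ac (snd s)) br_ac (cobr_ac \<alpha>) \<phi> \<and>
     (\<forall>\<gamma>\<in>abs_gal. u \<gamma> \<circ> gal_act \<gamma> \<phi> = \<phi>)"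

lemma br_ac_extends: "bilin_extends to_ac br br_ac"
  using lbr by (intro field_hom.bilin_extends_ext_bilin[OF field_hom_to_ac] lie_algebra_bilin)
    (simp add: lie_bialgebra_def)

lemma \<delta>_extends: "lin_extends to_ac \<delta> (ext_lin to_ac \<delta>)"
  using lbr by (intro field_hom.lin_extends_ext_lin[OF field_hom_to_ac]) (simp add: lie_bialgebra_def)

lemma cobr_ac_extends:
  assumes "\<gamma> \<in> abs_gal"
  shows "lin_extends \<gamma> (cobr_ac c) (cobr_ac (\<gamma> c))"
  by (rule field_hom.lin_extends_scale[OF field_hom_abs_gal[OF assms] lin_extends_galois[OF assms \<delta>_extends]])

lemma ext_extends:
  assumes "lie_bialgebra br' \<delta>'"
  shows "bilin_extends to_ac br' (ext_bilin to_ac br')" "lin_extends to_ac \<delta>' (ext_lin to_ac \<delta>')"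
  using assms by (auto intro!: field_hom.bilin_extends_ext_bilin[OF field_hom_to_ac] lie_algebra_bilin
    field_hom.lin_extends_ext_lin[OF field_hom_to_ac] simp: lie_bialgebra_def)

lemma descent_exists:
  assumes s: "s \<in> bialgebra_forms br_ac (cobr_ac \<alpha>)"
  shows "\<exists>u\<in>twisted_automorphisms br \<delta> \<alpha>. \<exists>\<phi>. is_descent s \<phi> u"
proof -
  obtain br' \<delta>' where s_eq: "s = (br', \<delta>')" by (cases s)
  have lb': "lie_bialgebra br' \<delta>'" using s by (simp add: s_eq bialgebra_forms_def)
  obtain \<phi> where \<phi>: "lie_bialgebra_iso (ext_bilin to_ac br') (ext_lin to_ac \<delta>') br_ac (cobr_ac \<alpha>) \<phi>"
    using s by (auto simp: s_eq bialgebra_forms_def)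
  have lin: "lin \<phi>" and bij: "bij \<phi>" using \<phi> by (auto simp: lie_bialgebra_iso_def lie_iso_def)
  define \<psi> where "\<psi> = inv_into UNIV \<phi>"
  have lin\<psi>: "lin \<psi>" unfolding \<psi>_def by (rule lin_inv[OF lin bij])
  have c: "\<psi> \<circ> \<phi> = id" using bij by (simp add: \<psi>_def bij_is_inj)
  define u where "u = restrict (\<lambda>\<gamma>. \<phi> \<circ> gal_act \<gamma> \<psi>) abs_gal"
  \<comment> \<open>Conjugating \<phi> by \<gamma> fixes the source, which is defined over K, and
    changes the scalar of the target to \<open>\<gamma> \<alpha>\<close>.\<close>
  have tw: "lie_bialgebra_iso br_ac (cobr_ac (\<gamma> \<alpha>)) br_ac (cobr_ac \<alpha>) (u \<gamma>)" if g: "\<gamma> \<in> abs_gal" for \<gamma>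
  proof -
    have "lie_bialgebra_iso (ext_bilin to_ac br') (ext_lin to_ac \<delta>') br_ac (cobr_ac (\<gamma> \<alpha>)) (gal_act \<gamma> \<phi>)"
      using lie_bialgebra_iso_extends_iff[OF field_hom_abs_gal[OF g] bilin_extends_galois[OF g ext_extends(1)[OF lb']]
          bilin_extends_galois[OF g br_ac_extends] lin_extends_gal_act[OF g lin]
          lin_extends_galois[OF g ext_extends(2)[OF lb']] cobr_ac_extends[OF g]] \<phi> by blast
    from lie_bialgebra_iso_comp[OF lie_bialgebra_iso_inv[OF this] \<phi>] show ?thesis
      by (simp add: u_def g \<psi>_def bij_gal_act[OF g bij])
  qed
  have "u (\<gamma> \<circ> \<eta>) = u \<gamma> \<circ> gal_act \<gamma> (u \<eta>)" if g: "\<gamma> \<in> abs_gal" "\<eta> \<in> abs_gal" for \<gamma> \<eta>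
  proof -
    have "u \<gamma> \<circ> gal_act \<gamma> (u \<eta>) = \<phi> \<circ> (gal_act \<gamma> \<psi> \<circ> gal_act \<gamma> \<phi>) \<circ> gal_act \<gamma> (gal_act \<eta> \<psi>)"
      using g by (simp add: u_def gal_act_comp comp_assoc)
    also have "gal_act \<gamma> \<psi> \<circ> gal_act \<gamma> \<phi> = id"
      using g c by (simp add: gal_act_id flip: gal_act_comp)
    finally have "u \<gamma> \<circ> gal_act \<gamma> (u \<eta>) = \<phi> \<circ> gal_act \<gamma> (gal_act \<eta> \<psi>)"
      by (simp only: comp_id)
    moreover have "u (\<gamma> \<circ> \<eta>) = \<phi> \<circ> gal_act \<gamma> (gal_act \<eta> \<psi>)"
      using g by (simp add: u_def abs_gal_comp gal_act_gal_act)
    ultimately show ?thesis by (rule trans[OF _ sym, rotated])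
  qed
  moreover have aut: "u \<gamma> \<in> aut_lie br" if "\<gamma> \<in> abs_gal" for \<gamma>
    using tw[OF that] by (simp add: aut_lie_def lie_bialgebra_iso_def)
  moreover have "continuous_map krull_topology (discrete_topology (aut_lie br)) u"
  proof (rule continuous_krullI)
    \<comment> \<open>Only the action of \<gamma> on the coordinates of \<psi> at basis vectors
      enters \<open>gal_act \<gamma> \<psi>\<close>.\<close>
    show "finite (\<Union>i. range (\<lambda>j. \<psi> (basis_vec i) $ j))" by auto
    fix \<gamma> \<eta> :: "'k alg_closure \<Rightarrow> 'k alg_closure"
    assume g: "\<gamma> \<in> abs_gal" "\<eta> \<in> abs_gal"
      and eq: "\<And>a. a \<in> (\<Union>i. range (\<lambda>j. \<psi> (basis_vec i) $ j)) \<Longrightarrow> \<gamma> a = \<eta> a"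
    have "gal_act \<gamma> \<psi> = gal_act \<eta> \<psi>"
    proof (rule lin_eqI)
      fix i
      have "vmap \<gamma> (\<psi> (basis_vec i)) = vmap \<eta> (\<psi> (basis_vec i))"
        using eq by (auto simp: vec_eq_iff)
      then show "gal_act \<gamma> \<psi> (basis_vec i) = gal_act \<eta> \<psi> (basis_vec i)"
        using g by (metis field_hom.vmap_basis field_hom_abs_gal gal_act_vmap)
    qed (use g lin\<psi> lin_gal_act in auto)
    then show "u \<gamma> = u \<eta>" using g by (simp add: u_def)
  qed (rule aut)
  ultimately have "u \<in> twisted_automorphisms br \<delta> \<alpha>"
    using tw by (auto simp: twisted_automorphisms_def gal_cocycles_def u_def)
  moreover have "is_descent s \<phi> u"
    using \<phi> c by (simp add: is_descent_def s_eq u_def comp_assoc gal_act_id flip: gal_act_comp)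
  ultimately show ?thesis by blast
qed

lemma form_exists:
  assumes u: "u \<in> twisted_automorphisms br \<delta> \<alpha>"
  shows "\<exists>s\<in>bialgebra_forms br_ac (cobr_ac \<alpha>). \<exists>\<phi>. is_descent s \<phi> u"
proof -
  have iso: "lie_bialgebra_iso br_ac (cobr_ac (\<gamma> \<alpha>)) br_ac (cobr_ac \<alpha>) (u \<gamma>)" if "\<gamma> \<in> abs_gal" for \<gamma>
    using u that by (auto simp: twisted_automorphisms_def)
  then have lin: "lin (u \<gamma>)" and bij: "bij (u \<gamma>)" and hom: "u \<gamma> (br_ac x y) = br_ac (u \<gamma> x) (u \<gamma> y)"
    and cohom: "tensor_map (u \<gamma>) (u \<gamma>) (cobr_ac (\<gamma> \<alpha>) x) = cobr_ac \<alpha> (u \<gamma> x)" if "\<gamma> \<in> abs_gal" for \<gamma> x y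
    using that by (auto simp: lie_bialgebra_iso_def lie_iso_def)
  have coc: "u (\<gamma> \<circ> \<eta>) = u \<gamma> \<circ> gal_act \<gamma> (u \<eta>)" if "\<gamma> \<in> abs_gal" "\<eta> \<in> abs_gal" for \<gamma> \<eta>
    using u that by (auto simp: twisted_automorphisms_def gal_cocycles_def)
  have cont: "continuous_map krull_topology (discrete_topology (aut_lie br)) u"
    using u by (auto simp: twisted_automorphisms_def gal_cocycles_def)
  obtain \<rho> where \<rho>: "lin \<rho>" "bij \<rho>" "\<And>\<gamma>. \<gamma> \<in> abs_gal \<Longrightarrow> u \<gamma> \<circ> gal_act \<gamma> \<rho> = \<rho>"
    by (rule hilbert_90[OF lin bij coc cont]) auto
  define \<psi> where "\<psi> = inv_into UNIV \<rho>"
  have lin\<psi>: "lin \<psi>" unfolding \<psi>_def by (rule lin_inv[OF \<rho>(1,2)])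
  have i: "\<psi> (\<rho> x) = x" "\<rho> (\<psi> x) = x" for x
    using \<rho>(2) by (auto simp: \<psi>_def bij_is_inj bij_is_surj surj_f_inv_f)
  have act: "\<rho> (vmap \<gamma> x) = u \<gamma> (vmap \<gamma> (\<rho> x))" if "\<gamma> \<in> abs_gal" for \<gamma> x
    using fun_cong[OF \<rho>(3)[OF that], of "vmap \<gamma> x"] by (simp add: gal_act_vmap that)
  have act\<psi>: "\<psi> (u \<gamma> (vmap \<gamma> z)) = vmap \<gamma> (\<psi> z)" if "\<gamma> \<in> abs_gal" for \<gamma> z
    by (metis act[OF that] i)
  \<comment> \<open>The model pulled back along \<rho>. The result commutes with the Galois action
    because \<rho> absorbs the cocycle.\<close>
  define b' where "b' x y = \<psi> (br_ac (\<rho> x) (\<rho> y))" for x y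
  define d' where "d' x = tensor_map \<psi> \<psi> (cobr_ac \<alpha> (\<rho> x))" for x
  note bl = bilin_extendsD(2)[OF br_ac_extends]
  have "bilin b'"
    unfolding b'_def
    by (intro bilinI lin_comp[OF lin\<psi>] lin_comp[OF bilin_lin(1)[OF bl] \<rho>(1)] lin_comp[OF bilin_lin(2)[OF bl] \<rho>(1)])
  moreover have "b' (vmap \<gamma> x) (vmap \<gamma> y) = vmap \<gamma> (b' x y)" if g: "\<gamma> \<in> abs_gal" for \<gamma> x y
  proof -
    have "b' (vmap \<gamma> x) (vmap \<gamma> y) = \<psi> (u \<gamma> (br_ac (vmap \<gamma> (\<rho> x)) (vmap \<gamma> (\<rho> y))))"
      by (simp add: b'_def act g hom)
    also have "br_ac (vmap \<gamma> (\<rho> x)) (vmap \<gamma> (\<rho> y)) = vmap \<gamma> (br_ac (\<rho> x) (\<rho> y))"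
      by (rule bilin_extendsD(3)[OF bilin_extends_galois[OF g br_ac_extends]])
    finally show ?thesis by (simp add: act\<psi> g b'_def)
  qed
  ultimately obtain br' where br': "bilin_extends to_ac br' b'"
    by (rule descend_bilin)
  have "lin d'"
    unfolding d'_def
    by (intro lin_comp[OF lin_tensor_map] lin_comp[OF lin_scale[OF lin_extendsD(2)[OF \<delta>_extends]] \<rho>(1)])
  \<comment> \<open>Under \<gamma> the scalar \<alpha> becomes \<open>\<gamma> \<alpha>\<close>; the
    cobracket condition on \<open>u \<gamma>\<close> compensates exactly this.\<close>
  moreover have "d' (vmap \<gamma> x) = vmap \<gamma> (d' x)" if g: "\<gamma> \<in> abs_gal" for \<gamma> x
  proof -
    have e: "lin_extends \<gamma> \<psi> (\<psi> \<circ> u \<gamma>)"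
      using lin\<psi> lin[OF g] act\<psi>[OF g] by (simp add: lin_extends_def lin_o)
    have "d' (vmap \<gamma> x) = tensor_map \<psi> \<psi> (tensor_map (u \<gamma>) (u \<gamma>) (cobr_ac (\<gamma> \<alpha>) (vmap \<gamma> (\<rho> x))))"
      using cohom[OF g, of "vmap \<gamma> (\<rho> x)"] by (simp add: d'_def act g)
    also have "\<dots> = tensor_map (\<psi> \<circ> u \<gamma>) (\<psi> \<circ> u \<gamma>) (vmap \<gamma> (cobr_ac \<alpha> (\<rho> x)))"
      using lin_extendsD(3)[OF cobr_ac_extends[OF g], of \<alpha> "\<rho> x"]
      by (simp add: tensor_map_comp lin\<psi> lin g)
    also have "\<dots> = vmap \<gamma> (tensor_map \<psi> \<psi> (cobr_ac \<alpha> (\<rho> x)))"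
      by (rule lin_extendsD(3)[OF field_hom.lin_extends_tensor_map[OF field_hom_abs_gal[OF g] e e]])
    finally show ?thesis by (simp add: d'_def)
  qed
  ultimately obtain \<delta>' where \<delta>': "lin_extends to_ac \<delta>' d'"
    by (rule descend_lin)
  have iso\<psi>: "lie_bialgebra_iso br_ac (cobr_ac \<alpha>) b' d' \<psi>"
    using lin\<psi> \<rho>(2) bij_imp_bij_inv[of \<rho>]
    by (simp add: lie_bialgebra_iso_def lie_iso_def b'_def d'_def i \<psi>_def[symmetric])
  have inv\<psi>: "inv_into UNIV \<psi> = \<rho>"
    unfolding \<psi>_def by (rule inv_inv_eq[OF \<rho>(2)])
  have "lie_bialgebra br_ac (cobr_ac \<alpha>)"
    using lie_bialgebra_extends_iff[OF field_hom_to_ac br_ac_extends \<delta>_extends] lbr lie_bialgebra_scale by blast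
  then have "lie_bialgebra b' d'"
    using iso\<psi> by (rule lie_bialgebra_transport)
  then have "lie_bialgebra br' \<delta>'"
    using lie_bialgebra_extends_iff[OF field_hom_to_ac br' \<delta>'] by blast
  moreover have iso\<rho>: "lie_bialgebra_iso (ext_bilin to_ac br') (ext_lin to_ac \<delta>') br_ac (cobr_ac \<alpha>) \<rho>"
    using lie_bialgebra_iso_inv[OF iso\<psi>]
    unfolding inv\<psi> lin_extends_unique[OF \<delta>', symmetric] bilin_extends_unique[OF br', symmetric] .
  ultimately have "(br', \<delta>') \<in> bialgebra_forms br_ac (cobr_ac \<alpha>)"
    by (auto simp: bialgebra_forms_def)
  moreover have "is_descent (br', \<delta>') \<rho> u"
    unfolding is_descent_def fst_conv snd_conv using iso\<rho> \<rho>(3) by blast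
  ultimately show ?thesis by blast
qed

lemma descent_iff:
  assumes s: "s \<in> bialgebra_forms br_ac (cobr_ac \<alpha>)" "t \<in> bialgebra_forms br_ac (cobr_ac \<alpha>)"
    and u: "u \<in> twisted_automorphisms br \<delta> \<alpha>" "v \<in> twisted_automorphisms br \<delta> \<alpha>"
    and "is_descent s \<phi> u" "is_descent t \<psi> v"
  shows "(s, t) \<in> iso_rel (bialgebra_forms br_ac (cobr_ac \<alpha>)) \<longleftrightarrow>
    (u, v) \<in> cohomologous (aut_bialgebra br \<delta>) (twisted_automorphisms br \<delta> \<alpha>)"
proof -
  obtain b1 \<delta>1 b2 \<delta>2 where st: "s = (b1, \<delta>1)" "t = (b2, \<delta>2)" by (cases s, cases t)
  let ?b1 = "ext_bilin to_ac b1" and ?d1 = "ext_lin to_ac \<delta>1"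
  let ?b2 = "ext_bilin to_ac b2" and ?d2 = "ext_lin to_ac \<delta>2"
  have \<phi>: "lie_bialgebra_iso ?b1 ?d1 br_ac (cobr_ac \<alpha>) \<phi>" and \<psi>: "lie_bialgebra_iso ?b2 ?d2 br_ac (cobr_ac \<alpha>) \<psi>"
    using assms(5,6) by (auto simp: is_descent_def st)
  have ug: "u \<gamma> (gal_act \<gamma> \<phi> x) = \<phi> x" and vg: "v \<gamma> (gal_act \<gamma> \<psi> x) = \<psi> x"
    if "\<gamma> \<in> abs_gal" for \<gamma> x
    using assms(5,6) that unfolding is_descent_def comp_def by metis+
  have lb: "lie_bialgebra b1 \<delta>1" "lie_bialgebra b2 \<delta>2"
    using s by (auto simp: st bialgebra_forms_def)
  have bij: "bij \<theta>" if "lie_bialgebra_iso b1 \<delta>1 b2 \<delta>2 \<theta>"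
    for b1 \<delta>1 b2 \<delta>2 and \<theta> :: "('k, 'n) geom_map"
    using that by (simp add: lie_bialgebra_iso_def lie_iso_def)
  \<comment> \<open>A nonzero scalar on the cobracket does not change the automorphisms, so cocycles
    are compared through automorphisms of the unscaled structure.\<close>
  have A: "aut_bialgebra br \<delta> = {\<rho>. lie_bialgebra_iso br_ac (cobr_ac \<alpha>) br_ac (cobr_ac \<alpha>) \<rho>}"
    by (simp add: aut_bialgebra_def lie_bialgebra_iso_scale_iff[OF \<alpha>])
  have extends: "lie_bialgebra_iso ?b1 ?d1 ?b2 ?d2 \<Theta> \<longleftrightarrow> lie_bialgebra_iso b1 \<delta>1 b2 \<delta>2 \<theta>"
    if "lin_extends to_ac \<theta> \<Theta>" for \<theta> \<Theta>
    by (rule lie_bialgebra_iso_extends_iff[OF field_hom_to_ac ext_extends(1)[OF lb(1)] ext_extends(1)[OF lb(2)]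
        that ext_extends(2)[OF lb(1)] ext_extends(2)[OF lb(2)]])
  have gal_act_o: "gal_act \<gamma> \<theta> (gal_act \<gamma> \<theta>' x) = gal_act \<gamma> (\<theta> \<circ> \<theta>') x"
    if "\<gamma> \<in> abs_gal" for \<gamma> x and \<theta> \<theta>' :: "('k, 'n) geom_map"
    by (simp add: gal_act_comp[OF that])
  show ?thesis
  proof
    assume "(s, t) \<in> iso_rel (bialgebra_forms br_ac (cobr_ac \<alpha>))"
    then obtain \<theta> where \<theta>: "lie_bialgebra_iso b1 \<delta>1 b2 \<delta>2 \<theta>" by (auto simp: iso_rel_def st)
    define \<Theta> where "\<Theta> = ext_lin to_ac \<theta>"
    have e: "lin_extends to_ac \<theta> \<Theta>"
      unfolding \<Theta>_def using \<theta>
      by (intro field_hom.lin_extends_ext_lin[OF field_hom_to_ac]) (simp add: lie_bialgebra_iso_def lie_iso_def)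
    \<comment> \<open>With \<omega> in place of \<psi> there are two isomorphisms from the same form
      to the model; they differ by an automorphism \<rho>. Conjugation by \<gamma> does not see
      \<Theta>, which is defined over K.\<close>
    define \<omega> where "\<omega> = \<psi> \<circ> \<Theta>"
    have \<omega>: "lie_bialgebra_iso ?b1 ?d1 br_ac (cobr_ac \<alpha>) \<omega>"
      unfolding \<omega>_def using extends[OF e] \<theta> by (intro lie_bialgebra_iso_comp[OF _ \<psi>]) blast
    define \<rho> where "\<rho> = \<phi> \<circ> inv_into UNIV \<omega>"
    have \<rho>: "lie_bialgebra_iso br_ac (cobr_ac \<alpha>) br_ac (cobr_ac \<alpha>) \<rho>"
      unfolding \<rho>_def by (rule lie_bialgebra_iso_comp[OF lie_bialgebra_iso_inv[OF \<omega>] \<phi>])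
    have \<rho>\<omega>: "\<rho> \<circ> \<omega> = \<phi>"
      using bij[OF \<omega>] by (simp add: \<rho>_def comp_assoc bij_is_inj)
    have "v \<gamma> = inv_into UNIV \<rho> \<circ> u \<gamma> \<circ> gal_act \<gamma> \<rho>" if g: "\<gamma> \<in> abs_gal" for \<gamma>
    proof
      fix y
      obtain x where y: "y = gal_act \<gamma> \<omega> x"
        using bij_gal_act(1)[OF g bij[OF \<omega>]] by (metis bij_pointE)
      have "y = gal_act \<gamma> \<psi> (\<Theta> x)"
        by (simp add: y \<omega>_def gal_act_comp[OF g] gal_act_extension[OF g e])
      then have "\<rho> (v \<gamma> y) = \<phi> x"
        unfolding \<rho>\<omega>[symmetric] by (simp add: vg[OF g] \<omega>_def)
      moreover have "u \<gamma> (gal_act \<gamma> \<rho> y) = \<phi> x"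
        unfolding y gal_act_o[OF g] \<rho>\<omega> by (rule ug[OF g])
      ultimately show "v \<gamma> y = (inv_into UNIV \<rho> \<circ> u \<gamma> \<circ> gal_act \<gamma> \<rho>) y"
        using bij[OF \<rho>] by (metis bij_is_inj comp_apply inv_f_f)
    qed
    then show "(u, v) \<in> cohomologous (aut_bialgebra br \<delta>) (twisted_automorphisms br \<delta> \<alpha>)"
      using u \<rho> unfolding cohomologous_def A by blast
  next
    assume "(u, v) \<in> cohomologous (aut_bialgebra br \<delta>) (twisted_automorphisms br \<delta> \<alpha>)"
    then obtain \<rho> where \<rho>: "lie_bialgebra_iso br_ac (cobr_ac \<alpha>) br_ac (cobr_ac \<alpha>) \<rho>"
      and v: "\<And>\<gamma>. \<gamma> \<in> abs_gal \<Longrightarrow> v \<gamma> = inv_into UNIV \<rho> \<circ> u \<gamma> \<circ> gal_act \<gamma> \<rho>"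
      by (auto simp: cohomologous_def A)
    define \<omega> where "\<omega> = \<rho> \<circ> \<psi>"
    have \<omega>: "lie_bialgebra_iso ?b2 ?d2 br_ac (cobr_ac \<alpha>) \<omega>"
      unfolding \<omega>_def by (rule lie_bialgebra_iso_comp[OF \<psi> \<rho>])
    \<comment> \<open>Candidate for the isomorphism of forms: correct \<psi> by \<rho> and compare
      with \<phi>. The relation between \<open>u\<close> and \<open>v\<close> makes it Galois
      invariant, so it descends.\<close>
    define \<Theta> where "\<Theta> = inv_into UNIV \<omega> \<circ> \<phi>"
    have \<Theta>: "lie_bialgebra_iso ?b1 ?d1 ?b2 ?d2 \<Theta>"
      unfolding \<Theta>_def by (rule lie_bialgebra_iso_comp[OF \<phi> lie_bialgebra_iso_inv[OF \<omega>]])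
    have \<omega>\<Theta>: "\<omega> \<circ> \<Theta> = \<phi>"
      using bij[OF \<omega>] by (simp add: \<Theta>_def surj_iff[THEN iffD1, OF bij_is_surj] flip: comp_assoc)
    have "gal_act \<gamma> \<Theta> x = \<Theta> x" if g: "\<gamma> \<in> abs_gal" for \<gamma> x
    proof -
      have "\<omega> (gal_act \<gamma> \<Theta> x) = \<rho> (v \<gamma> (gal_act \<gamma> \<psi> (gal_act \<gamma> \<Theta> x)))"
        by (simp add: \<omega>_def vg g)
      also have "\<dots> = u \<gamma> (gal_act \<gamma> \<rho> (gal_act \<gamma> \<psi> (gal_act \<gamma> \<Theta> x)))"
        using bij[OF \<rho>] by (simp add: v[OF g] bij_is_surj surj_f_inv_f)
      also have "gal_act \<gamma> \<rho> (gal_act \<gamma> \<psi> (gal_act \<gamma> \<Theta> x)) = gal_act \<gamma> (\<omega> \<circ> \<Theta>) x"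
        by (simp add: gal_act_o g \<omega>_def comp_assoc)
      also have "u \<gamma> \<dots> = (\<omega> \<circ> \<Theta>) x"
        by (simp only: \<omega>\<Theta> ug[OF g])
      also have "\<dots> = \<omega> (\<Theta> x)" by simp
      finally show ?thesis using bij[OF \<omega>] by (simp add: bij_is_inj inj_eq)
    qed
    then have "\<Theta> (vmap \<gamma> x) = vmap \<gamma> (\<Theta> x)" if "\<gamma> \<in> abs_gal" for \<gamma> x
      using that gal_act_vmap by metis
    moreover have "lin \<Theta>" using \<Theta> by (simp add: lie_bialgebra_iso_def lie_iso_def)
    ultimately obtain \<theta> where e: "lin_extends to_ac \<theta> \<Theta>"
      by (metis descend_lin)
    then show "(s, t) \<in> iso_rel (bialgebra_forms br_ac (cobr_ac \<alpha>))"
      using s extends[OF e] \<Theta> by (auto simp: iso_rel_def st)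
  qed
qed

theorem form_classes_eqpoll:
  "form_classes br_ac (cobr_ac \<alpha>) \<approx>
     twisted_automorphisms br \<delta> \<alpha> // cohomologous (aut_bialgebra br \<delta>) (twisted_automorphisms br \<delta> \<alpha>)"
  unfolding form_classes_def
  by (rule quotient_eqpoll[of _ _ _ _ "\<lambda>s u. \<exists>\<phi>. is_descent s \<phi> u"])
    (use equiv_iso_rel descent_exists form_exists descent_iff in \<open>auto simp: cohomologous_def\<close>)

theorem form_classes_empty:
  assumes "twisted_automorphisms br \<delta> \<alpha> = {}"
  shows "form_classes br_ac (cobr_ac \<alpha>) = {}"
  using descent_exists assms unfolding form_classes_def by (auto elim!: quotientE)

end

section \<open>Invariant forms\<close>

abbreviation linform :: "('a::field ^ 'n \<Rightarrow> 'a) \<Rightarrow> bool" where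
  "linform \<equiv> Vector_Spaces.linear (*s) (*)"

lemma lie_anti:
  assumes "lie_algebra br"
  shows "br x y = - br y x"
proof -
  have "br x y + br y x = br (x + y) (x + y) - br x x - br y y"
    by (simp add: bilin_simps[OF lie_algebra_bilin[OF assms]])
  also have "\<dots> = 0" using assms by (simp add: lie_algebra_def)
  finally show ?thesis by (simp add: eq_neg_iff_add_eq_0)
qed

lemma lie_jacobi: "lie_algebra br \<Longrightarrow> br x (br y z) + br y (br z x) + br z (br x y) = 0"
  by (simp add: lie_algebra_def)

lemma lie_leibniz:
  assumes "lie_algebra br"
  shows "br (br x y) z = br x (br y z) - br y (br x z)"
  using lie_jacobi[OF assms, of x y z] lie_anti[OF assms, of z x] lie_anti[OF assms, of z "br x y"]
  by (simp add: bilin_simps[OF lie_algebra_bilin[OF assms]] algebra_simps eq_neg_iff_add_eq_0)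

lemma linform_eqI:
  fixes \<phi> \<psi> :: "'a::field ^ 'm \<Rightarrow> 'a"
  assumes "linform \<phi>" "linform \<psi>"
    and "\<And>i. \<phi> (basis_vec i) = \<psi> (basis_vec i)"
  shows "\<phi> x = \<psi> x"
proof -
  interpret l1: Vector_Spaces.linear "(*s)" "(*)" \<phi> by fact
  interpret l2: Vector_Spaces.linear "(*s)" "(*)" \<psi> by fact
  have "\<phi> (\<Sum>i\<in>UNIV. x $ i *s basis_vec i) = \<psi> (\<Sum>i\<in>UNIV. x $ i *s basis_vec i)"
    by (simp only: l1.sum l2.sum l1.scale l2.scale assms(3))
  then show ?thesis by (simp only: basis_expansion)
qed

definition bform :: "('a::field ^ 'm \<Rightarrow> 'a ^ 'n \<Rightarrow> 'a) \<Rightarrow> bool" where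
  "bform B \<longleftrightarrow> (\<forall>x. linform (B x)) \<and> (\<forall>y. linform (\<lambda>x. B x y))"

lemma linformI:
  fixes \<phi> :: "'a::field ^ 'm \<Rightarrow> 'a"
  assumes "\<And>x y. \<phi> (x + y) = \<phi> x + \<phi> y" "\<And>c x. \<phi> (c *s x) = c * \<phi> x"
  shows "linform \<phi>"
  by unfold_locales (simp_all add: assms algebra_simps)

lemma bformD:
  assumes "bform B"
  shows "B (x + x') y = B x y + B x' y" "B x (y + y') = B x y + B x y'"
    "B (c *s x) y = c * B x y" "B x (c *s y) = c * B x y"
    "B (- x) y = - B x y" "B x (- y) = - B x y"
    "B (x - x') y = B x y - B x' y" "B x (y - y') = B x y - B x y'"
    "B 0 y = 0" "B x 0 = 0"
    "B (sum g A) y = (\<Sum>i\<in>A. B (g i) y)" "B x (sum h C) = (\<Sum>i\<in>C. B x (h i))"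
proof -
  have l: "linform (B x)" "linform (\<lambda>x. B x y)" for x y
    using assms by (auto simp: bform_def)
  interpret l1: Vector_Spaces.linear "(*s)" "(*)" "B x" for x by (rule l)
  interpret l2: Vector_Spaces.linear "(*s)" "(*)" "\<lambda>x. B x y" for y by (rule l)
  show "B (x + x') y = B x y + B x' y" "B x (y + y') = B x y + B x y'"
    "B (c *s x) y = c * B x y" "B x (c *s y) = c * B x y"
    "B (- x) y = - B x y" "B x (- y) = - B x y"
    "B (x - x') y = B x y - B x' y" "B x (y - y') = B x y - B x y'"
    "B 0 y = 0" "B x 0 = 0"
    "B (sum g A) y = (\<Sum>i\<in>A. B (g i) y)" "B x (sum h C) = (\<Sum>i\<in>C. B x (h i))"
    by (fact l2.add l1.add l2.scale l1.scale l2.neg l1.neg l2.diff l1.diff l2.zero l1.zero l2.sum l1.sum)+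
qed

lemma bformI:
  assumes "\<And>x x' y. B (x + x') y = B x y + B x' y" "\<And>x y y'. B x (y + y') = B x y + B x y'"
    "\<And>c x y. B (c *s x) y = c * B x y" "\<And>c x y. B x (c *s y) = c * B x y"
  shows "bform B"
  unfolding bform_def using assms by (auto intro!: linformI)

lemma bform_expand:
  assumes "bform B"
  shows "B x y = (\<Sum>i\<in>UNIV. \<Sum>j\<in>UNIV. x $ i * y $ j * B (basis_vec i) (basis_vec j))"
proof -
  have 1: "B x y = (\<Sum>i\<in>UNIV. x $ i * B (basis_vec i) y)" for x y
    by (subst (1) basis_expansion[of x, symmetric]) (simp add: bformD(3,11)[OF assms])
  have 2: "B x y = (\<Sum>j\<in>UNIV. y $ j * B x (basis_vec j))" for x y
    by (subst (1) basis_expansion[of y, symmetric]) (simp add: bformD(4,12)[OF assms])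
  show ?thesis
    by (subst 1, subst 2) (simp add: sum_distrib_left mult.assoc)
qed

lemma bform_eqI:
  assumes "bform B" "bform C" "\<And>i j. B (basis_vec i) (basis_vec j) = C (basis_vec i) (basis_vec j)"
  shows "B x y = C x y"
  unfolding bform_expand[OF assms(1), of x y] bform_expand[OF assms(2), of x y] assms(3) ..

lemma bform_eq_vmapI:
  assumes "field_hom f" "bform B" "bform C" "\<And>x y. B (vmap f x) (vmap f y) = C (vmap f x) (vmap f y)"
  shows "B x y = C x y"
  by (rule bform_eqI[OF assms(2,3)]) (metis assms(1,4) field_hom.vmap_basis)

lemma bform_ext_form: "bform (ext_form f B)"
  by (rule bformI) (simp_all add: ext_form_def algebra_simps sum.distrib sum_distrib_left)

lemma ext_form_vmap:
  assumes "field_hom f" "bform B"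
  shows "ext_form f B (vmap f x) (vmap f y) = f (B x y)"
proof -
  interpret field_hom f by fact
  show ?thesis
    unfolding bform_expand[OF assms(2), of x y] by (simp add: ext_form_def hom_sum hom_mult)
qed

lemma invariant_formD:
  assumes "invariant_form br B"
  shows "bform B" "B x y = B y x" "(\<And>y. B x y = 0) \<Longrightarrow> x = 0" "B (br x y) z = B x (br y z)"
  using assms by (auto simp: invariant_form_def bform_def)

lemma nondegenerate_eqI:
  assumes "invariant_form br B" "\<And>z. B x z = B y z"
  shows "x = y"
proof -
  have "x - y = 0"
    by (rule invariant_formD(3)[OF assms(1)])
       (simp add: bformD(7)[OF invariant_formD(1)[OF assms(1)]] assms(2))
  then show ?thesis by simp
qed

lemma invariant_form_ad:
  assumes "lie_algebra br" "invariant_form br B"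
  shows "B (br a x) y = - B x (br a y)"
proof -
  note iv = invariant_formD[OF assms(2)]
  have "br a x = - br x a" by (rule lie_anti[OF assms(1)])
  then show ?thesis using iv(4) by (simp add: bformD[OF iv(1)])
qed

text \<open>Nondegeneracy makes the map to the dual space injective, and equal finite dimension
  makes it onto.\<close>

lemma represent_functional:
  assumes "invariant_form br (B :: 'a::field ^ 'n::finite \<Rightarrow> 'a ^ 'n \<Rightarrow> 'a)"
    and "linform \<phi>"
  obtains x where "\<And>y. B x y = \<phi> y"
proof -
  note iv = invariant_formD[OF assms(1)]
  interpret l: Vector_Spaces.linear "(*s)" "(*)" \<phi> by fact
  define F where "F x = (\<chi> i. B x (basis_vec i))" for x
  have linF: "lin F"
    by (rule linI) (simp_all add: F_def vec_eq_iff bformD[OF iv(1)])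
  have expand: "B x y = (\<Sum>i\<in>UNIV. y $ i * B x (basis_vec i))" for x y
    by (subst (1) basis_expansion[of y, symmetric]) (simp add: bformD(4,12)[OF iv(1)])
  have "inj F"
    unfolding vec.linear_inj_iff_eq_0[OF linF]
  proof (intro allI impI)
    fix x assume "F x = 0"
    then have "B x (basis_vec i) = 0" for i by (simp add: F_def vec_eq_iff)
    then have "B x y = 0" for y by (subst expand) simp
    then show "x = 0" by (rule iv(3))
  qed
  then have "surj F" by (rule vec.linear_inj_imp_surj[OF linF])
  then obtain x where x: "F x = (\<chi> i. \<phi> (basis_vec i))" by (metis surjD)
  have "B x y = \<phi> y" for y
  proof -
    have "\<phi> y = \<phi> (\<Sum>i\<in>UNIV. y $ i *s basis_vec i)" by (simp add: basis_expansion)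
    also have "\<dots> = (\<Sum>i\<in>UNIV. y $ i * \<phi> (basis_vec i))"
      by (simp add: l.sum l.scale)
    also have "\<dots> = B x y"
      using x by (subst expand) (simp add: F_def vec_eq_iff)
    finally show ?thesis ..
  qed
  then show ?thesis using that by blast
qed

lemma represent_bform:
  assumes "invariant_form br (B :: 'a::field ^ 'n::finite \<Rightarrow> 'a ^ 'n \<Rightarrow> 'a)" and "bform C"
  obtains R where "lin R" "\<And>x y. B (R x) y = C x y"
proof -
  note iv = invariant_formD[OF assms(1)]
  have "\<exists>z. \<forall>y. B z y = C x y" for x
    by (rule represent_functional[OF assms(1), of "C x"]) (use assms(2) in \<open>auto simp: bform_def\<close>)
  then obtain R where R: "\<And>x y. B (R x) y = C x y" by metis
  have "lin R"
    by (rule linI; rule nondegenerate_eqI[OF assms(1)])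
      (simp_all add: bformD[OF iv(1)] R bformD[OF assms(2)])
  then show ?thesis using R that by blast
qed

lemma invariant_form_ext:
  assumes "field_hom f" "bilin_extends f br br'" "invariant_form br B"
  shows "invariant_form br' (ext_form f B)"
proof -
  interpret field_hom f by fact
  note iv = invariant_formD[OF assms(3)]
  let ?B = "ext_form f B"
  note b = bform_ext_form[of f B] and v = ext_form_vmap[OF assms(1) iv(1)]
  have sym: "?B x y = ?B y x" for x y
    by (rule bform_eq_vmapI[OF assms(1) b, of "\<lambda>x y. ?B y x"])
      (auto intro!: bformI simp: bformD[OF b] v intro: iv(2) arg_cong[of _ _ f])
  \<comment> \<open>Each coordinate functional is represented by a vector over the small field,
    which still represents it after extension; so a vector in the radical has zero
    coordinates.\<close>
  have nondeg: "x = 0" if x: "\<And>y. ?B x y = 0" for x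
  proof -
    have "x $ i = 0" for i
    proof -
      have "linform (\<lambda>y. y $ i)" by (rule linformI) simp_all
      then obtain d where d: "\<And>y. B d y = y $ i"
        by (rule represent_functional[OF assms(3)]) blast
      have "?B y (vmap f d) = y $ i" for y
      proof (rule linform_eqI)
        fix j
        have "?B (vmap f (basis_vec j)) (vmap f d) = f (basis_vec j $ i)"
          by (simp only: v iv(2)[of _ d] d)
        moreover have "f (basis_vec j $ i) = basis_vec j $ i"
          by (simp add: axis_def hom_zero hom_one)
        ultimately show "?B (basis_vec j) (vmap f d) = basis_vec j $ i"
          by (simp only: vmap_basis)
      qed (auto intro!: linformI simp: bformD[OF b])
      then show ?thesis using x by metis
    qed
    then show ?thesis by (simp add: vec_eq_iff)
  qed
  note la = bilin_simps[OF bilin_extendsD(2)[OF assms(2)]]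
  \<comment> \<open>Invariance is trilinear: \<open>x\<close> and \<open>y\<close> are freed first
    with \<open>z\<close> over the small field, then \<open>z\<close> as well.\<close>
  have i1: "?B (br' x y) (vmap f z) = ?B x (br' y (vmap f z))" for x y z
    by (rule bform_eq_vmapI[OF assms(1), of "\<lambda>x y. ?B (br' x y) (vmap f z)" "\<lambda>x y. ?B x (br' y (vmap f z))"])
      (auto intro!: bformI simp: bformD[OF b] la v bilin_extendsD(3)[OF assms(2)] iv(4))
  have i2: "?B (br' x y) z = ?B x (br' y z)" for x y z
    by (rule bform_eq_vmapI[OF assms(1), of "\<lambda>x z. ?B (br' x y) z" "\<lambda>x z. ?B x (br' y z)"])
      (auto intro!: bformI simp: bformD[OF b] la i1)
  show ?thesis
    unfolding invariant_form_def using b sym nondeg i2 by (auto simp: bform_def)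
qed

section \<open>The Killing form\<close>

definition killing :: "('a::field, 'n::finite) bracket \<Rightarrow> 'a ^ 'n \<Rightarrow> 'a ^ 'n \<Rightarrow> 'a" where
  "killing br x y = trace (matrix (br x) ** matrix (br y))"

lemma matrix_lin_comp: "lin \<phi> \<Longrightarrow> lin \<psi> \<Longrightarrow> matrix \<phi> ** matrix \<psi> = matrix (\<phi> \<circ> \<psi>)"
  by (rule matrix_compose_gen[symmetric])

lemma killing_bform:
  assumes "bilin br"
  shows "bform (killing br)"
proof -
  note l = bilin_lin[OF assms]
  have "matrix (br (x + y)) = matrix (br x) + matrix (br y)" "matrix (br (c *s x)) = (\<chi> i j. c * matrix (br x) $ i $ j)"
    for c x y
    by (simp_all add: matrix_def vec_eq_iff lin_add[OF l(2)] lin_smult[OF l(2)])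
  then show ?thesis
    by (intro bformI)
      (simp_all add: killing_def trace_def matrix_matrix_mult_def algebra_simps sum.distrib sum_distrib_left)
qed

lemma trace_matrix_diff:
  fixes A B C :: "'a::comm_ring_1 ^ 'n ^ 'n"
  shows "trace ((A - B) ** C) = trace (A ** C) - trace (B ** C)"
    and "trace (C ** (A - B)) = trace (C ** A) - trace (C ** B)"
  by (simp_all add: trace_def matrix_matrix_mult_def algebra_simps sum_subtractf)

lemma killing_invariant:
  assumes "lie_algebra br"
  shows "killing br (br x y) z = killing br x (br y z)"
proof -
  note l = bilin_lin[OF lie_algebra_bilin[OF assms]]
  let ?M = "\<lambda>x. matrix (br x)"
  have M: "?M (br x y) = ?M x ** ?M y - ?M y ** ?M x" for x y
    by (simp add: matrix_lin_comp l) (simp add: lie_leibniz[OF assms] matrix_def vec_eq_iff)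
  have "trace (?M y ** ?M x ** ?M z) = trace (?M x ** ?M z ** ?M y)"
    by (metis matrix_mul_assoc trace_mul_sym)
  then show ?thesis
    by (simp add: killing_def M trace_matrix_diff matrix_mul_assoc)
qed

lemma killing_lie_iso:
  assumes "lie_iso b1 b2 \<phi>" "bilin b1" "bilin b2"
  shows "killing b2 (\<phi> x) (\<phi> y) = killing b1 x y"
proof -
  have l: "lin \<phi>" and b: "bij \<phi>" and h: "\<And>x y. \<phi> (b1 x y) = b2 (\<phi> x) (\<phi> y)"
    using assms(1) by (auto simp: lie_iso_def)
  let ?\<psi> = "inv_into UNIV \<phi>"
  have \<psi>: "lin ?\<psi>" by (rule lin_inv[OF l b])
  have c: "?\<psi> \<circ> \<phi> = id" "\<phi> (?\<psi> z) = z" for z using b by (auto simp: bij_is_inj bij_is_surj surj_f_inv_f)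
  have M: "matrix (b2 (\<phi> x)) = matrix \<phi> ** matrix (b1 x) ** matrix ?\<psi>" for x
  proof -
    have "b2 (\<phi> x) = \<phi> \<circ> b1 x \<circ> ?\<psi>"
      by (simp add: fun_eq_iff h c)
    then show ?thesis by (simp add: matrix_lin_comp l \<psi> lin_o bilin_lin[OF assms(2)])
  qed
  have I: "matrix ?\<psi> ** matrix \<phi> = mat 1"
    unfolding matrix_lin_comp[OF \<psi> l] c(1) by (rule matrix_id_mat_1)
  have "killing b2 (\<phi> x) (\<phi> y) = trace (matrix \<phi> ** (matrix (b1 x) ** (matrix ?\<psi> ** matrix \<phi>) ** matrix (b1 y) ** matrix ?\<psi>))"
    by (simp add: killing_def M matrix_mul_assoc)
  also have "\<dots> = trace (matrix \<phi> ** (matrix (b1 x) ** matrix (b1 y) ** matrix ?\<psi>))"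
    by (simp only: I matrix_mul_rid)
  also have "\<dots> = trace (matrix (b1 x) ** matrix (b1 y) ** (matrix ?\<psi> ** matrix \<phi>))"
    by (subst trace_mul_sym) (simp only: matrix_mul_assoc)
  finally show ?thesis by (simp only: I killing_def matrix_mul_rid)
qed

lemma killing_extends:
  assumes "field_hom f" "bilin_extends f br br'"
  shows "killing br' (vmap f x) (vmap f y) = f (killing br x y)"
proof -
  interpret field_hom f by fact
  have "br' (vmap f x) (basis_vec j) = vmap f (br x (basis_vec j))" for x j
    using bilin_extendsD(3)[OF assms(2), of x "basis_vec j"] by (simp add: vmap_basis)
  then show ?thesis
    by (simp add: killing_def trace_def matrix_matrix_mult_def matrix_def hom_sum hom_mult)
qed

text \<open>Substitute for Schur's lemma: endomorphisms of the adjoint module are scalars.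
  Simplicity alone would allow the centroid to be a larger field.\<close>

definition centroid_trivial :: "('a::field, 'n::finite) bracket \<Rightarrow> bool" where
  "centroid_trivial br \<longleftrightarrow>
     (\<forall>\<phi>. lin \<phi> \<longrightarrow> (\<forall>x y. \<phi> (br x y) = br x (\<phi> y)) \<longrightarrow> (\<exists>c. \<forall>x. \<phi> x = c *s x))"

text \<open>Dividing \<open>C\<close> by the nondegenerate \<open>B\<close> gives an endomorphism
  \<open>R\<close> commuting with the adjoint action, hence a scalar.\<close>

lemma invariant_bform_unique:
  assumes "lie_algebra br" "invariant_form br B" "centroid_trivial br" "bform C"
    and C: "\<And>a x y. C (br a x) y = - C x (br a y)"
  shows "\<exists>k. \<forall>x y. C x y = k * B x y"
proof -
  obtain R where R: "lin R" "\<And>x y. B (R x) y = C x y"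
    by (rule represent_bform[OF assms(2,4)]) blast
  have "R (br a x) = br a (R x)" for a x
  proof (rule nondegenerate_eqI[OF assms(2)])
    show "B (R (br a x)) z = B (br a (R x)) z" for z
      unfolding R(2) C invariant_form_ad[OF assms(1,2)] ..
  qed
  then obtain k where "\<And>x. R x = k *s x"
    using assms(3) R(1) unfolding centroid_trivial_def by blast
  then have "C x y = k * B x y" for x y
    using R(2)[of x y] by (simp add: bformD[OF invariant_formD(1)[OF assms(2)]])
  then show ?thesis by blast
qed

text \<open>The Killing form depends on the bracket alone, so automorphisms fix it. It is
  \<open>k * B\<close>, where \<open>k\<close> is nonzero because the Killing form is.\<close>

lemma automorphism_preserves_form:
  assumes "lie_algebra br" "invariant_form br B" "centroid_trivial br" "killing br p q \<noteq> 0"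
    and "lie_iso br br u"
  shows "B (u x) (u y) = B x y"
proof -
  have ad: "killing br (br a x) y = - killing br x (br a y)" for a x y
  proof -
    note kb = killing_bform[OF lie_algebra_bilin[OF assms(1)]]
    have "br a x = - br x a" by (rule lie_anti[OF assms(1)])
    then show ?thesis by (simp add: bformD(5)[OF kb] killing_invariant[OF assms(1)])
  qed
  obtain k where k: "\<And>x y. killing br x y = k * B x y"
    using invariant_bform_unique[where C = "killing br", OF assms(1-3) killing_bform[OF lie_algebra_bilin[OF assms(1)]] ad]
    by blast
  then have "k \<noteq> 0" using assms(4) by auto
  then show ?thesis
    using k[of "u x" "u y"] k[of x y]
      killing_lie_iso[OF assms(5) lie_algebra_bilin lie_algebra_bilin, OF assms(1,1), of x y] by simp
qed

section \<open>Split simple Lie algebras\<close>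

lemma diagonalizable_basis:
  fixes A :: "'a::field ^ 'n \<Rightarrow> 'a ^ 'n"
  assumes "diagonalizable A"
  obtains P :: "'a ^ 'n \<Rightarrow> 'a ^ 'n" and d where "lin P" "bij P" "\<And>i. A (P (basis_vec i)) = d i *s P (basis_vec i)"
proof -
  obtain P :: "'a ^ 'n \<Rightarrow> 'a ^ 'n" where P: "lin P" "bij P" "\<And>i. P (basis_vec i) \<in> {v. \<exists>c. A v = c *s v}"
    by (rule spanning_basis[OF assms[unfolded diagonalizable_def]]) blast
  then have "\<forall>i. \<exists>c. A (P (basis_vec i)) = c *s P (basis_vec i)" by blast
  then show ?thesis using that P(1,2) by metis
qed

lemma diagonal_apply:
  fixes A :: "'a::field ^ 'n \<Rightarrow> 'a ^ 'n"
  assumes "lin A" "lin P" "\<And>i. A (P (basis_vec i)) = d i *s P (basis_vec i)"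
  shows "A (P v) = P (\<chi> i. d i * v $ i)"
proof -
  have D: "lin (\<lambda>v. \<chi> i. d i * v $ i)"
    by (rule linI) (auto simp: vec_eq_iff algebra_simps)
  have "(\<lambda>v. A (P v)) = (\<lambda>v. P (\<chi> i. d i * v $ i))"
  proof (rule lin_eqI[OF lin_comp[OF assms(1,2)] lin_comp[OF assms(2) D]])
    fix i
    have "(\<chi> j. d j * basis_vec i $ j) = d i *s basis_vec i"
      by (auto simp: vec_eq_iff axis_def)
    then show "A (P (basis_vec i)) = P (\<chi> j. d j * basis_vec i $ j)"
      by (simp only: assms(3) lin_smult[OF assms(2)])
  qed
  then show ?thesis by metis
qed

text \<open>In eigencoordinates, subtracting \<open>d i\<close> from \<open>A\<close> removes the
  \<open>i\<close>-th coordinate and stays in \<open>E\<close>, so shrinking the support ends at an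
  eigenvector.\<close>

lemma diagonalizable_eigenvector:
  fixes A :: "'a::field ^ 'n \<Rightarrow> 'a ^ 'n"
  assumes "diagonalizable A" "lin A" "vec.subspace E" "\<And>x. x \<in> E \<Longrightarrow> A x \<in> E" "x \<in> E" "x \<noteq> 0"
  obtains y c where "y \<in> E" "y \<noteq> 0" "A y = c *s y"
proof -
  obtain P :: "'a ^ 'n \<Rightarrow> 'a ^ 'n" and d where P: "lin P" "bij P" "\<And>i. A (P (basis_vec i)) = d i *s P (basis_vec i)"
    by (rule diagonalizable_basis[OF assms(1)]) blast
  note AP = diagonal_apply[OF assms(2) P(1,3)]
  have "\<exists>y c. y \<in> E \<and> y \<noteq> 0 \<and> A y = c *s y" if "P v \<in> E" "v \<noteq> 0" for v
    using that
  proof (induction "card {i. v $ i \<noteq> 0}" arbitrary: v rule: less_induct)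
    case less
    obtain i where i: "v $ i \<noteq> 0" using less.prems(2) by (auto simp: vec_eq_iff)
    define w where "w = (\<chi> j. (d j - d i) * v $ j)"
    have Pw: "P w = A (P v) - d i *s P v"
    proof -
      have "w = (\<chi> j. d j * v $ j) - d i *s v" by (simp add: w_def vec_eq_iff algebra_simps)
      then show ?thesis by (simp add: AP lin_diff[OF P(1)] lin_smult[OF P(1)])
    qed
    show ?case
    proof (cases "w = 0")
      case True
      then have "A (P v) = d i *s P v" using Pw lin_zero[OF P(1)] by simp
      moreover have "P v \<noteq> 0"
        using less.prems(2) P(2) lin_zero[OF P(1)] by (metis bij_is_inj injD)
      ultimately show ?thesis using less.prems(1) by blast
    next
      case False
      have "{j. w $ j \<noteq> 0} \<subset> {j. v $ j \<noteq> 0}"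
        using i by (auto simp: w_def)
      then have "card {j. w $ j \<noteq> 0} < card {j. v $ j \<noteq> 0}"
        by (intro psubset_card_mono) auto
      moreover have "P w \<in> E"
        unfolding Pw by (intro vec.subspace_diff vec.subspace_scale assms(3,4) less.prems(1))
      ultimately show ?thesis using less.hyps False by blast
    qed
  qed
  moreover obtain v where "x = P v" using P(2) by (metis bij_pointE)
  ultimately show ?thesis using that assms(5,6) lin_zero[OF P(1)] by metis
qed

text \<open>In eigencoordinates, a power of \<open>A\<close> can kill a vector only if every
  coordinate with nonzero \<open>d i\<close> vanishes.\<close>

lemma diagonalizable_nilpotent:
  fixes A :: "'a::field ^ 'n \<Rightarrow> 'a ^ 'n"
  assumes "diagonalizable A" "lin A" "(A ^^ m) y = 0"
  shows "A y = 0"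
proof -
  obtain P :: "'a ^ 'n \<Rightarrow> 'a ^ 'n" and d where P: "lin P" "bij P" "\<And>i. A (P (basis_vec i)) = d i *s P (basis_vec i)"
    by (rule diagonalizable_basis[OF assms(1)]) blast
  note AP = diagonal_apply[OF assms(2) P(1,3)]
  obtain v where y: "y = P v" using P(2) by (metis bij_pointE)
  have "(A ^^ k) (P v) = P (\<chi> i. d i ^ k * v $ i)" for k
    by (induction k) (simp_all add: AP mult.assoc)
  then have "P (\<chi> i. d i ^ m * v $ i) = P 0"
    using assms(3) y lin_zero[OF P(1)] by simp
  then have "(\<chi> i. d i ^ m * v $ i) = 0"
    using P(2) by (metis bij_is_inj injD)
  then have "(\<chi> i. d i * v $ i) = 0" by (auto simp: vec_eq_iff)
  then show ?thesis using y AP lin_zero[OF P(1)] by simp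
qed

text \<open>The trace of the square is the sum of the squares of the eigenvalues, and the order on
  the rationals forces each of them to vanish.\<close>

lemma diagonalizable_trace_square:
  fixes A :: "rat ^ 'n \<Rightarrow> rat ^ 'n"
  assumes "diagonalizable A" "lin A" "trace (matrix A ** matrix A) = 0"
  shows "A y = 0"
proof -
  obtain P :: "rat ^ 'n \<Rightarrow> rat ^ 'n" and d where P: "lin P" "bij P" "\<And>i. A (P (basis_vec i)) = d i *s P (basis_vec i)"
    by (rule diagonalizable_basis[OF assms(1)]) blast
  note AP = diagonal_apply[OF assms(2) P(1,3)]
  define Q where "Q = inv_into UNIV P"
  have Q: "lin Q" unfolding Q_def by (rule lin_inv[OF P(1,2)])
  have QP: "Q (P x) = x" and PQ: "P (Q x) = x" for x
    using P(2) by (auto simp: Q_def bij_is_inj bij_is_surj surj_f_inv_f)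
  let ?D = "\<lambda>v. \<chi> i. (d i * d i) * v $ i"
  have "A \<circ> A = P \<circ> (?D \<circ> Q)"
  proof
    fix x
    show "(A \<circ> A) x = (P \<circ> (?D \<circ> Q)) x"
      using AP[of "Q x"] by (simp add: PQ AP mult.assoc)
  qed
  moreover have D: "lin ?D"
    by (rule linI) (auto simp: vec_eq_iff algebra_simps)
  ultimately have AA: "matrix A ** matrix A = matrix P ** (matrix ?D ** matrix Q)"
    by (simp add: matrix_lin_comp assms(2) P(1) Q D lin_o)
  have "trace (matrix A ** matrix A) = trace (matrix ?D ** matrix Q ** matrix P)"
    unfolding AA by (rule trace_mul_sym)
  also have "\<dots> = trace (matrix ?D)"
  proof -
    have "Q \<circ> P = id" using QP by auto
    then show ?thesis
      by (simp only: matrix_mul_assoc[symmetric] matrix_lin_comp[OF Q P(1)] matrix_id_mat_1 matrix_mul_rid)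
  qed
  also have "\<dots> = (\<Sum>i\<in>UNIV. d i * d i)"
    by (simp add: trace_def matrix_def axis_def)
  finally have "(\<Sum>i\<in>UNIV. d i * d i) = 0" using assms(3) by simp
  then have "d i = 0" for i
    by (simp add: sum_nonneg_eq_0_iff)
  then have "A (P (Q y)) = P 0"
    unfolding AP by (simp add: zero_vec_def)
  then show ?thesis using PQ lin_zero[OF P(1)] by simp
qed

section \<open>Cartan subalgebras and the centroid\<close>

lemma simple_lieD:
  assumes "simple_lie br"
  shows "lie_algebra br" "\<exists>x y. br x y \<noteq> 0" "lie_ideal br I \<Longrightarrow> I = {0} \<or> I = UNIV"
  using assms by (auto simp: simple_lie_def)

text \<open>A central \<open>H\<close> is normalized by everything; being self-normalizing, it would
  be the whole algebra, which would then be abelian.\<close>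

lemma cartan_not_central:
  assumes "simple_lie br" "cartan_subalgebra br H"
  obtains h x where "h \<in> H" "br h x \<noteq> 0"
proof -
  have "\<exists>h\<in>H. \<exists>x. br h x \<noteq> 0"
  proof (rule ccontr)
    assume "\<not> ?thesis"
    then have 0: "br h x = 0" if "h \<in> H" for h x using that by blast
    have "0 \<in> H"
      using assms(2) by (auto simp: cartan_subalgebra_def lie_subalgebra_def vec.subspace_0)
    moreover have "br x h = 0" if "h \<in> H" for h x
      using 0[OF that, of x] lie_anti[OF simple_lieD(1)[OF assms(1)], of x h] by simp
    ultimately have "H = UNIV"
      using assms(2) by (auto simp: cartan_subalgebra_def)
    then show False using 0 simple_lieD(2)[OF assms(1)] by blast
  qed
  then show ?thesis using that by blast
qed

lemma killing_split_rational:
  assumes "split_simple_lie (br :: (rat, 'n::finite) bracket)"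
  obtains h where "killing br h h \<noteq> 0"
proof -
  obtain H where s: "simple_lie br" and H: "cartan_subalgebra br H" "\<And>h. h \<in> H \<Longrightarrow> diagonalizable (br h)"
    using assms by (auto simp: split_simple_lie_def)
  obtain h x where "h \<in> H" "br h x \<noteq> 0" by (rule cartan_not_central[OF s H(1)])
  moreover from this have "killing br h h \<noteq> 0"
    using diagonalizable_trace_square[OF H(2)[of h], of x]
      bilin_lin(1)[OF lie_algebra_bilin[OF simple_lieD(1)[OF s]]] by (auto simp: killing_def)
  ultimately show ?thesis using that by blast
qed

text \<open>
  For \<open>\<phi>\<close> in the centroid and \<open>h\<close> in a split Cartan subalgebra also \<open>\<phi> h\<close> lies in it, and
  \<open>\<phi>\<close> acts on the root space of a root \<open>\<alpha>\<close> with \<open>\<alpha> h \<noteq> 0\<close> by \<open>\<alpha> (\<phi> h) / \<alpha> h\<close>.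
\<close>

lemma centroid_split_simple:
  fixes br :: "('a::field, 'n::finite) bracket"
  assumes "split_simple_lie br"
  shows "centroid_trivial br"
  unfolding centroid_trivial_def
proof (intro allI impI)
  fix \<phi> assume \<phi>: "lin \<phi>" "\<forall>x y. \<phi> (br x y) = br x (\<phi> y)"
  obtain H where s: "simple_lie br" and H: "cartan_subalgebra br H" "\<And>h. h \<in> H \<Longrightarrow> diagonalizable (br h)"
    using assms by (auto simp: split_simple_lie_def)
  note L = simple_lieD(1)[OF s]
  note l = bilin_lin[OF lie_algebra_bilin[OF L]]
  note anti = lie_anti[OF L]
  have \<phi>2: "\<phi> (br x y) = br (\<phi> x) y" for x y
    using \<phi>(2) anti[of x y] anti[of "\<phi> x" y] by (simp add: lin_uminus[OF \<phi>(1)])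
  \<comment> \<open>On \<open>H\<close> the operator \<open>br h\<close> is nilpotent along the
    lower central series; being diagonalizable, it is zero there.\<close>
  have abelian: "br h k = 0" if "h \<in> H" "k \<in> H" for h k
  proof -
    have "(br h ^^ m) k \<in> lower_central br H m" for m
    proof (induction m)
      case (Suc m)
      then have "br h ((br h ^^ m) k) \<in> {br x y | x y. x \<in> H \<and> y \<in> lower_central br H m}"
        using that(1) by blast
      then show ?case by (simp add: vec.span_base)
    qed (simp add: that)
    moreover obtain m where "lower_central br H m = {0}"
      using H(1) by (auto simp: cartan_subalgebra_def)
    ultimately have "(br h ^^ m) k = 0" by blast
    then show ?thesis by (rule diagonalizable_nilpotent[OF H(2)[OF that(1)] l(1)])
  qed
  obtain h z where h: "h \<in> H" "br h z \<noteq> 0" by (rule cartan_not_central[OF s H(1)])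
  obtain P :: "'a ^ 'n \<Rightarrow> 'a ^ 'n" and d where P: "lin P" "bij P" "\<And>i. br h (P (basis_vec i)) = d i *s P (basis_vec i)"
    by (rule diagonalizable_basis[OF H(2)[OF h(1)]]) blast
  obtain i where i: "d i \<noteq> 0"
  proof (rule ccontr)
    assume "\<not> thesis"
    then have "d i = 0" for i using that by blast
    then have "br h (P v) = P 0" for v
      unfolding diagonal_apply[OF l(1) P(1,3)] by (simp add: zero_vec_def)
    moreover obtain v where "z = P v" using P(2) by (metis bij_pointE)
    ultimately show False using h(2) lin_zero[OF P(1)] by simp
  qed
  \<comment> \<open>\<phi> carries \<open>br h y = 0\<close> to \<open>br (\<phi> h) y = 0\<close>,
    so \<open>\<phi> h\<close> normalizes \<open>H\<close> and self-normalization applies.\<close>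
  have k: "\<phi> h \<in> H"
  proof -
    have "br (\<phi> h) y = 0" if "y \<in> H" for y
      using abelian[OF h(1) that] by (simp add: lin_zero[OF \<phi>(1)] flip: \<phi>2)
    moreover have "0 \<in> H"
      using H(1) by (auto simp: cartan_subalgebra_def lie_subalgebra_def vec.subspace_0)
    ultimately have "\<phi> h \<in> {x. \<forall>y\<in>H. br x y \<in> H}" by auto
    then show ?thesis using H(1) by (auto simp: cartan_subalgebra_def)
  qed
  define E where "E = {x. br h x = d i *s x}"
  have E: "vec.subspace E"
    unfolding E_def vec.subspace_def
    by (auto simp: lin_zero[OF l(1)] lin_add[OF l(1)] lin_smult[OF l(1)] vec.scale_right_distrib mult.commute)
  \<comment> \<open>On this eigenspace \<open>br (\<phi> h)\<close> is \<open>d i\<close> times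
    \<phi>, so an eigenvector of it there with value \<open>c\<close> is an eigenvector of \<phi>
    with value \<open>c / d i\<close>.\<close>
  have \<phi>E: "br (\<phi> h) x = d i *s \<phi> x" if "x \<in> E" for x
    using that by (simp add: E_def lin_smult[OF \<phi>(1)] flip: \<phi>2)
  have "br (\<phi> h) x \<in> E" if "x \<in> E" for x
  proof -
    have "br h (\<phi> x) = \<phi> (br h x)" using \<phi>(2) by simp
    also have "\<dots> = d i *s \<phi> x" using that by (simp add: E_def lin_smult[OF \<phi>(1)])
    finally have "\<phi> x \<in> E" by (simp add: E_def)
    then show ?thesis unfolding \<phi>E[OF that] by (rule vec.subspace_scale[OF E])
  qed
  moreover have "P (basis_vec i) \<in> E" by (simp add: E_def P)
  moreover have "P (basis_vec i) \<noteq> 0"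
    using P(2) lin_zero[OF P(1)] by (metis axis_eq_0_iff bij_is_inj injD zero_neq_one)
  ultimately obtain x c where x: "x \<in> E" "x \<noteq> 0" "br (\<phi> h) x = c *s x"
    by (rule diagonalizable_eigenvector[OF H(2)[OF k] l(1) E])
  have "\<phi> x = (c / d i) *s x"
  proof -
    have "d i *s \<phi> x = c *s x" using \<phi>E x by simp
    then have "inverse (d i) *s (d i *s \<phi> x) = inverse (d i) *s (c *s x)" by simp
    then show ?thesis using i by (simp add: field_simps)
  qed
  then have "x \<in> {x. \<phi> x = (c / d i) *s x}" by simp
  \<comment> \<open>Eigenspaces of a centroid element are ideals, and a nonzero one is everything by
    simplicity.\<close>
  moreover have "lie_ideal br {x. \<phi> x = (c / d i) *s x}"
    unfolding lie_ideal_def vec.subspace_def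
    by (auto simp: lin_zero[OF \<phi>(1)] lin_add[OF \<phi>(1)] lin_smult[OF \<phi>(1)] vec.scale_right_distrib mult.commute
        \<phi>(2)[rule_format] lin_smult[OF l(1)])
  ultimately have "{x. \<phi> x = (c / d i) *s x} = UNIV"
    using simple_lieD(3)[OF s] x(2) by blast
  then show "\<exists>c. \<forall>x. \<phi> x = c *s x" by blast
qed

text \<open>The closure is a vector space over K, and the nonzero vector \<open>a\<close> can be
  completed to a basis.\<close>

lemma separating_functional:
  fixes a :: "'k::field alg_closure"
  assumes "a \<noteq> 0"
  obtains \<xi> :: "'k alg_closure \<Rightarrow> 'k" where "\<And>x y. \<xi> (x + y) = \<xi> x + \<xi> y"
    "\<And>c x. \<xi> (to_ac c * x) = c * \<xi> x" "\<xi> a \<noteq> 0"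
proof -
  interpret vp: vector_space_pair "\<lambda>(k::'k) x. to_ac k * x" "(*) :: 'k \<Rightarrow> 'k \<Rightarrow> 'k"
    by unfold_locales (simp_all add: algebra_simps)
  have "vp.vs1.independent {a}" using assms by (simp add: vp.vs1.dependent_single)
  from vp.linear_independent_extend[OF this, of "\<lambda>_. 1"]
  obtain g where g: "Vector_Spaces.linear (\<lambda>k x. to_ac k * x) (*) g" "g a = 1" by auto
  interpret g: Vector_Spaces.linear "\<lambda>k x. to_ac k * x" "(*)" g by fact
  show ?thesis using that[of g] g.add g.scale g(2) by simp
qed

text \<open>
  A functional \<open>\<xi>\<close> from the algebraic closure to \<open>K\<close> turns an element of the geometric centroid
  into one of the centroid over \<open>K\<close>, and such functionals separate points.
\<close>

lemma centroid_alg_closure: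
  fixes br :: "('k::field, 'n::finite) bracket"
  assumes "centroid_trivial br" "bilin_extends to_ac br br'"
  shows "centroid_trivial br'"
  unfolding centroid_trivial_def
proof (intro allI impI)
  fix \<phi> assume \<phi>: "lin \<phi>" "\<forall>x y. \<phi> (br' x y) = br' x (\<phi> y)"
  interpret field_hom "to_ac :: 'k \<Rightarrow> _" by (rule field_hom_to_ac)
  note l = bilin_lin[OF bilin_extendsD(1)[OF assms(2)]] and l' = bilin_lin[OF bilin_extendsD(2)[OF assms(2)]]
  \<comment> \<open>For each \<xi> the map \<psi> below lies in the centroid over K, so applying
    \<xi> to the entries of the matrix of \<phi> gives a scalar matrix.\<close>
  have *: "\<exists>c. \<forall>j i. \<xi> (\<phi> (basis_vec j) $ i) = (if i = j then c else 0)"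
    if \<xi>: "\<And>x y. \<xi> (x + y) = \<xi> x + \<xi> y" "\<And>c x. \<xi> (to_ac c * x) = c * \<xi> x" for \<xi> :: "'k alg_closure \<Rightarrow> 'k"
  proof -
    have \<xi>0: "\<xi> 0 = 0" using \<xi>(2)[of 0 0] by simp
    have \<xi>_sum: "\<xi> (sum g A) = (\<Sum>x\<in>A. \<xi> (g x))" for g :: "'n \<Rightarrow> _" and A
      by (induction A rule: infinite_finite_induct) (auto simp: \<xi>0 \<xi>(1))
    have \<xi>_mult: "\<xi> (x * to_ac c) = c * \<xi> x" for c x using \<xi>(2) by (simp add: mult.commute)
    have V: "vmap \<xi> (br' (vmap to_ac x) y) = br x (vmap \<xi> y)" for x y
    proof -
      have e: "br' (vmap to_ac x) (basis_vec j) = vmap to_ac (br x (basis_vec j))" for j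
        using bilin_extendsD(3)[OF assms(2), of x "basis_vec j"] by (simp add: vmap_basis)
      have "br' (vmap to_ac x) y = (\<Sum>j\<in>UNIV. y $ j *s vmap to_ac (br x (basis_vec j)))"
        unfolding e[symmetric] by (rule lin_expand[OF l'(1)])
      moreover have "br x (vmap \<xi> y) = (\<Sum>j\<in>UNIV. \<xi> (y $ j) *s br x (basis_vec j))"
        using lin_expand[OF l(1), of x "vmap \<xi> y"] by simp
      ultimately show ?thesis
        by (simp add: vec_eq_iff sum_component \<xi>_sum \<xi>_mult mult.commute)
    qed
    define \<psi> where "\<psi> x = vmap \<xi> (\<phi> (vmap to_ac x))" for x
    have "lin \<psi>"
      by (rule linI) (simp_all add: \<psi>_def vmap_add vmap_smult lin_add[OF \<phi>(1)] lin_smult[OF \<phi>(1)]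
        vec_eq_iff \<xi>)
    moreover have "\<forall>x y. \<psi> (br x y) = br x (\<psi> y)"
      using \<phi>(2) by (simp add: \<psi>_def V flip: bilin_extendsD(3)[OF assms(2)])
    ultimately obtain c where c: "\<And>x. \<psi> x = c *s x"
      using assms(1) unfolding centroid_trivial_def by blast
    have "\<xi> (\<phi> (basis_vec j) $ i) = (if i = j then c else 0)" for i j
    proof -
      have "\<xi> (\<phi> (basis_vec j) $ i) = (c *s basis_vec j) $ i"
        using arg_cong[OF c[of "basis_vec j"], of "\<lambda>v. v $ i"] by (simp only: \<psi>_def vmap_basis vmap_nth)
      then show ?thesis by (simp add: axis_def)
    qed
    then show ?thesis by blast
  qed
  obtain i0 :: 'n where True by simp
  \<comment> \<open>Any diagonal entry serves as the scalar; a deviating entry would be detected by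
    some \<xi>.\<close>
  define c where "c = \<phi> (basis_vec i0) $ i0"
  have "\<phi> (basis_vec j) $ i = (if i = j then c else 0)" for i j
  proof (rule ccontr)
    assume "\<not> ?thesis"
    then have "\<phi> (basis_vec j) $ i - (if i = j then c else 0) \<noteq> 0" by simp
    then obtain \<xi> :: "'k alg_closure \<Rightarrow> 'k" where \<xi>: "\<And>x y. \<xi> (x + y) = \<xi> x + \<xi> y" "\<And>c x. \<xi> (to_ac c * x) = c * \<xi> x"
      "\<xi> (\<phi> (basis_vec j) $ i - (if i = j then c else 0)) \<noteq> 0"
      by (rule separating_functional) blast
    have "\<xi> (x - y) = \<xi> x - \<xi> y" for x y using \<xi>(1)[of "x - y" y] by simp
    moreover have "\<xi> 0 = 0" using \<xi>(2)[of 0 0] by simp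
    moreover obtain c' where "\<And>j i. \<xi> (\<phi> (basis_vec j) $ i) = (if i = j then c' else 0)"
      using *[OF \<xi>(1,2)] by blast
    ultimately show False using \<xi>(3) by (simp add: c_def split: if_splits)
  qed
  then have "\<phi> (basis_vec j) = c *s basis_vec j" for j
    by (auto simp: vec_eq_iff axis_def)
  then have "\<phi> = (\<lambda>x. c *s x)"
    by (intro lin_eqI[OF \<phi>(1)] lin_scale[OF lin_id(2)])
  then show "\<exists>c. \<forall>x. \<phi> x = c *s x" by blast
qed

lemma killing_from_split_rational_form:
  fixes br :: "('k::field_char_0, 'n::finite) bracket"
  assumes "from_split_rational_form br B" "bilin br"
  obtains x where "killing br x x \<noteq> 0"
proof -
  obtain br0 :: "(rat, 'n) bracket" and \<phi> where br0: "split_simple_lie br0"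
    "lie_iso (ext_bilin of_rat br0) br \<phi>"
    using assms(1) unfolding from_split_rational_form_def by blast
  obtain h where h: "killing br0 h h \<noteq> 0" by (rule killing_split_rational[OF br0(1)])
  have e: "bilin_extends (of_rat :: rat \<Rightarrow> 'k) br0 (ext_bilin of_rat br0)"
    using br0(1) by (intro field_hom.bilin_extends_ext_bilin field_hom_of_rat lie_algebra_bilin)
      (auto simp: split_simple_lie_def simple_lie_def)
  have "killing br (\<phi> (vmap of_rat h)) (\<phi> (vmap of_rat h)) = of_rat (killing br0 h h)"
    by (simp add: killing_lie_iso[OF br0(2) bilin_extendsD(2)[OF e] assms(2)] killing_extends[OF field_hom_of_rat e])
  then show ?thesis using that h by (metis of_rat_eq_0_iff)
qed

section \<open>Contracting tensors with an invariant form\<close>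

text \<open>The tensor read as a bilinear form, with the space identified with its dual by
  \<open>B\<close>. Identities of tensors become identities of scalars.\<close>

definition eval2 :: "('a::field ^ 'n::finite \<Rightarrow> 'a ^ 'n \<Rightarrow> 'a) \<Rightarrow> 'a ^ ('n \<times> 'n) \<Rightarrow> 'a ^ 'n \<Rightarrow> 'a ^ 'n \<Rightarrow> 'a" where
  "eval2 B T x y = (\<Sum>i\<in>UNIV. \<Sum>j\<in>UNIV. T $ (i, j) * (B (basis_vec i) x * B (basis_vec j) y))"

definition eval3 ::
    "('a::field ^ 'n::finite \<Rightarrow> 'a ^ 'n \<Rightarrow> 'a) \<Rightarrow> 'a ^ ('n \<times> 'n \<times> 'n) \<Rightarrow> 'a ^ 'n \<Rightarrow> 'a ^ 'n \<Rightarrow> 'a ^ 'n \<Rightarrow> 'a" where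
  "eval3 B T x y z = (\<Sum>i\<in>UNIV. B (basis_vec i) x * eval2 B (\<chi> p. T $ (i, p)) y z)"

text \<open>The tensor read as an operator by contracting its first factor with \<open>x\<close>.
  For symmetric \<open>B\<close> the flipped tensor gives the adjoint operator.\<close>

definition rop :: "('a::field ^ 'n::finite \<Rightarrow> 'a ^ 'n \<Rightarrow> 'a) \<Rightarrow> 'a ^ ('n \<times> 'n) \<Rightarrow> 'a ^ 'n \<Rightarrow> 'a ^ 'n" where
  "rop B T x = (\<Sum>i\<in>UNIV. \<Sum>j\<in>UNIV. (T $ (i, j) * B (basis_vec i) x) *s basis_vec j)"

lemma eval2_linear:
  "eval2 B (S + T) x y = eval2 B S x y + eval2 B T x y"
  "eval2 B (S - T) x y = eval2 B S x y - eval2 B T x y"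
  "eval2 B (- T) x y = - eval2 B T x y"
  "eval2 B (c *s T) x y = c * eval2 B T x y"
  "eval2 B 0 x y = 0"
  by (simp_all add: eval2_def distrib_right left_diff_distrib sum.distrib sum_subtractf sum_negf sum_distrib_left mult.assoc)

lemma basis_vec_nth: "basis_vec j $ i = (if i = j then 1 else 0)"
  by (simp add: axis_def)

lemma linform_eval2: "linform (\<lambda>T. eval2 B T x y)"
  by (rule linformI) (simp_all add: eval2_linear)

lemma eval3_linear:
  "eval3 B (S + T) x y z = eval3 B S x y z + eval3 B T x y z"
  "eval3 B (c *s T) x y z = c * eval3 B T x y z"
  "eval3 B 0 x y z = 0"
proof -
  have e: "(\<chi> p. (S + T) $ (i, p)) = (\<chi> p. S $ (i, p)) + (\<chi> p. T $ (i, p))" 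
     "(\<chi> p. (c *s T) $ (i, p)) = c *s (\<chi> p. T $ (i, p))" "(\<chi> p. (0 :: 'a ^ ('b \<times> 'b \<times> 'b)) $ (i, p)) = 0" for i
    by (simp_all add: vec_eq_iff)
  show "eval3 B (S + T) x y z = eval3 B S x y z + eval3 B T x y z"
    by (simp only: eval3_def e eval2_linear distrib_left sum.distrib)
  show "eval3 B (c *s T) x y z = c * eval3 B T x y z"
    by (simp only: eval3_def e eval2_linear sum_distrib_left mult.left_commute)
  show "eval3 B 0 x y z = 0"
    by (simp only: eval3_def e eval2_linear mult_zero_right sum.neutral_const)
qed

lemma eval3_sum: "eval3 B (sum g A) x y z = (\<Sum>i\<in>A. eval3 B (g i) x y z)"
  by (induction A rule: infinite_finite_induct) (auto simp: eval3_linear)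

lemma linform_eval3: "linform (\<lambda>T. eval3 B T x y z)"
  by (rule linformI) (simp_all add: eval3_linear)

lemma linform_comp:
  assumes "linform \<phi>" "lin \<psi>"
  shows "linform (\<lambda>T. \<phi> (\<psi> T))"
proof -
  interpret l: Vector_Spaces.linear "(*s)" "(*)" \<phi> by fact
  show ?thesis
    by (rule linformI) (simp_all add: lin_add[OF assms(2)] lin_smult[OF assms(2)] l.add l.scale)
qed

lemma linform_eq_tensorI:
  fixes \<phi> \<psi> :: "'a::field ^ ('m::finite \<times> 'n::finite) \<Rightarrow> 'a"
  assumes "linform \<phi>" "linform \<psi>"
    and "\<And>a b. \<phi> (tensor a b) = \<psi> (tensor a b)"
  shows "\<phi> T = \<psi> T"
  by (rule linform_eqI[OF assms(1,2)]) (metis assms(3) surj_pair tensor_basis)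

lemma linform_eq_tensor3I:
  fixes \<phi> \<psi> :: "'a::field ^ ('m::finite \<times> 'n::finite \<times> 'p::finite) \<Rightarrow> 'a"
  assumes "linform \<phi>" "linform \<psi>"
    and "\<And>a b c. \<phi> (tensor a (tensor b c)) = \<psi> (tensor a (tensor b c))"
  shows "\<phi> T = \<psi> T"
  by (rule linform_eqI[OF assms(1,2)]) (metis assms(3) surj_pair tensor_basis)

context
  fixes B :: "'a::field ^ 'n::finite \<Rightarrow> 'a ^ 'n \<Rightarrow> 'a"
  assumes bf: "bform B"
begin

lemma form_left_expand: "B a x = (\<Sum>i\<in>UNIV. a $ i * B (basis_vec i) x)"
  by (subst (1) basis_expansion[of a, symmetric]) (simp add: bformD(3,11)[OF bf])

lemma eval2_tensor: "eval2 B (tensor a b) x y = B a x * B b y"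
  by (simp add: eval2_def tensor_nth form_left_expand[of a] form_left_expand[of b] sum_product mult_ac)

lemma eval3_tensor: "eval3 B (tensor a S) x y z = B a x * eval2 B S y z"
proof -
  have "(\<chi> p. tensor a S $ (i, p)) = a $ i *s S" for i
    by (simp add: vec_eq_iff tensor_nth)
  then show ?thesis
    by (simp add: eval3_def eval2_linear form_left_expand[of a] sum_distrib_left sum_distrib_right mult_ac)
qed

lemma bform_eval2: "bform (eval2 B T)"
  by (rule bformI) (simp_all add: eval2_def bformD[OF bf] algebra_simps sum.distrib sum_distrib_left)

lemma eval2_flip: "eval2 B (flip T) x y = eval2 B T y x"
  by (rule linform_eq_tensorI[OF linform_comp[OF linform_eval2 lin_flip] linform_eval2])
    (simp add: flip_tensor eval2_tensor mult.commute)

lemma eval3_cycle3: "eval3 B (cycle3 T) x y z = eval3 B T y z x"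
  by (rule linform_eq_tensor3I[OF linform_comp[OF linform_eval3 lin_cycle3] linform_eval3])
    (simp add: cycle3_tensor eval3_tensor eval2_tensor mult_ac)

lemma form_rop: "B (rop B T x) y = eval2 B T x y"
  by (simp add: rop_def eval2_def bformD[OF bf] mult.assoc)

lemma rop_flip: "rop B (flip T) x = (\<Sum>i\<in>UNIV. \<Sum>j\<in>UNIV. (T $ (i, j) * B (basis_vec j) x) *s basis_vec i)"
  unfolding rop_def flip_def by (subst sum.swap) simp

lemma lin_rop: "lin (rop B T)"
  by (rule linI)
    (simp_all add: rop_def bformD[OF bf] algebra_simps sum.distrib vec.scale_sum_right vec.scale_left_distrib)

end

context
  fixes br :: "('a::field, 'n::finite) bracket" and B :: "'a ^ 'n \<Rightarrow> 'a ^ 'n \<Rightarrow> 'a"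
  assumes L: "lie_algebra br" and IV: "invariant_form br B"
begin

lemmas iv_bf = invariant_formD(1)[OF IV]
lemmas br_simps = bilin_simps[OF lie_algebra_bilin[OF L]]

lemma coordinate_vectors:
  obtains d where "\<And>i j. B (basis_vec j) (d i) = (if i = j then 1 else 0)"
proof -
  have "\<exists>d. \<forall>y. B d y = y $ i" for i
  proof -
    have "linform (\<lambda>y. y $ i)" by (rule linformI) simp_all
    from represent_functional[OF IV this] show ?thesis by metis
  qed
  then obtain d where d: "\<And>i y. B (d i) y = y $ i" by metis
  have "B (basis_vec j) (d i) = (if i = j then 1 else 0)" for i j
    unfolding invariant_formD(2)[OF IV, of "basis_vec j"] d by (simp add: axis_def)
  then show ?thesis by (rule that)
qed

text \<open>Evaluation at the \<open>B\<close>-dual basis reads off the coefficients.\<close>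

lemma eval2_zeroD:
  assumes "\<And>x y. eval2 B T x y = 0"
  shows "T = 0"
proof -
  obtain d where d: "\<And>i j. B (basis_vec j) (d i) = (if i = j then 1 else 0)"
    by (rule coordinate_vectors) blast
  have delta: "(if P then 1 else (0::'a)) * (if Q then 1 else 0) = (if P then if Q then 1 else 0 else 0)" for P Q by simp
  have "eval2 B T (d i) (d j) = T $ (i, j)" for i j
    by (simp add: eval2_def d delta if_distrib[of "\<lambda>x. _ * x"] sum.delta cong: if_cong)
  then show ?thesis using assms by (simp add: vec_eq_iff)
qed

lemma eval3_zeroD:
  assumes "\<And>x y z. eval3 B T x y z = 0"
  shows "T = 0"
proof -
  obtain d where d: "\<And>i j. B (basis_vec j) (d i) = (if i = j then 1 else 0)"
    by (rule coordinate_vectors) blast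
  have "eval3 B T (d i) y z = eval2 B (\<chi> p. T $ (i, p)) y z" for i y z
    by (simp add: eval3_def d if_distrib[of "\<lambda>x. x * _"] sum.delta cong: if_cong)
  then have "(\<chi> p. T $ (i, p)) = 0" for i
    using assms by (intro eval2_zeroD) simp
  then show ?thesis by (simp add: vec_eq_iff)
qed

lemma eval2_eqI:
  assumes "\<And>x y. eval2 B S x y = eval2 B T x y"
  shows "S = T"
  using eval2_zeroD[of "S - T"] assms by (simp add: eval2_linear)

text \<open>Pairing with the dual basis vectors gives the coordinates of \<open>y\<close>, so the
  sum reassembles \<open>B x y\<close>. Invariance of the Casimir tensor then reduces to that of the
  form.\<close>

lemma eval2_casimir: "eval2 B (casimir B) x y = B x y"
proof -
  have db: "B (dual_basis_vec B i) y = y $ i" for i y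
  proof -
    have "\<exists>!d. \<forall>j. B d (basis_vec j) = (if i = j then 1 else 0)"
    proof -
      have lin: "linform (\<lambda>y. y $ i)" by (rule linformI) simp_all
      obtain d where d: "\<And>y. B d y = y $ i" by (rule represent_functional[OF IV lin]) blast
      show ?thesis
      proof (rule ex1I[of _ d])
        show "\<forall>j. B d (basis_vec j) = (if i = j then 1 else 0)" by (simp add: d axis_def)
        fix d' assume d': "\<forall>j. B d' (basis_vec j) = (if i = j then 1 else 0)"
        have "B d' z = B d z" for z
        proof (rule linform_eqI)
          show "B d' (basis_vec j) = B d (basis_vec j)" for j
            using d' by (auto simp: d basis_vec_nth)
        qed (use iv_bf in \<open>auto simp: bform_def\<close>)
        then show "d' = d" by (rule nondegenerate_eqI[OF IV])
      qed
    qed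
    from theI'[OF this] have "\<forall>j. B (dual_basis_vec B i) (basis_vec j) = (if i = j then 1 else 0)"
      unfolding dual_basis_vec_def .
    then have 1: "B (dual_basis_vec B i) (basis_vec j) = basis_vec j $ i" for j
      by (auto simp: basis_vec_nth)
    show ?thesis
    proof (rule linform_eqI)
      show "B (dual_basis_vec B i) (basis_vec j) = basis_vec j $ i" for j by (rule 1)
      show "linform (\<lambda>y. y $ i)" by (rule linformI) simp_all
    qed (use iv_bf in \<open>auto simp: bform_def\<close>)
  qed
  interpret e: Vector_Spaces.linear "(*s)" "(*)" "\<lambda>T. eval2 B T x y" by (rule linform_eval2)
  have "eval2 B (casimir B) x y = (\<Sum>i\<in>UNIV. B (basis_vec i) x * y $ i)"
    by (simp add: casimir_def e.sum eval2_tensor[OF iv_bf] db)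
  also have "\<dots> = (\<Sum>i\<in>UNIV. y $ i * B (basis_vec i) x)"
    by (simp add: mult.commute)
  also have "\<dots> = B x y"
    using form_left_expand[OF iv_bf, of y x] invariant_formD(2)[OF IV] by metis
  finally show ?thesis .
qed

lemma eval2_ad2: "eval2 B (ad2 br a T) x y = - eval2 B T (br a x) y - eval2 B T x (br a y)"
proof -
  have lin: "linform (\<lambda>T. - eval2 B T (br a x) y - eval2 B T x (br a y))"
    by (rule linformI) (simp_all add: eval2_linear algebra_simps)
  show ?thesis
    by (rule linform_eq_tensorI[OF linform_comp[OF linform_eval2 lin_ad2] lin])
      (simp add: ad2_tensor lie_algebra_bilin[OF L] eval2_linear eval2_tensor[OF iv_bf] invariant_form_ad[OF L IV])
qed

lemma form_cyclic: "B (br x y) z = B (br y z) x" "B (br x y) z = B (br z x) y"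
proof -
  show 1: "B (br x y) z = B (br y z) x" for x y z
    using invariant_formD(2,4)[OF IV] by metis
  show "B (br x y) z = B (br z x) y" by (metis 1)
qed

text \<open>The bracket on \<open>\<gg> \<cong> \<gg>\<^sup>*\<close> dual to the coboundary of \<open>r\<close>.\<close>

definition dual_bracket :: "'a ^ ('n \<times> 'n) \<Rightarrow> 'a ^ 'n \<Rightarrow> 'a ^ 'n \<Rightarrow> 'a ^ 'n" where
  "dual_bracket r x y = br (rop B r x) y - br x (rop B (flip r) y)"

lemma eval2_coboundary: "eval2 B (coboundary br r a) x y = B a (dual_bracket r x y)"
proof -
  have "B a (br (rop B r x) y) = - B (rop B r x) (br a y)"
    using invariant_formD(2)[OF IV] form_cyclic(2)[of a] by (metis invariant_form_ad[OF L IV] form_cyclic(1))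
  moreover have "B a (br x (rop B (flip r) y)) = B (rop B (flip r) y) (br a x)"
    using invariant_formD(2,4)[OF IV] by metis
  ultimately show ?thesis
    by (simp add: coboundary_def eval2_ad2 dual_bracket_def bformD[OF iv_bf] form_rop[OF iv_bf] eval2_flip[OF iv_bf])
qed

lemma lin_coboundary: "lin (coboundary br r)"
  unfolding coboundary_def[abs_def] by (rule bilin_lin(2)[OF bilin_ad2[OF lie_algebra_bilin[OF L]]])

text \<open>This turns the co-Jacobi identity into the Jacobi identity of the dual bracket.\<close>

lemma eval3_iterated_coboundary:
  "eval3 B (tensor_map id (coboundary br r) (coboundary br r a)) x y z =
     B a (dual_bracket r x (dual_bracket r y z))"
proof -
  have "eval3 B (tensor_map id (coboundary br r) T) x y z = eval2 B T x (dual_bracket r y z)" for T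
    by (rule linform_eq_tensorI[OF linform_comp[OF linform_eval3 lin_tensor_map] linform_eval2])
      (simp add: tensor_map_tensor lin_id lin_coboundary eval3_tensor[OF iv_bf] eval2_tensor[OF iv_bf] eval2_coboundary)
  then show ?thesis by (simp add: eval2_coboundary)
qed

lemma form_br_sum:
  "B (br (\<Sum>i\<in>UNIV. \<Sum>j\<in>UNIV. p i j *s v i j) (\<Sum>k\<in>UNIV. \<Sum>l\<in>UNIV. q k l *s w k l)) x =
    (\<Sum>i\<in>UNIV. \<Sum>j\<in>UNIV. \<Sum>k\<in>UNIV. \<Sum>l\<in>UNIV. p i j * q k l * B (br (v i j) (w k l)) x)"
  for p :: "'n \<Rightarrow> 'n \<Rightarrow> 'a" and q :: "'n \<Rightarrow> 'n \<Rightarrow> 'a"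
proof -
  have 1: "B (br (\<Sum>i\<in>UNIV. \<Sum>j\<in>UNIV. p i j *s v i j) y) x = (\<Sum>i\<in>UNIV. \<Sum>j\<in>UNIV. p i j * B (br (v i j) y) x)" for y
    by (simp add: br_simps bformD[OF iv_bf])
  have 2: "B (br y (\<Sum>k\<in>UNIV. \<Sum>l\<in>UNIV. q k l *s w k l)) x = (\<Sum>k\<in>UNIV. \<Sum>l\<in>UNIV. q k l * B (br y (w k l)) x)" for y
    by (simp add: br_simps bformD[OF iv_bf])
  show ?thesis unfolding 1 unfolding 2 by (simp only: sum_distrib_left mult.assoc)
qed

text \<open>Each commutator brackets the factor shared by its two copies of \<open>r\<close>. The
  remaining legs are contracted and leave operators: \<open>rop B r\<close> when the first leg is
  contracted, the flipped one when the second is.\<close>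

lemma eval3_CYB:
  "eval3 B (CYB br r) x y z =
     B (br (rop B (flip r) y) (rop B (flip r) z)) x + B (br (rop B r x) (rop B (flip r) z)) y +
     B (br (rop B r x) (rop B r y)) z"
  unfolding rop_flip[OF iv_bf] unfolding rop_def form_br_sum CYB_def eval3_sum
  by (simp add: eval3_linear eval3_tensor[OF iv_bf] eval2_tensor[OF iv_bf] sum.distrib[symmetric] algebra_simps)

section \<open>Consequences of the Yang-Baxter equation\<close>

context
  fixes r :: "'a ^ ('n \<times> 'n)" and c :: 'a
  assumes cyb: "CYB br r = 0" and sym: "r + flip r = c *s casimir B"
begin

text \<open>The Casimir tensor acts as the identity operator.\<close>

lemma rop_sum: "rop B r x + rop B (flip r) x = c *s x"
proof (rule nondegenerate_eqI[OF IV])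
  fix z
  have "B (rop B r x + rop B (flip r) x) z = eval2 B (r + flip r) x z"
    by (simp add: bformD[OF iv_bf] form_rop[OF iv_bf] eval2_linear)
  then show "B (rop B r x + rop B (flip r) x) z = B (c *s x) z"
    by (simp add: sym eval2_linear eval2_casimir bformD[OF iv_bf])
qed

text \<open>The Yang-Baxter equation in operator form: moving \<open>rop B r\<close> to its adjoint
  on \<open>z\<close> produces two of the three terms of \<open>eval3_CYB\<close>, and the vanishing
  of the sum gives the third.\<close>

lemma rop_dual_bracket: "rop B r (dual_bracket r x y) = br (rop B r x) (rop B r y)"
proof (rule nondegenerate_eqI[OF IV])
  fix z
  let ?R = "rop B r" and ?R' = "rop B (flip r)"
  have "B (?R (dual_bracket r x y)) z = eval2 B (flip r) z (dual_bracket r x y)"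
    by (simp add: form_rop[OF iv_bf] eval2_flip[OF iv_bf])
  also have "\<dots> = B (?R' z) (dual_bracket r x y)" by (simp add: form_rop[OF iv_bf])
  also have "\<dots> = B (?R' z) (br (?R x) y) - B (?R' z) (br x (?R' y))"
    by (simp add: dual_bracket_def bformD[OF iv_bf])
  also have "B (?R' z) (br (?R x) y) = - B (br (?R x) (?R' z)) y"
    by (simp only: invariant_formD(2)[OF IV, of "?R' z"] form_cyclic(2)[of "?R x" y "?R' z"]
        lie_anti[OF L, of "?R' z"] bformD(5)[OF iv_bf])
  also have "B (?R' z) (br x (?R' y)) = B (br (?R' y) (?R' z)) x"
    using invariant_formD(2)[OF IV] form_cyclic by metis
  also have "- B (br (?R x) (?R' z)) y - B (br (?R' y) (?R' z)) x = B (br (?R x) (?R y)) z"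
    using eval3_CYB[of r x y z] by (simp add: cyb eval3_linear add_eq_0_iff)
  finally show "B (?R (dual_bracket r x y)) z = B (br (?R x) (?R y)) z" .
qed

lemma dual_bracket_alt:
  "dual_bracket r x y = br (rop B r x) y + br x (rop B r y) - c *s br x y"
proof -
  have "rop B (flip r) y = c *s y - rop B r y" using rop_sum[of y] by (simp add: algebra_simps)
  then show ?thesis by (simp add: dual_bracket_def br_simps)
qed

text \<open>\<open>rop_dual_bracket\<close> resolves the nested operator to \<open>br V W\<close>;
  the cyclic sum then regroups into Jacobi expressions of the original bracket in mixed
  arguments.\<close>

lemma dual_bracket_jacobi:
  "dual_bracket r x (dual_bracket r y z) + dual_bracket r y (dual_bracket r z x) +
    dual_bracket r z (dual_bracket r x y) = 0"
proof -
  define U where "U = rop B r x"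
  define V where "V = rop B r y"
  define W where "W = rop B r z"
  define J where "J p q s = br p (br q s) + br q (br s p) + br s (br p q)" for p q s
  have J: "J p q s = 0" for p q s unfolding J_def by (rule lie_jacobi[OF L])
  have e: "dual_bracket r x (dual_bracket r y z) =
      br U (br V z) + br U (br y W) - c *s br U (br y z) + br x (br V W)
      - c *s br x (br V z) - c *s br x (br y W) + (c * c) *s br x (br y z)"
    if "U = rop B r x" "V = rop B r y" "W = rop B r z" for x y z U V W
    unfolding dual_bracket_alt[of x] rop_dual_bracket that[symmetric]
    unfolding dual_bracket_alt[of y z]
    by (simp add: br_simps that[symmetric] vec.scale_right_distrib vec.scale_right_diff_distrib)
  note defs = U_def V_def W_def
  have "dual_bracket r x (dual_bracket r y z) + dual_bracket r y (dual_bracket r z x) +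
      dual_bracket r z (dual_bracket r x y) =
      J U V z + J U y W + J x V W - c *s (J U y z + J x V z + J x y W) + (c * c) *s J x y z"
    unfolding e[OF defs] e[OF defs(2,3,1)] e[OF defs(3,1,2)] J_def
    by (simp add: vec.scale_right_distrib)
  then show ?thesis by (simp add: J)
qed

lemma dual_bracket_anti: "dual_bracket r x y = - dual_bracket r y x"
  unfolding dual_bracket_alt lie_anti[OF L, of y] lie_anti[OF L, of _ x]
  by (simp add: lie_anti[OF L, of x] vec_eq_iff)

lemma coboundary_lie_bialgebra: "lie_bialgebra br (coboundary br r)"
  unfolding lie_bialgebra_def Let_def
proof (intro conjI allI L lin_coboundary)
  fix a b
  show "flip (coboundary br r a) = - coboundary br r a"
  proof (rule eval2_eqI)
    show "eval2 B (flip (coboundary br r a)) x y = eval2 B (- coboundary br r a) x y" for x y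
      using dual_bracket_anti[of x y]
      by (simp add: eval2_flip[OF iv_bf] eval2_linear eval2_coboundary bformD[OF iv_bf])
  qed
  let ?T = "tensor_map id (coboundary br r) (coboundary br r a)"
  show "?T + cycle3 ?T + cycle3 (cycle3 ?T) = 0"
  proof (rule eval3_zeroD)
    fix x y z
    have "eval3 B (?T + cycle3 ?T + cycle3 (cycle3 ?T)) x y z =
        B a (dual_bracket r x (dual_bracket r y z) + dual_bracket r y (dual_bracket r z x) + dual_bracket r z (dual_bracket r x y))"
      by (simp add: eval3_linear eval3_cycle3[OF iv_bf] eval3_iterated_coboundary bformD(2)[OF iv_bf])
    then show "eval3 B (?T + cycle3 ?T + cycle3 (cycle3 ?T)) x y z = 0"
      by (simp add: dual_bracket_jacobi bformD[OF iv_bf])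
  qed
  \<comment> \<open>\<open>ad2\<close> is a representation on tensors, so a coboundary satisfies the
    cocycle condition.\<close>
  have "(\<lambda>T. ad2 br (br a b) T) = (\<lambda>T. ad2 br a (ad2 br b T) - ad2 br b (ad2 br a T))"
    by (rule lin_eq_tensorI[OF lin_ad2 lin_minus[OF lin_comp[OF lin_ad2 lin_ad2] lin_comp[OF lin_ad2 lin_ad2]]])
      (simp add: ad2_tensor lie_algebra_bilin[OF L] lin_add[OF lin_ad2] lie_leibniz[OF L] bilin_simps[OF bilin_tensor])
  then show "coboundary br r (br a b) = ad2 br a (coboundary br r b) - ad2 br b (coboundary br r a)"
    unfolding coboundary_def by metis
qed

lemma modified_CYBE:
  fixes D
  defines "D \<equiv> (\<lambda>x. rop B r x - rop B (flip r) x)"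
  shows "br (D x) (D y) + (c * c) *s br x y = D (br (D x) y + br x (D y))"
proof -
  let ?R = "rop B r" and ?W = "br (D x) y + br x (D y)"
  \<comment> \<open>\<open>D\<close> is twice the operator minus \<open>c\<close>; doubled
    quantities avoid division by 2. The homomorphism property taken four times gives the claim once
    the terms linear in \<open>c\<close> cancel.\<close>
  have R2: "?R x + ?R x = D x + c *s x" for x
    unfolding D_def rop_sum[symmetric] by simp
  let ?d = "dual_bracket r x y"
  have "?d + ?d = br (?R x + ?R x) y + br x (?R y + ?R y) - (c *s br x y + c *s br x y)"
    unfolding dual_bracket_alt by (simp only: br_simps) simp
  also have "\<dots> = ?W"
    unfolding R2 by (simp only: br_simps) simp
  finally have d2: "?d + ?d = ?W" .
  have "br (?R x + ?R x) (?R y + ?R y) = ?R (?d + ?d) + ?R (?d + ?d)"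
    by (simp only: br_simps lin_add[OF lin_rop[OF iv_bf]] rop_dual_bracket)
  then have "br (D x + c *s x) (D y + c *s y) = D ?W + c *s ?W"
    unfolding R2 d2 .
  then show ?thesis
    by (simp add: br_simps vec.scale_right_distrib algebra_simps)
qed

end

end

section \<open>Twisting an r-matrix by automorphisms\<close>

lemma ad2_flip:
  assumes "bilin br"
  shows "ad2 br a (flip T) = flip (ad2 br a T)"
  by (simp add: ad2_def lin_add[OF lin_flip] flip_tensor_map bilin_lin[OF assms] lin_id add.commute)

text \<open>An invariant tensor is an invariant form, hence a multiple of the symmetric
  \<open>B\<close>; a skew multiple of it is zero in characteristic zero.\<close>

lemma invariant_skew_zero:
  fixes br :: "('a::field_char_0, 'n::finite) bracket"
  assumes "lie_algebra br" "invariant_form br B" "centroid_trivial br"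
    and T: "flip T = - T" "\<And>a. ad2 br a T = 0"
  shows "T = 0"
proof (rule eval2_zeroD[OF assms(1,2)])
  note bf = invariant_formD(1)[OF assms(2)]
  have inv: "eval2 B T (br a x) y = - eval2 B T x (br a y)" for a x y
    using eval2_ad2[OF assms(1,2), of a T x y] by (simp add: T eval2_linear algebra_simps)
  obtain k where k: "\<And>x y. eval2 B T x y = k * B x y"
    using invariant_bform_unique[where C = "eval2 B T", OF assms(1-3) bform_eval2[OF bf] inv] by blast
  fix x y
  have "eval2 B T y x = - eval2 B T x y"
    using eval2_flip[OF bf, of T x y] by (simp add: T eval2_linear)
  then show "eval2 B T x y = 0"
    using invariant_formD(2)[OF assms(2), of x y] by (simp add: k)
qed

lemma eval2_tensor_map:
  assumes "bform B" "lin u" "\<And>x y. B (u x) (u y) = B x y"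
  shows "eval2 B (tensor_map u u T) (u x) (u y) = eval2 B T x y"
  by (rule linform_eq_tensorI[OF linform_comp[OF linform_eval2 lin_tensor_map] linform_eval2])
    (simp add: tensor_map_tensor eval2_tensor assms)

lemma half_sum_eq:
  fixes a b p q :: "'a::field_char_0 ^ 'n"
  assumes "a + b = p + q" "a - b = p - q"
  shows "a = p"
proof -
  have "a $ i = p $ i" for i
  proof -
    have "2 * a $ i = (a + b) $ i + (a - b) $ i" by simp
    also have "\<dots> = 2 * p $ i" unfolding assms by simp
    finally show ?thesis by simp
  qed
  then show ?thesis by (simp add: vec_eq_iff)
qed

section \<open>Automorphisms acting on r and on its coboundary\<close>

context
  fixes br :: "('a::field_char_0, 'n::finite) bracket" and B r c p q
  assumes L: "lie_algebra br" and IV: "invariant_form br B" and Z: "centroid_trivial br"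
    and kil: "killing br p q \<noteq> 0"
    and cyb: "CYB br r = 0" and sym: "r + flip r = c *s casimir B"
begin

lemma casimir_automorphism:
  assumes "lie_iso br br u"
  shows "tensor_map u u (casimir B) = casimir B"
proof (rule eval2_eqI[OF L IV])
  fix x y
  have u: "lin u" "surj u" using assms by (auto simp: lie_iso_def bij_is_surj)
  note pres = automorphism_preserves_form[OF L IV Z kil assms]
  obtain x' y' where "x = u x'" "y = u y'" using u(2) by (metis surjD)
  then show "eval2 B (tensor_map u u (casimir B)) x y = eval2 B (casimir B) x y"
    by (simp add: eval2_tensor_map[OF invariant_formD(1)[OF IV] u(1) pres] eval2_casimir[OF L IV] pres)
qed

lemma ad2_casimir: "ad2 br a (casimir B) = 0"
proof (rule eval2_zeroD[OF L IV])
  show "eval2 B (ad2 br a (casimir B)) x y = 0" for x y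
    by (simp add: eval2_ad2[OF L IV] eval2_casimir[OF L IV] invariant_form_ad[OF L IV])
qed

text \<open>The symmetric part of \<open>r\<close> is a multiple of the invariant Casimir tensor and
  contributes nothing to the coboundary.\<close>

lemma coboundary_flip: "coboundary br (flip r) x = - coboundary br r x"
proof -
  have "coboundary br r x + coboundary br (flip r) x = ad2 br x (c *s casimir B)"
    by (simp add: coboundary_def sym flip: lin_add[OF lin_ad2])
  then show ?thesis
    by (simp add: lin_smult[OF lin_ad2] ad2_casimir add_eq_0_iff)
qed

lemma twist_sum:
  assumes "lie_iso br br u"
  shows "tensor_map u u r + tensor_map u u (flip r) = r + flip r"
  by (simp add: sym lin_smult[OF lin_tensor_map] casimir_automorphism[OF assms] flip: lin_add[OF lin_tensor_map])

lemma tensor_map_coboundary: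
  assumes "lie_iso br br u"
  shows "tensor_map u u (coboundary br r x) = ad2 br (u x) (tensor_map u u r)"
  unfolding coboundary_def using ad2_iso[OF assms lie_algebra_bilin lie_algebra_bilin, OF L L] by metis

text \<open>\<open>W\<close>, the failure of \<open>u\<close> to scale \<open>r\<close> by
  \<open>t\<close>, is annihilated by the adjoint action. It need not vanish, but its skew part is
  an invariant skew tensor and does.\<close>

lemma twist_skew:
  assumes u: "lie_iso br br u"
    and tw: "\<And>x. tensor_map u u (coboundary br r x) = t *s coboundary br r (u x)"
  shows "tensor_map u u r - tensor_map u u (flip r) = t *s (r - flip r)"
proof -
  have lu: "lin u" "surj u" using u by (auto simp: lie_iso_def bij_is_surj)
  define W where "W = tensor_map u u r - t *s r"
  have inv: "ad2 br y W = 0" for y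
  proof -
    obtain x where "y = u x" using lu(2) by (metis surjD)
    then show ?thesis
      using tw[of x] unfolding tensor_map_coboundary[OF u]
      by (simp add: W_def lin_diff[OF lin_ad2] lin_smult[OF lin_ad2] coboundary_def)
  qed
  have "W - flip W = 0"
  proof (rule invariant_skew_zero[OF L IV Z])
    show "flip (W - flip W) = - (W - flip W)" by (simp add: lin_diff[OF lin_flip] flip_flip)
    show "ad2 br a (W - flip W) = 0" for a
      by (simp add: lin_diff[OF lin_ad2] ad2_flip lie_algebra_bilin[OF L] inv lin_zero[OF lin_flip])
  qed
  then show ?thesis
    by (simp add: W_def lin_diff[OF lin_flip] lin_smult[OF lin_flip] flip_tensor_map lu vec.scale_right_diff_distrib
       algebra_simps)
qed

text \<open>\<open>twist_sum\<close> controls the symmetric part and \<open>twist_skew\<close> with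
  \<open>t = 1\<close> the skew part; together they determine the image of \<open>r\<close>.\<close>

lemma twist_fixed_iff:
  assumes u: "lie_iso br br u"
  shows "(\<forall>x. tensor_map u u (coboundary br r x) = coboundary br r (u x)) \<longleftrightarrow> tensor_map u u r = r"
proof
  assume "\<forall>x. tensor_map u u (coboundary br r x) = coboundary br r (u x)"
  then have "tensor_map u u r - tensor_map u u (flip r) = r - flip r"
    using twist_skew[OF u, of 1] by simp
  with twist_sum[OF u] show "tensor_map u u r = r" by (rule half_sum_eq)
next
  assume "tensor_map u u r = r"
  then show "\<forall>x. tensor_map u u (coboundary br r x) = coboundary br r (u x)"
    unfolding tensor_map_coboundary[OF u] by (simp add: coboundary_def)
qed

lemma twist_flip_iff:
  assumes u: "lie_iso br br u"
  shows "(\<forall>x. tensor_map u u (coboundary br r x) = - coboundary br r (u x)) \<longleftrightarrow> tensor_map u u r = flip r"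
proof
  assume "\<forall>x. tensor_map u u (coboundary br r x) = - coboundary br r (u x)"
  then have "tensor_map u u r - tensor_map u u (flip r) = flip r - r"
    using twist_skew[OF u, of "-1"] by simp
  moreover have "tensor_map u u r + tensor_map u u (flip r) = flip r + r"
    using twist_sum[OF u] by (simp add: add.commute)
  ultimately show "tensor_map u u r = flip r" by (rule half_sum_eq[rotated])
next
  assume "tensor_map u u r = flip r"
  then show "\<forall>x. tensor_map u u (coboundary br r x) = - coboundary br r (u x)"
    unfolding tensor_map_coboundary[OF u] by (simp add: coboundary_flip flip: coboundary_def)
qed

lemma twist_square:
  assumes u: "lie_iso br br u" and "c \<noteq> 0"
    and tw: "\<And>x. tensor_map u u (coboundary br r x) = t *s coboundary br r (u x)"
  shows "t * t = 1"
proof -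
  note bf = invariant_formD(1)[OF IV]
  have lu: "lin u" "surj u" "inj u" and hom: "\<And>x y. u (br x y) = br (u x) (u y)"
    using u by (auto simp: lie_iso_def bij_is_surj bij_is_inj)
  note pres = automorphism_preserves_form[OF L IV Z kil u]
  define D where "D x = rop B r x - rop B (flip r) x" for x
  have lD: "lin D" unfolding D_def by (intro lin_minus lin_rop[OF bf])
  have BD: "B (D x) y = eval2 B (r - flip r) x y" for x y
    by (simp add: D_def bformD[OF bf] form_rop[OF bf] eval2_linear)
  \<comment> \<open>\<open>D\<close> is the operator of the skew part, which \<open>u\<close> scales
    by \<open>t\<close> while preserving \<open>B\<close>.\<close>
  have uD: "u (D x) = t *s D (u x)" for x
  proof (rule nondegenerate_eqI[OF IV])
    fix z
    obtain y where y: "z = u y" using lu(2) by (metis surjD)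
    have "B (u (D x)) z = eval2 B (tensor_map u u (r - flip r)) (u x) (u y)"
      by (simp add: y pres BD eval2_tensor_map[OF bf lu(1) pres])
    also have "\<dots> = t * eval2 B (r - flip r) (u x) z"
      using twist_skew[OF u tw] by (simp add: lin_diff[OF lin_tensor_map] eval2_linear y right_diff_distrib)
    finally show "B (u (D x)) z = B (t *s D (u x)) z"
      by (simp add: bformD[OF bf] BD)
  qed
  have M: "br (D x) (D y) + (c * c) *s br x y = D (br (D x) y + br x (D y))" for x y
    unfolding D_def by (rule modified_CYBE[OF L IV cyb sym])
  \<comment> \<open>An abelian algebra would have zero Killing form.\<close>
  obtain x y where xy: "br x y \<noteq> 0"
  proof (rule ccontr)
    assume "\<not> thesis"
    then have "br x y = 0" for x y using that by blast
    then have "killing br p q = 0"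
      by (simp add: killing_def matrix_def trace_def matrix_matrix_mult_def)
    then show False using kil by simp
  qed
  \<comment> \<open>Apply \<open>u\<close> to the modified equation at \<open>x\<close>,
    \<open>y\<close> and compare with \<open>t * t\<close> times the equation at \<open>u x\<close>,
    \<open>u y\<close>: only the term with \<open>c * c\<close> differs.\<close>
  have "u (br (D x) (D y) + (c * c) *s br x y) = u (D (br (D x) y + br x (D y)))"
    by (simp only: M)
  then have "(t * t) *s br (D (u x)) (D (u y)) + (c * c) *s br (u x) (u y) =
      (t * t) *s D (br (D (u x)) (u y) + br (u x) (D (u y)))"
    by (simp add: lin_add[OF lu(1)] lin_smult[OF lu(1)] hom uD bilin_simps[OF lie_algebra_bilin[OF L]]
      lin_add[OF lD] lin_smult[OF lD] vec.scale_right_distrib)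
  also have "\<dots> = (t * t) *s br (D (u x)) (D (u y)) + (t * t) *s ((c * c) *s br (u x) (u y))"
    unfolding M[symmetric] by (simp only: vec.scale_right_distrib)
  finally have "(c * c) *s br (u x) (u y) = (t * t) *s ((c * c) *s br (u x) (u y))"
    by (simp only: add_left_cancel)
  then have "((t * t - 1) * (c * c)) *s br (u x) (u y) = 0"
    by (simp add: left_diff_distrib vec.scale_left_diff_distrib)
  moreover have "br (u x) (u y) \<noteq> 0"
    using xy lu(3) lin_zero[OF lu(1)] by (metis hom injD)
  ultimately show ?thesis using \<open>c \<noteq> 0\<close> by simp
qed

end

section \<open>Extending the r-matrix to the algebraic closure\<close>

lemma CYB_vmap:
  assumes "field_hom f" "bilin_extends f br br'"
  shows "CYB br' (vmap f r) = vmap f (CYB br r)"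
proof -
  interpret field_hom f by fact
  have e: "br' (basis_vec i) (basis_vec j) = vmap f (br (basis_vec i) (basis_vec j))" for i j
    using bilin_extendsD(3)[OF assms(2), of "basis_vec i" "basis_vec j"] by (simp add: vmap_basis)
  show ?thesis
    by (simp add: CYB_def vmap_sum vmap_smult vmap_add vmap_tensor vmap_basis e hom_mult)
qed

lemma eval2_vmap:
  assumes "field_hom f" "bform B"
  shows "eval2 (ext_form f B) (vmap f T) (vmap f x) (vmap f y) = f (eval2 B T x y)"
proof -
  interpret field_hom f by fact
  have "ext_form f B (basis_vec i) (vmap f x) = f (B (basis_vec i) x)" for i x
    using ext_form_vmap[OF assms, of "basis_vec i" x] by (simp add: vmap_basis)
  then show ?thesis by (simp add: eval2_def hom_sum hom_mult)
qed

text \<open>Both tensors contract to the extended form, which determines them.\<close>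

lemma casimir_vmap:
  assumes "field_hom f" "lie_algebra br" "invariant_form br B" "lie_algebra br'" "invariant_form br' (ext_form f B)"
  shows "casimir (ext_form f B) = vmap f (casimir B)"
proof (rule eval2_eqI[OF assms(4,5)])
  fix x y
  note bf = invariant_formD(1)[OF assms(3)]
  have "ext_form f B x y = eval2 (ext_form f B) (vmap f (casimir B)) x y"
    by (rule bform_eq_vmapI[OF assms(1) bform_ext_form bform_eval2[OF bform_ext_form]])
      (simp add: eval2_vmap assms(1) bf ext_form_vmap eval2_casimir[OF assms(2,3)])
  then show "eval2 (ext_form f B) (casimir (ext_form f B)) x y = eval2 (ext_form f B) (vmap f (casimir B)) x y"
    by (simp add: eval2_casimir[OF assms(4,5)])
qed

lemma coboundary_extends:
  assumes "field_hom f" "bilin_extends f br br'"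
  shows "lin_extends f (coboundary br r) (coboundary br' (vmap f r))"
  using bilin_lin(2)[OF bilin_ad2[OF bilin_extendsD(1)[OF assms(2)]]]
    bilin_lin(2)[OF bilin_ad2[OF bilin_extendsD(2)[OF assms(2)]]]
    field_hom.ad2_vmap[OF assms]
  by (simp add: lin_extends_def coboundary_def[abs_def])

lemma abs_gal_fixing_adjoin:
  "\<gamma> \<in> gal (adjoin \<alpha>) \<longleftrightarrow> \<gamma> \<in> abs_gal \<and> \<gamma> \<alpha> = \<alpha>"
proof
  have "x \<in> adjoin \<alpha>" if "x \<in> insert \<alpha> (range to_ac)" for x
    unfolding adjoin_def by (rule generate_field.incl[OF that])
  then show "\<gamma> \<in> abs_gal \<and> \<gamma> \<alpha> = \<alpha>" if "\<gamma> \<in> gal (adjoin \<alpha>)"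
    using that by (auto simp: gal_def)
next
  assume \<gamma>: "\<gamma> \<in> abs_gal \<and> \<gamma> \<alpha> = \<alpha>"
  interpret g: field_hom \<gamma> using \<gamma> by (intro field_hom_abs_gal) simp
  interpret F: field "ring_of_type_algebra :: 'a alg_closure ring" by (rule field_from_type_algebra)
  let ?R = "ring_of_type_algebra :: 'a alg_closure ring"
  have ops: "mult ?R = (*)" "add ?R = (+)" "one ?R = 1" "zero ?R = 0" "carrier ?R = UNIV"
    by (simp_all add: ring_of_type_algebra_def)
  \<comment> \<open>The elements fixed by \<gamma> form a field, so the fixed generators
    suffice.\<close>
  have "\<gamma> x = x" if "x \<in> adjoin \<alpha>" for x
    using that unfolding adjoin_def
  proof (induction rule: generate_field.induct)
    case one
    then show ?case by (simp add: ops g.hom_one)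
  next
    case (incl h)
    then show ?case using \<gamma> abs_galD(4) by auto
  next
    case (a_inv h)
    have "h + a_inv ring_of_type_algebra h = 0"
      using F.r_neg[of h] by (simp add: ops)
    then show ?case
      using a_inv by (metis add_left_cancel g.hom_add g.hom_zero)
  next
    case (m_inv h)
    then have "h * m_inv ring_of_type_algebra h = 1"
      using F.Units_r_inv[of h] F.field_Units by (simp add: ops)
    then show ?case
      using m_inv by (metis g.hom_mult g.hom_one mult_left_cancel mult_zero_left zero_neq_one)
  next
    case (eng_add h1 h2)
    then show ?case by (simp add: ops g.hom_add)
  next
    case (eng_mult h1 h2)
    then show ?case by (simp add: ops g.hom_mult)
  qed
  then show "\<gamma> \<in> gal (adjoin \<alpha>)" using \<gamma> by (simp add: gal_def)
qed

text \<open>The smaller discrete space is a subspace of the larger one, so narrowing the values does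
  not affect continuity.\<close>

lemma gal_cocycles_restrict:
  assumes "A \<subseteq> A'"
  shows "gal_cocycles A = {u \<in> gal_cocycles A'. \<forall>\<gamma>\<in>abs_gal. u \<gamma> \<in> A}"
proof -
  have ts: "topspace krull_topology = abs_gal" by (simp add: krull_topology_def)
  have "discrete_topology A = subtopology (discrete_topology A') A"
    using assms by (simp add: Int_absorb1)
  then have "continuous_map krull_topology (discrete_topology A) u \<longleftrightarrow>
      continuous_map krull_topology (discrete_topology A') u \<and> (\<forall>\<gamma>\<in>abs_gal. u \<gamma> \<in> A)" for u
    by (auto simp: continuous_map_in_subtopology ts image_subset_iff Pi_iff simp del: subtopology_discrete_topology)
  then show ?thesis
    using assms by (auto simp: gal_cocycles_def PiE_iff)
qed

theorem proposition5p6: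
  fixes br :: "('k::field_char_0, 'n::finite) bracket"
    and B :: "'k ^ 'n \<Rightarrow> 'k ^ 'n \<Rightarrow> 'k"
    and r :: "'k ^ ('n \<times> 'n)"
    and c :: 'k
    and \<alpha> :: "'k alg_closure"
  defines "Kstar \<equiv> UNIV - {0 :: 'k}"
    and "forms \<equiv> form_classes (ext_bilin to_ac br)
                    (\<lambda>x. \<alpha> *s ext_lin to_ac (coboundary br r) x)"
  assumes "split_simple_lie br"
    and "invariant_form br B"
    and "from_split_rational_form br B"
    and "r_matrix br B r"
    and "r + flip r = c *s casimir B"
    and "c \<noteq> 0"
    and "\<alpha> \<noteq> 0"
  shows "(\<alpha> \<in> to_ac ` Kstar \<longrightarrow>
            forms \<approx> H1_gal (aut_bialgebra br (coboundary br r)))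
       \<and> (\<alpha>\<^sup>2 \<in> to_ac ` (Kstar - (\<lambda>x. x\<^sup>2) ` Kstar) \<longrightarrow>
            forms \<approx> H1_twisted br r \<alpha>)
       \<and> (\<not> \<alpha> \<in> to_ac ` Kstar \<and> \<not> \<alpha>\<^sup>2 \<in> to_ac ` (Kstar - (\<lambda>x. x\<^sup>2) ` Kstar) \<longrightarrow>
            forms = {})"
proof -
  note fh = field_hom_to_ac[where ?'a = 'k]
  interpret field_hom "to_ac :: 'k \<Rightarrow> _" by (rule fh)
  have L: "lie_algebra br" using assms(3) by (simp add: split_simple_lie_def simple_lie_def)
  have cyb: "CYB br r = 0" using assms(6) by (simp add: r_matrix_def)
  have lbr: "lie_bialgebra br (coboundary br r)"
    by (rule coboundary_lie_bialgebra[OF L assms(4) cyb assms(7)])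
  define b where "b = ext_bilin to_ac br"
  define B' where "B' = ext_form to_ac B"
  define r' where "r' = vmap to_ac r"
  define d where "d = coboundary b r'"
  have be: "bilin_extends to_ac br b"
    unfolding b_def by (rule bilin_extends_ext_bilin[OF lie_algebra_bilin[OF L]])
  have L': "lie_algebra b"
    using lie_algebra_extends_iff[OF fh be] L by blast
  have IV': "invariant_form b B'"
    unfolding B'_def by (rule invariant_form_ext[OF fh be assms(4)])
  have Z': "centroid_trivial b"
    by (rule centroid_alg_closure[OF centroid_split_simple[OF assms(3)] be])
  obtain p where "killing br p p \<noteq> 0"
    by (rule killing_from_split_rational_form[OF assms(5) lie_algebra_bilin[OF L]])
  then have kil': "killing b (vmap to_ac p) (vmap to_ac p) \<noteq> 0"
    by (simp add: killing_extends[OF fh be])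
  have cyb': "CYB b r' = 0"
    unfolding r'_def by (simp add: CYB_vmap[OF fh be] cyb vmap_zero)
  have sym': "r' + flip r' = to_ac c *s casimir B'"
    using casimir_vmap[OF fh L assms(4) L'] IV' unfolding r'_def B'_def
    by (simp add: assms(7) flip: vmap_smult vmap_add vmap_flip)
  have c': "to_ac c \<noteq> 0" using assms(8) by simp
  have d: "ext_lin to_ac (coboundary br r) = d"
    unfolding d_def r'_def by (rule lin_extends_unique[OF coboundary_extends[OF fh be], symmetric])
  note fixed_iff = twist_fixed_iff[OF L' IV' Z' kil' cyb' sym', folded d_def]
    and flip_iff = twist_flip_iff[OF L' IV' Z' kil' cyb' sym', folded d_def]
    and square = twist_square[OF L' IV' Z' kil' cyb' sym' _ c', folded d_def]
  let ?Z = "twisted_automorphisms br (coboundary br r) \<alpha>"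
  \<comment> \<open>Values in \<open>aut_lie\<close> already respect the bracket, so only the
    cobracket condition is left.\<close>
  have Z: "?Z = {u \<in> gal_cocycles (aut_lie br). \<forall>\<gamma>\<in>abs_gal. \<forall>x.
      \<gamma> \<alpha> *s tensor_map (u \<gamma>) (u \<gamma>) (d x) = \<alpha> *s d (u \<gamma> x)}"
    unfolding twisted_automorphisms_def d b_def[symmetric] lie_bialgebra_iso_def lin_smult[OF lin_tensor_map]
    by (auto simp: gal_cocycles_def aut_lie_def b_def PiE_iff)
  have iso: "lie_iso b b (u \<gamma>)" if "u \<in> gal_cocycles (aut_lie br)" "\<gamma> \<in> abs_gal" for u \<gamma>
    using that by (auto simp: gal_cocycles_def aut_lie_def b_def PiE_iff)
  have forms: "forms \<approx> ?Z // cohomologous (aut_bialgebra br (coboundary br r)) ?Z"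
    unfolding forms_def by (rule form_classes_eqpoll[OF lbr assms(9)])
  have "forms \<approx> H1_gal (aut_bialgebra br (coboundary br r))" if \<alpha>: "\<alpha> \<in> to_ac ` Kstar"
  proof -
    \<comment> \<open>As \<alpha> is Galois invariant, the scalars cancel and each value simply
      preserves the cobracket.\<close>
    have "\<gamma> \<alpha> = \<alpha>" if "\<gamma> \<in> abs_gal" for \<gamma> using \<alpha> abs_galD(4)[OF that] by auto
    then have "?Z = {u \<in> gal_cocycles (aut_lie br). \<forall>\<gamma>\<in>abs_gal. \<forall>x. tensor_map (u \<gamma>) (u \<gamma>) (d x) = d (u \<gamma> x)}"
      unfolding Z using assms(9) by (metis (no_types, lifting) vec.scale_left_imp_eq)
    moreover have "aut_bialgebra br (coboundary br r) \<subseteq> aut_lie br"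
      by (auto simp: aut_bialgebra_def aut_lie_def lie_bialgebra_iso_def)
    ultimately have "?Z = gal_cocycles (aut_bialgebra br (coboundary br r))"
      using iso by (auto simp: gal_cocycles_restrict aut_bialgebra_def lie_bialgebra_iso_def d b_def[symmetric])
    then show ?thesis using forms by (simp add: H1_gal_def)
  qed
  moreover have "forms \<approx> H1_twisted br r \<alpha>" if \<alpha>: "\<alpha>\<^sup>2 \<in> to_ac ` (Kstar - (\<lambda>x. x\<^sup>2) ` Kstar)"
  proof -
    have pm: "\<gamma> \<alpha> = \<alpha> \<or> \<gamma> \<alpha> = - \<alpha>" if g: "\<gamma> \<in> abs_gal" for \<gamma>
    proof -
      have "(\<gamma> \<alpha>)\<^sup>2 = \<gamma> (\<alpha>\<^sup>2)" by (simp add: power2_eq_square abs_galD(3)[OF g])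
      also have "\<dots> = \<alpha>\<^sup>2" using \<alpha> abs_galD(4)[OF g] by auto
      finally show ?thesis by (simp add: power2_eq_iff)
    qed
    have "(\<forall>x. \<gamma> \<alpha> *s tensor_map (u \<gamma>) (u \<gamma>) (d x) = \<alpha> *s d (u \<gamma> x)) \<longleftrightarrow>
        (\<gamma> \<alpha> = \<alpha> \<longrightarrow> tensor_map (u \<gamma>) (u \<gamma>) r' = r') \<and> (\<gamma> \<alpha> = - \<alpha> \<longrightarrow> tensor_map (u \<gamma>) (u \<gamma>) r' = flip r')"
      if u: "u \<in> gal_cocycles (aut_lie br)" "\<gamma> \<in> abs_gal" for u \<gamma>
    proof (cases "\<gamma> \<alpha> = \<alpha>")
      case True
      \<comment> \<open>Ensures that only one of the two implications on the right has a true
        premise.\<close>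
      moreover have "\<alpha> \<noteq> - \<alpha>"
      proof
        assume "\<alpha> = - \<alpha>"
        then have "2 * \<alpha> = 0" unfolding mult_2 by (simp only: eq_neg_iff_add_eq_0)
        then show False using assms(9) by simp
      qed
      ultimately show ?thesis using fixed_iff[OF iso[OF u]] assms(9) by simp
    next
      case False
      then have "\<gamma> \<alpha> = - \<alpha>" using pm[OF u(2)] by simp
      moreover have "- \<alpha> *s x = \<alpha> *s y \<longleftrightarrow> x = - y" for x y :: "'k alg_closure ^ ('n \<times> 'n)"
      proof -
        have "- \<alpha> *s x = \<alpha> *s y \<longleftrightarrow> \<alpha> *s (- x) = \<alpha> *s y" by simp
        also have "\<dots> \<longleftrightarrow> - x = y" using assms(9) by (simp only: vec.scale_cancel_left simp_thms)
        finally show ?thesis by auto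
      qed
      ultimately show ?thesis using False flip_iff[OF iso[OF u]] by simp
    qed
    then have key: "(\<forall>\<gamma>\<in>abs_gal. \<forall>x. \<gamma> \<alpha> *s tensor_map (u \<gamma>) (u \<gamma>) (d x) = \<alpha> *s d (u \<gamma> x)) \<longleftrightarrow>
        (\<forall>\<gamma>\<in>gal (adjoin \<alpha>). tensor_map (u \<gamma>) (u \<gamma>) r' = r') \<and>
        (\<forall>\<gamma>\<in>abs_gal. \<gamma> \<alpha> = - \<alpha> \<longrightarrow> tensor_map (u \<gamma>) (u \<gamma>) r' = flip r')"
      if "u \<in> gal_cocycles (aut_lie br)" for u
      unfolding abs_gal_fixing_adjoin Ball_def using that by blast
    have "?Z = twisted_cocycles br r \<alpha>"
      unfolding Z twisted_cocycles_def r'_def[symmetric] using key by blast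
    then show ?thesis using forms by (simp add: H1_twisted_def)
  qed
  moreover have "forms = {}" if \<alpha>: "\<alpha> \<notin> to_ac ` Kstar" "\<alpha>\<^sup>2 \<notin> to_ac ` (Kstar - (\<lambda>x. x\<^sup>2) ` Kstar)"
  proof -
    have "?Z = {}"
    proof (rule ccontr)
      assume "?Z \<noteq> {}"
      then obtain u where u: "u \<in> gal_cocycles (aut_lie br)"
        "\<And>\<gamma> x. \<gamma> \<in> abs_gal \<Longrightarrow> \<gamma> \<alpha> *s tensor_map (u \<gamma>) (u \<gamma>) (d x) = \<alpha> *s d (u \<gamma> x)"
        unfolding Z by blast
      \<comment> \<open>A single cocycle suffices: \<open>u \<gamma>\<close> scales the coboundary
        by \<open>\<alpha> / \<gamma> \<alpha>\<close>, and \<open>twist_square\<close> makes this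
        ratio a sign.\<close>
      have "\<gamma> (\<alpha>\<^sup>2) = \<alpha>\<^sup>2" if g: "\<gamma> \<in> abs_gal" for \<gamma>
      proof -
        have nz: "\<gamma> \<alpha> \<noteq> 0"
          using assms(9) field_hom.hom_eq_0_iff[OF field_hom_abs_gal[OF g]] by simp
        have "tensor_map (u \<gamma>) (u \<gamma>) (d x) = (\<alpha> / \<gamma> \<alpha>) *s d (u \<gamma> x)" for x
        proof -
          have "inverse (\<gamma> \<alpha>) *s (\<gamma> \<alpha> *s tensor_map (u \<gamma>) (u \<gamma>) (d x)) = inverse (\<gamma> \<alpha>) *s (\<alpha> *s d (u \<gamma> x))"
            by (simp only: u(2)[OF g])
          then show ?thesis using nz by (simp add: field_simps)
        qed
        then have "(\<alpha> / \<gamma> \<alpha>) * (\<alpha> / \<gamma> \<alpha>) = 1"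
          by (rule square[OF iso[OF u(1) g]])
        then have "\<alpha> * \<alpha> = \<gamma> \<alpha> * \<gamma> \<alpha>" using nz by (simp add: field_simps)
        then show ?thesis unfolding power2_eq_square abs_galD(3)[OF g] by (rule sym)
      qed
      then have "\<alpha>\<^sup>2 \<in> range to_ac" by (intro fixed_field_abs_gal) blast
      then obtain k where k: "\<alpha>\<^sup>2 = to_ac k" by blast
      have "k \<noteq> 0" using k assms(9) by auto
      \<comment> \<open>Excluding the nonsquares leaves a square in K, which puts \<alpha> itself in
        K, against the other exclusion.\<close>
      then have "k \<in> (\<lambda>x. x\<^sup>2) ` Kstar" using \<alpha>(2) k by (auto simp: Kstar_def)
      then obtain m where m: "k = m\<^sup>2" "m \<noteq> 0" by (auto simp: Kstar_def)
      then have "\<alpha>\<^sup>2 = (to_ac m)\<^sup>2" using k by simp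
      then have "\<alpha> = to_ac m \<or> \<alpha> = to_ac (- m)" by (simp add: power2_eq_iff)
      moreover have "m \<in> Kstar" "- m \<in> Kstar" using m(2) by (simp_all add: Kstar_def)
      ultimately show False using \<alpha>(1) by blast
    qed
    then show ?thesis
      unfolding forms_def by (rule form_classes_empty[OF lbr assms(9)])
  qed
  ultimately show ?thesis by blast
qed

end
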